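(* Let $k$ be a field and let $A = k\langle x,y,z \mid x^2+yx,\ xz,\ zy\rangle$ be the associative unital $k$-algebra with three generators $x,y,z$ and the three quadratic relations $x^2+yx=0$, $xz=0$, $zy=0$, graded by $\deg x=\deg y=\deg z=1$. Then the algebra $A$ is Koszul, and its global dimension is equal to $4$. Hence the following conjecture of Positselski is false: "Any Koszul algebra $A$ of finite global homological dimension $d$ has $\dim A_1\ge d$. Dually, for a Koszul algebra $B$ with $B_{d+1}=0$ and $B_d\neq 0$ one has $\dim B_1\ge d$." (That is, both the assertion and its dual form fail.)
   Context: Here $k\langle x,y,z\rangle$ is the free associative unital algebra (noncommutative polynomials), and $k\langle x,y,z\mid R\rangle$ is its quotient by the two-sided ideal generated by $R$. Algebras are non-negatively graded, $A=\bigoplus_{n\ge 0}A_n$, with $A_0=k$ and $\dim_k A_1<\infty$; $A_n$ denotes the homogeneous component of degree $n$. The field $k$ is viewed as an $A$-module via the augmentation $A\to A_0=k$ that annihilates all $A_n$ with $n>0$. Such an algebra is called Koszul if its bar homology $\operatorname{Tor}^A_\bullet(k,k)$ is concentrated on the diagonal, i.e. $\operatorname{Tor}^A_{i}(k,k)_j=0$ for all $i\ne j$, where $i$ is the homological degree and $j$ is the internal degree induced by the grading of $A$. The global (homological) dimension of $A$ is meant in the usual sense, as the supremum of the projective dimensions of $A$-modules. *)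

theory Defs
  imports
    "HOL-Algebra.Module"
    "HOL-Algebra.QuotRing"
    "HOL-Algebra.Algebraic_Closure_Type"
    "HOL-Library.Poly_Mapping"
    "HOL-Library.Extended_Nat"
begin

section \<open>Free algebras and their quotients\<close>

text \<open>
  Lists under concatenation form the free monoid; it has to be an instance of the additive class
  \<^class>\<open>monoid_add\<close> because the convolution product of \<^theory>\<open>HOL-Library.Poly_Mapping\<close> is
  indexed by that class.  Hence \<open>'v list \<Rightarrow>\<^sub>0 'k\<close>, with its type class multiplication, is the free
  associative unital algebra on the set \<open>'v\<close>.
\<close>

instantiation list :: (type) monoid_add
begin

definition zero_list :: "'a list" where "zero_list = []"

definition plus_list :: "'a list \<Rightarrow> 'a list \<Rightarrow> 'a list" where "plus_list = (@)"

instance by standard (simp_all add: zero_list_def plus_list_def)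

end

definition pm_scale :: "'k \<Rightarrow> ('b \<Rightarrow>\<^sub>0 'k) \<Rightarrow> ('b \<Rightarrow>\<^sub>0 'k::field)"
  where "pm_scale c p = Poly_Mapping.map ((*) c) p"

definition gen :: "'v \<Rightarrow> ('v list \<Rightarrow>\<^sub>0 'k::field)"
  where "gen v = Poly_Mapping.single [v] 1"

text \<open>
  Algebras over the field \<open>'k\<close> reuse the fields of the library record
  \<^typ>\<open>('k, 'a) module\<close>, where \<^const>\<open>module.smult\<close> is multiplication by scalars.
\<close>

record ('k, 'a) graded_algebra = "('k, 'a) module" +
  hcomp :: "nat \<Rightarrow> 'a set"

definition free_algebra :: "('k::field, 'v list \<Rightarrow>\<^sub>0 'k) graded_algebra"
  where "free_algebra =
    \<lparr>carrier = UNIV, monoid.mult = (*), one = 1, zero = 0, add = (+), module.smult = pm_scale,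
     hcomp = (\<lambda>n. {p. \<forall>w\<in>Poly_Mapping.keys p. length w = n})\<rparr>"

definition quotient_algebra ::
    "('k, 'a) graded_algebra \<Rightarrow> 'a set \<Rightarrow> ('k, 'a set) graded_algebra"
  where "quotient_algebra F I =
    \<lparr>carrier = carrier (F Quot I), monoid.mult = monoid.mult (F Quot I), one = one (F Quot I),
     zero = ring.zero (F Quot I), add = add (F Quot I),
     module.smult = (\<lambda>c K. \<Union>x\<in>K. I +>\<^bsub>F\<^esub> (c \<odot>\<^bsub>F\<^esub> x)),
     hcomp = (\<lambda>n. (\<lambda>x. I +>\<^bsub>F\<^esub> x) ` hcomp F n)\<rparr>"

text \<open>
  \<open>k\<langle>v \<in> 'v | R\<rangle>\<close>.  The family \<^const>\<open>hcomp\<close> of this record is a grading if the elements of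
  \<open>R\<close> are homogeneous.
\<close>

definition presented_algebra ::
    "('v list \<Rightarrow>\<^sub>0 'k::field) set \<Rightarrow> ('k, ('v list \<Rightarrow>\<^sub>0 'k) set) graded_algebra"
  where "presented_algebra R = quotient_algebra free_algebra (Idl\<^bsub>free_algebra\<^esub> R)"

section \<open>Connected graded algebras\<close>

definition kspan :: "('k::field, 'a) graded_algebra \<Rightarrow> 'a set \<Rightarrow> 'a set"
  where "kspan A S = \<Inter>{W. submodule W (ring_of_type_algebra :: 'k ring) A \<and> S \<subseteq> W}"

definition is_basis :: "('k::field, 'a) graded_algebra \<Rightarrow> 'a set \<Rightarrow> 'a set \<Rightarrow> bool"
  where "is_basis A B V \<longleftrightarrow>
    B \<subseteq> V \<and> kspan A B = V \<and> (\<forall>b\<in>B. b \<notin> kspan A (B - {b}))"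

text \<open>Only meaningful for subspaces \<open>V\<close> of finite dimension.\<close>

definition kdim :: "('k::field, 'a) graded_algebra \<Rightarrow> 'a set \<Rightarrow> nat"
  where "kdim A V = card (SOME B. is_basis A B V)"

locale connected_graded_algebra =
  ring A + module "ring_of_type_algebra :: 'k::field ring" A
  for A :: "('k::field, 'a) graded_algebra" (structure) +
  assumes smult_mult_left:
      "\<lbrakk>x \<in> carrier A; y \<in> carrier A\<rbrakk> \<Longrightarrow> (c \<odot> x) \<otimes> y = c \<odot> (x \<otimes> y)"
    and smult_mult_right:
      "\<lbrakk>x \<in> carrier A; y \<in> carrier A\<rbrakk> \<Longrightarrow> x \<otimes> (c \<odot> y) = c \<odot> (x \<otimes> y)"
    and hcomp_submodule: "submodule (hcomp A n) (ring_of_type_algebra :: 'k::field ring) A"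
    and direct_sum:
      "x \<in> carrier A \<Longrightarrow>
        \<exists>!f. (\<forall>n. f n \<in> hcomp A n) \<and> finite {n. f n \<noteq> \<zero>} \<and>
             x = (\<Oplus>n\<in>{n. f n \<noteq> \<zero>}. f n)"
    and hcomp_mult: "\<lbrakk>x \<in> hcomp A m; y \<in> hcomp A n\<rbrakk> \<Longrightarrow> x \<otimes> y \<in> hcomp A (m + n)"
    and one_neq_zero: "\<one> \<noteq> \<zero>"
    and hcomp_0: "hcomp A 0 = {c \<odot> \<one> | c. True}"
    and finite_dim_hcomp_1: "\<exists>B. finite B \<and> is_basis A B (hcomp A 1)"

section \<open>Bar homology and Koszulness\<close>

text \<open>
  The reduced bar complex of a connected graded algebra has \<open>A\<^sub>+\<^bsup>\<otimes>i\<^esup>\<close> in homological degree \<open>i\<close>.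
  We write its part of internal degree \<open>j\<close> as \<open>bar_free A i j / bar_multilin A i j\<close>: the vector
  space freely generated by the symbols \<open>[a\<^sub>1|\<dots>|a\<^sub>i]\<close> (lists of homogeneous elements of
  positive degree with sum of degrees \<open>j\<close>) modulo the relations of multilinearity.
\<close>

definition pm_span :: "('b \<Rightarrow>\<^sub>0 'k::field) set \<Rightarrow> ('b \<Rightarrow>\<^sub>0 'k) set"
  where "pm_span = Modules.module.span pm_scale"

definition bar :: "'a list \<Rightarrow> ('a list \<Rightarrow>\<^sub>0 'k::field)"
  where "bar as = Poly_Mapping.single as 1"

definition has_degrees :: "('k, 'a) graded_algebra \<Rightarrow> 'a list \<Rightarrow> nat list \<Rightarrow> bool"
  where "has_degrees A as ns \<longleftrightarrow> list_all2 (\<lambda>a n. 0 < n \<and> a \<in> hcomp A n) as ns"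

definition bar_free ::
    "('k::field, 'a) graded_algebra \<Rightarrow> nat \<Rightarrow> nat \<Rightarrow> ('a list \<Rightarrow>\<^sub>0 'k) set"
  where "bar_free A i j =
    pm_span {bar as | as ns. has_degrees A as ns \<and> length ns = i \<and> sum_list ns = j}"

definition bar_multilin ::
    "('k::field, 'a) graded_algebra \<Rightarrow> nat \<Rightarrow> nat \<Rightarrow> ('a list \<Rightarrow>\<^sub>0 'k) set"
  where "bar_multilin A i j =
    pm_span {bar (as @ [(c \<odot>\<^bsub>A\<^esub> a) \<oplus>\<^bsub>A\<^esub> b] @ bs)
              - pm_scale c (bar (as @ [a] @ bs)) - bar (as @ [b] @ bs)
            | as a b bs c ns m ns'.
              has_degrees A as ns \<and> has_degrees A [a] [m] \<and> has_degrees A [b] [m] \<and>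
              has_degrees A bs ns' \<and> length (ns @ [m] @ ns') = i \<and>
              sum_list (ns @ [m] @ ns') = j}"

text \<open>
  \<open>d[a\<^sub>1|\<dots>|a\<^sub>i] = \<Sum>\<^bsub>0<l<i\<^esub> (-1)\<^sup>l [a\<^sub>1|\<dots>|a\<^sub>l a\<^bsub>l+1\<^esub>|\<dots>|a\<^sub>i]\<close>, extended linearly.  The two outer
  faces of the bar construction vanish since the augmentation annihilates \<open>A\<^sub>+\<close>.  In the formal
  definition list positions are counted from 0.
\<close>

definition bar_face :: "('k, 'a) graded_algebra \<Rightarrow> nat \<Rightarrow> 'a list \<Rightarrow> 'a list"
  where "bar_face A l as = take l as @ [as ! l \<otimes>\<^bsub>A\<^esub> as ! Suc l] @ drop (l + 2) as"

definition bar_diff ::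
    "('k::field, 'a) graded_algebra \<Rightarrow> ('a list \<Rightarrow>\<^sub>0 'k) \<Rightarrow> ('a list \<Rightarrow>\<^sub>0 'k)"
  where "bar_diff A p =
    (\<Sum>as\<in>Poly_Mapping.keys p. pm_scale (Poly_Mapping.lookup p as)
       (\<Sum>l<length as - 1. pm_scale ((-1) ^ Suc l) (bar (bar_face A l as))))"

text \<open>
  Cycles and boundaries of the quotient complex, as subspaces of \<^const>\<open>bar_free\<close> containing
  \<^const>\<open>bar_multilin\<close>.  In homological degree 0 the differential is 0, so there every chain is
  a cycle although \<open>i - 1\<close> is then truncated.
\<close>

definition bar_cycles ::
    "('k::field, 'a) graded_algebra \<Rightarrow> nat \<Rightarrow> nat \<Rightarrow> ('a list \<Rightarrow>\<^sub>0 'k) set"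
  where "bar_cycles A i j = {p \<in> bar_free A i j. bar_diff A p \<in> bar_multilin A (i - 1) j}"

definition bar_boundaries ::
    "('k::field, 'a) graded_algebra \<Rightarrow> nat \<Rightarrow> nat \<Rightarrow> ('a list \<Rightarrow>\<^sub>0 'k) set"
  where "bar_boundaries A i j =
    {bar_diff A q + r | q r. q \<in> bar_free A (Suc i) j \<and> r \<in> bar_multilin A i j}"

text \<open>The elements of \<open>Tor\<^sub>i\<^sup>A(k,k)\<^sub>j\<close> are cosets; its zero is \<open>bar_boundaries A i j\<close>.\<close>

definition Tor ::
    "('k::field, 'a) graded_algebra \<Rightarrow> nat \<Rightarrow> nat \<Rightarrow> ('a list \<Rightarrow>\<^sub>0 'k) set set"
  where "Tor A i j = (\<lambda>z. (+) z ` bar_boundaries A i j) ` bar_cycles A i j"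

definition koszul :: "('k::field, 'a) graded_algebra \<Rightarrow> bool"
  where "koszul A \<longleftrightarrow>
    connected_graded_algebra A \<and> (\<forall>i j. i \<noteq> j \<longrightarrow> Tor A i j = {bar_boundaries A i j})"

section \<open>Global dimension\<close>

text \<open>
  The library locale \<^locale>\<open>module\<close> is restricted to commutative rings; this is its analogue
  for left modules over arbitrary rings.
\<close>

locale left_module = R?: ring R + M?: abelian_group M
  for R :: "('a, 'r) ring_scheme" (structure) and M :: "('a, 'm) module" (structure) +
  assumes smult_closed:
      "\<lbrakk>a \<in> carrier R; x \<in> carrier M\<rbrakk> \<Longrightarrow> a \<odot>\<^bsub>M\<^esub> x \<in> carrier M"
    and smult_l_distr:
      "\<lbrakk>a \<in> carrier R; b \<in> carrier R; x \<in> carrier M\<rbrakk> \<Longrightarrow>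
        (a \<oplus> b) \<odot>\<^bsub>M\<^esub> x = a \<odot>\<^bsub>M\<^esub> x \<oplus>\<^bsub>M\<^esub> b \<odot>\<^bsub>M\<^esub> x"
    and smult_r_distr:
      "\<lbrakk>a \<in> carrier R; x \<in> carrier M; y \<in> carrier M\<rbrakk> \<Longrightarrow>
        a \<odot>\<^bsub>M\<^esub> (x \<oplus>\<^bsub>M\<^esub> y) = a \<odot>\<^bsub>M\<^esub> x \<oplus>\<^bsub>M\<^esub> a \<odot>\<^bsub>M\<^esub> y"
    and smult_assoc1:
      "\<lbrakk>a \<in> carrier R; b \<in> carrier R; x \<in> carrier M\<rbrakk> \<Longrightarrow>
        (a \<otimes> b) \<odot>\<^bsub>M\<^esub> x = a \<odot>\<^bsub>M\<^esub> (b \<odot>\<^bsub>M\<^esub> x)"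
    and smult_one: "x \<in> carrier M \<Longrightarrow> \<one> \<odot>\<^bsub>M\<^esub> x = x"

definition module_hom ::
    "('a, 'r) ring_scheme \<Rightarrow> ('a, 'm) module \<Rightarrow> ('a, 'n) module \<Rightarrow> ('m \<Rightarrow> 'n) set"
  where "module_hom R M N =
    {f \<in> carrier M \<rightarrow> carrier N.
      (\<forall>x\<in>carrier M. \<forall>y\<in>carrier M. f (x \<oplus>\<^bsub>M\<^esub> y) = f x \<oplus>\<^bsub>N\<^esub> f y) \<and>
      (\<forall>a\<in>carrier R. \<forall>x\<in>carrier M. f (a \<odot>\<^bsub>M\<^esub> x) = a \<odot>\<^bsub>N\<^esub> f x)}"

text \<open>
  The type \<open>'m\<close> of module elements plays the role of a universe: all modules, including test
  modules for projectivity and terms of resolutions, are carried by subsets of \<open>'m\<close>.  If \<open>'m\<close> is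
  infinite and at least as large as \<open>R\<close>, every module in \<open>'m\<close> is a quotient of a free
  module in \<open>'m\<close>, so projectivity and projective dimension relative to \<open>'m\<close> are the absolute ones.
\<close>

definition projective :: "('a, 'r) ring_scheme \<Rightarrow> ('a, 'm) module \<Rightarrow> bool"
  where "projective R P \<longleftrightarrow> left_module R P \<and>
    (\<forall>(M :: ('a, 'm) module) (N :: ('a, 'm) module) g f.
      left_module R M \<and> left_module R N \<and>
      g \<in> module_hom R M N \<and> g ` carrier M = carrier N \<and> f \<in> module_hom R P N \<longrightarrow>
      (\<exists>h\<in>module_hom R P M. \<forall>x\<in>carrier P. g (h x) = f x))"

text \<open>An exact sequence \<open>\<dots> \<rightarrow> P 1 \<rightarrow> P 0 \<rightarrow> M \<rightarrow> 0\<close> with maps \<open>d i : P (i + 1) \<rightarrow> P i\<close> and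
  \<open>e : P 0 \<rightarrow> M\<close>.\<close>

definition projective_resolution ::
    "('a, 'r) ring_scheme \<Rightarrow> ('a, 'm) module \<Rightarrow>
     (nat \<Rightarrow> ('a, 'm) module) \<Rightarrow> (nat \<Rightarrow> 'm \<Rightarrow> 'm) \<Rightarrow> ('m \<Rightarrow> 'm) \<Rightarrow> bool"
  where "projective_resolution R M P d e \<longleftrightarrow>
    (\<forall>i. projective R (P i)) \<and>
    (\<forall>i. d i \<in> module_hom R (P (Suc i)) (P i)) \<and>
    e \<in> module_hom R (P 0) M \<and>
    e ` carrier (P 0) = carrier M \<and>
    d 0 ` carrier (P 1) = {x \<in> carrier (P 0). e x = \<zero>\<^bsub>M\<^esub>} \<and>
    (\<forall>i. d (Suc i) ` carrier (P (Suc (Suc i))) =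
         {x \<in> carrier (P (Suc i)). d i x = \<zero>\<^bsub>P i\<^esub>})"

text \<open>The infimum of the empty set is \<open>\<infinity>\<close>; the zero module gets projective dimension 0.\<close>

definition proj_dim :: "('a, 'r) ring_scheme \<Rightarrow> ('a, 'm) module \<Rightarrow> enat"
  where "proj_dim R M =
    Inf {enat n | n. \<exists>P d e. projective_resolution R M P d e \<and>
                             (\<forall>i>n. carrier (P i) = {\<zero>\<^bsub>P i\<^esub>})}"

definition gldim :: "'m itself \<Rightarrow> ('a, 'r) ring_scheme \<Rightarrow> enat"
  where "gldim _ R = (SUP M \<in> {M :: ('a, 'm) module. left_module R M}. proj_dim R M)"

section \<open>Positselski's conjecture\<close>

text \<open>
  For algebras over \<open>'k\<close> with elements in \<open>'a\<close>, and modules with elements in \<open>'m\<close>.  A failure for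
  one type \<open>'a\<close> refutes the conjecture.  The type \<open>'m\<close> should be infinite and at least as large as
  \<open>'k\<close>: a Koszul algebra is generated by its finite-dimensional component of degree 1, so
  it then has at most as many elements as \<open>'m\<close>.
\<close>

definition positselski_conjecture :: "'k::field itself \<Rightarrow> 'a itself \<Rightarrow> 'm itself \<Rightarrow> bool"
  where "positselski_conjecture _ _ U \<longleftrightarrow>
    (\<forall>(A :: ('k, 'a) graded_algebra) d.
      koszul A \<and> gldim U A = enat d \<longrightarrow> kdim A (hcomp A 1) \<ge> d)"

definition positselski_conjecture_dual :: "'k::field itself \<Rightarrow> 'a itself \<Rightarrow> bool"
  where "positselski_conjecture_dual _ _ \<longleftrightarrow>
    (\<forall>(B :: ('k, 'a) graded_algebra) d.
      koszul B \<and> hcomp B (d + 1) = {\<zero>\<^bsub>B\<^esub>} \<and> hcomp B d \<noteq> {\<zero>\<^bsub>B\<^esub>} \<longrightarrow>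
      kdim B (hcomp B 1) \<ge> d)"

datatype generator = gx | gy | gz

end

theory Submission
  imports Defs "HOL-Library.Product_Plus"
begin

text \<open>
  Put \<open>u = x + y\<close>, so that the relations are \<open>u x = x z = z y = 0\<close>.  A normal form computation shows that
  \<open>A\<^sub>+ = u A \<oplus> x A \<oplus> z A\<close> and that the right annihilators of \<open>u, x, z, y\<close> are \<open>x A, z A, y A, 0\<close>.
  These right ideals form a Koszul filtration, and the contraction of the bar resolution turns it
  into the vanishing of the off-diagonal \<open>Tor\<close>.  The dual algebra has dimensions \<open>1, 3, 3, 2, 1\<close> and
  a Koszul filtration of its own.

  For a left module \<open>M\<close> the Koszul complex \<open>A \<otimes> V\<^sub>i \<otimes> M\<close>, with \<open>dim V\<^sub>i = 1, 3, 3, 2, 1\<close>, is a free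
  resolution: on top components of the first factor it is governed by the left annihilators
  \<open>0, A u, A x, A z\<close> of \<open>u, x, z, y\<close>.  So the global dimension is at most \<open>4\<close>.  It is at least \<open>4\<close>
  because in a projective module \<open>u p = 0\<close>, \<open>x p = 0\<close>, \<open>z p = 0\<close>, \<open>y p = 0\<close> force \<open>p\<close> into
  \<open>x P, z P, y P, 0\<close>: lifting \<open>1 \<in> k\<close> and its multiples by \<open>y, z, x\<close> through a shorter resolution of
  \<open>k\<close> and then descending again yields that \<open>1\<close> is zero.
\<close>

section \<open>Finitely supported functions\<close>

text \<open>The counterexample rests on one coincidence: the chain \<open>u, x, z, y\<close> of
  successive annihilators has four members, but \<open>u = x + y\<close>, so they span a space of
  dimension only 3. The word \<open>u x z y\<close> then gives a syzygy in homological degree 4, one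
  more than the dimension of A_1.

  The sign change of y (and of u in the dual) makes every product of two normal words a normal word
  or 0, without coefficients. Both algebras are thus contracted monoid algebras, and a single bar
  resolution with a monomial basis serves both.

  Two encodings shape the rest. \<open>Tor\<close> is defined by formal symbols modulo
  multilinearity, so it has to be compared with the monomial resolution; the comparison shifts the
  homological degree by one, A_+^(i+1) being placed inside A \<otimes> A_+^i. Modules are records
  with elements in a fixed universe: a k-basis B of M is built by hand, A \<otimes> M is replaced by
  the finitely supported functions from B to A, and each term of a resolution is injected into the
  universe.\<close>

lemma additiveI:
  fixes f :: "'a::ab_group_add \<Rightarrow> 'b::ab_group_add"
  shows "(\<And>x y. f (x + y) = f x + f y) \<Longrightarrow> additive f"
  by (simp add: additive_def)

lemma additiveD:
  fixes f :: "'a::ab_group_add \<Rightarrow> 'b::ab_group_add"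
  assumes "additive f"
  shows "f (x + y) = f x + f y" "f 0 = 0" "f (- x) = - f x" "f (x - y) = f x - f y"
    "f (sum g A) = (\<Sum>a\<in>A. f (g a))"
  using assms additive.add additive.zero additive.minus additive.diff additive.sum by blast+

lemma additive_compose:
  fixes f :: "'b::ab_group_add \<Rightarrow> 'c::ab_group_add" and g :: "'a::ab_group_add \<Rightarrow> 'b"
  shows "additive f \<Longrightarrow> additive g \<Longrightarrow> additive (\<lambda>x. f (g x))"
  by (simp add: additive_def)

lemma additive_zero: "additive (\<lambda>x. 0 :: 'b::ab_group_add)"
  and additive_id: "additive (\<lambda>x. x :: 'b)"
  by (simp_all add: additive_def)

lemma additive_times_left: "additive (\<lambda>x. a * (x::'a::ring))"
  and additive_times_right: "additive (\<lambda>x. (x::'a::ring) * a)"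
  by (simp_all add: additive_def algebra_simps)

lemma additive_single: "additive (Poly_Mapping.single b :: 'a::ab_group_add \<Rightarrow> _)"
  by (simp add: additive_def single_add)

lemma pm_sum_single:
  "(\<Sum>b\<in>Poly_Mapping.keys p. Poly_Mapping.single b (Poly_Mapping.lookup p b)) = p"
  by (rule poly_mapping_eqI)
    (simp add: lookup_sum lookup_single when_def sum.delta' in_keys_iff)

lemma pm_induct_keys [consumes 1, case_names zero add single]:
  fixes p :: "'b \<Rightarrow>\<^sub>0 'c::comm_monoid_add"
  assumes "Poly_Mapping.keys p \<subseteq> K" and "P 0" and "\<And>p q. P p \<Longrightarrow> P q \<Longrightarrow> P (p + q)"
    and "\<And>b c. b \<in> K \<Longrightarrow> P (Poly_Mapping.single b c)"
  shows "P p"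
proof -
  have "P (\<Sum>b\<in>S. Poly_Mapping.single b (Poly_Mapping.lookup p b))" if "finite S" "S \<subseteq> K" for S
    using that by (induction S rule: finite_induct) (auto intro: assms)
  from this[OF finite_keys assms(1)] show ?thesis by (simp add: pm_sum_single)
qed

lemma pm_additive_eq:
  fixes f g :: "('b \<Rightarrow>\<^sub>0 'c::ab_group_add) \<Rightarrow> 'd::ab_group_add"
  assumes "additive f" "additive g" "Poly_Mapping.keys p \<subseteq> K"
    and "\<And>b c. b \<in> K \<Longrightarrow> f (Poly_Mapping.single b c) = g (Poly_Mapping.single b c)"
  shows "f p = g p"
  using assms(3) by (induction rule: pm_induct_keys) (simp_all add: assms additiveD[OF assms(1)] additiveD[OF assms(2)])

lemma keys_diff_subset:
  fixes p q :: "'b \<Rightarrow>\<^sub>0 'c::ab_group_add"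
  shows "Poly_Mapping.keys (p - q) \<subseteq> Poly_Mapping.keys p \<union> Poly_Mapping.keys q"
  by (auto simp: in_keys_iff lookup_minus)

lemma keys_uminus_eq:
  fixes p :: "'b \<Rightarrow>\<^sub>0 'c::ab_group_add"
  shows "Poly_Mapping.keys (- p) = Poly_Mapping.keys p"
  by (auto simp: in_keys_iff)

text \<open>Coefficients lie in any abelian group and each \<open>\<phi> b\<close> need only be
  additive, so that one operator covers k-linear maps as well as maps out of free modules over the
  noncommutative algebras below.\<close>

definition lin :: "('b \<Rightarrow> 'c \<Rightarrow> 'd) \<Rightarrow> ('b \<Rightarrow>\<^sub>0 'c::ab_group_add) \<Rightarrow> 'd::ab_group_add"
  where "lin \<phi> p = (\<Sum>b\<in>Poly_Mapping.keys p. \<phi> b (Poly_Mapping.lookup p b))"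

lemma lin_superset:
  assumes "\<And>b. additive (\<phi> b)" "finite S" "Poly_Mapping.keys p \<subseteq> S"
  shows "lin \<phi> p = (\<Sum>b\<in>S. \<phi> b (Poly_Mapping.lookup p b))"
  unfolding lin_def using assms(2,3)
  by (intro sum.mono_neutral_left) (auto simp: in_keys_iff additiveD(2)[OF assms(1)])

lemma additive_lin:
  assumes "\<And>b. additive (\<phi> b)"
  shows "additive (lin \<phi>)"
proof (rule additiveI)
  fix p q :: "'a \<Rightarrow>\<^sub>0 'b"
  let ?S = "Poly_Mapping.keys p \<union> Poly_Mapping.keys q"
  have "lin \<phi> (p + q) = (\<Sum>b\<in>?S. \<phi> b (Poly_Mapping.lookup (p + q) b))"
    using keys_add[of p q] by (intro lin_superset assms) auto
  also have "\<dots> = (\<Sum>b\<in>?S. \<phi> b (Poly_Mapping.lookup p b)) + (\<Sum>b\<in>?S. \<phi> b (Poly_Mapping.lookup q b))"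
    by (simp add: lookup_add additiveD[OF assms] sum.distrib)
  also have "\<dots> = lin \<phi> p + lin \<phi> q"
    by (subst (1 2) lin_superset[OF assms, where S="?S"]) auto
  finally show "lin \<phi> (p + q) = lin \<phi> p + lin \<phi> q" .
qed

lemma lin_single:
  assumes "\<And>b. additive (\<phi> b)"
  shows "lin \<phi> (Poly_Mapping.single b c) = \<phi> b c"
  by (subst lin_superset[OF assms, where S="{b}"]) auto

lemma lin_add_fun:
  "lin (\<lambda>b c. \<phi> b c + \<psi> b c) p = lin \<phi> p + lin \<psi> p"
  by (simp add: lin_def sum.distrib)

lemma keys_sum_subset: "Poly_Mapping.keys (sum f S) \<subseteq> (\<Union>s\<in>S. Poly_Mapping.keys (f s))"
proof (cases "finite S")
  case True
  then show ?thesis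
  proof (induction S rule: finite_induct)
    case (insert x F)
    then show ?case using keys_add[of "f x" "sum f F"] by auto
  qed simp
qed simp

lemma keys_lin:
  "Poly_Mapping.keys (lin \<phi> p) \<subseteq> (\<Union>b\<in>Poly_Mapping.keys p. Poly_Mapping.keys (\<phi> b (Poly_Mapping.lookup p b)))"
  unfolding lin_def by (rule keys_sum_subset)

text \<open>Renaming basis vectors without collisions loses no coefficient; this makes the encoding
  of the dual algebra injective.\<close>

lemma lin_inj_single_zero:
  assumes "lin (\<lambda>b. Poly_Mapping.single (\<tau> b)) p = 0" "inj_on \<tau> (Poly_Mapping.keys p)"
  shows "p = 0"
proof (rule poly_mapping_eqI)
  fix b
  show "Poly_Mapping.lookup p b = Poly_Mapping.lookup 0 b"
  proof (cases "b \<in> Poly_Mapping.keys p")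
    case True
    have "0 = (\<Sum>a\<in>Poly_Mapping.keys p. Poly_Mapping.lookup p a when \<tau> a = \<tau> b)"
      using arg_cong[OF assms(1), of "\<lambda>q. Poly_Mapping.lookup q (\<tau> b)"]
      by (simp add: lin_def lookup_sum lookup_single)
    also have "\<dots> = (\<Sum>a\<in>Poly_Mapping.keys p. Poly_Mapping.lookup p a when a = b)"
      using inj_onD[OF assms(2)] True by (intro sum.cong) (auto simp: when_def)
    also have "\<dots> = Poly_Mapping.lookup p b" using True by (simp add: when_def)
    finally show ?thesis by simp
  qed (simp add: in_keys_iff)
qed

section \<open>Contracted monoid algebras\<close>

text \<open>
  A monoid with zero whose product of nonzero elements is a partial operation: \<open>zmult a b = None\<close>
  means \<open>a b = 0\<close>.
\<close>

class zmonoid =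
  fixes zmult :: "'a \<Rightarrow> 'a \<Rightarrow> 'a option" and zone :: 'a and zdeg :: "'a \<Rightarrow> nat"
  assumes zassoc: "Option.bind (zmult a b) (\<lambda>u. zmult u c) = Option.bind (zmult b c) (zmult a)"
    and zone_left [simp]: "zmult zone a = Some a"
    and zone_right [simp]: "zmult a zone = Some a"
    and zdeg_zmult: "zmult a b = Some c \<Longrightarrow> zdeg c = zdeg a + zdeg b"
    and zdeg_eq_0: "zdeg a = 0 \<longleftrightarrow> a = zone"
    and finite_zdeg_1: "finite {a. zdeg a = Suc 0}"

lemma zdeg_zone [simp]: "zdeg zone = 0"
  by (simp add: zdeg_eq_0)

text \<open>A fresh copy of \<open>'w \<Rightarrow>\<^sub>0 'k\<close>: the type-class product on
  the original is convolution over \<open>monoid_add\<close>, whereas here a product of basis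
  elements may be zero.\<close>

typedef (overloaded) ('w, 'k::zero) malg = "UNIV :: ('w \<Rightarrow>\<^sub>0 'k) set"
  morphisms cf Mk ..

lemma cf_Mk [simp]: "cf (Mk p) = p" and Mk_cf [simp]: "Mk (cf f) = f"
  by (simp_all add: cf_inverse Mk_inverse)

lemma malg_eq_iff: "f = g \<longleftrightarrow> cf f = cf g"
  by (simp add: cf_inject)

definition zs :: "'w option \<Rightarrow> 'k::field \<Rightarrow> 'w \<Rightarrow>\<^sub>0 'k"
  where "zs o' c = (case o' of None \<Rightarrow> 0 | Some w \<Rightarrow> Poly_Mapping.single w c)"

lemma additive_zs: "additive (zs o')"
  by (cases o') (simp_all add: zs_def additive_def single_add)

instantiation malg :: (zmonoid, field) ring_1
begin

definition "0 = Mk 0"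
definition "1 = Mk (Poly_Mapping.single zone 1)"
definition "f + g = Mk (cf f + cf g)"
definition "f - g = Mk (cf f - cf g)"
definition "- f = Mk (- cf f)"
definition "f * g =
  Mk (lin (\<lambda>v c. lin (\<lambda>w d. zs (zmult v w) (c * d)) (cf g)) (cf f))"

lemma additive_prod_right: "additive (lin (\<lambda>w d. zs (zmult v w) (c * d)))" for c :: "'b"
  by (intro additive_lin additive_compose[OF additive_zs additive_times_left])

lemma additive_prod_left: "additive (\<lambda>c. lin (\<lambda>w d. zs (zmult v w) (c * d)) q)" for q :: "'a \<Rightarrow>\<^sub>0 'b"
proof -
  have "additive (\<lambda>c. zs (zmult v w) (c * d))" for w and d :: 'b
    by (intro additive_compose[OF additive_zs additive_times_right])
  then show ?thesis by (simp add: additive_def lin_def sum.distrib)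
qed

lemma cf_times_single:
  "cf (Mk (Poly_Mapping.single v c) * Mk (Poly_Mapping.single w d)) = zs (zmult v w) (c * d)"
  for c d :: 'b
  unfolding times_malg_def cf_Mk
  by (subst lin_single[OF additive_prod_left], subst lin_single)
    (intro additive_compose[OF additive_zs additive_times_left] refl)+

lemma malg_induct_aux:
  fixes f :: "('a, 'b) malg"
  assumes "P (Mk 0)" "\<And>p q. P (Mk p) \<Longrightarrow> P (Mk q) \<Longrightarrow> P (Mk (p + q))"
    "\<And>w c. P (Mk (Poly_Mapping.single w c))"
  shows "P f"
proof -
  have "P (Mk p)" for p
    by (rule pm_induct_keys[where K=UNIV]) (auto intro: assms)
  then show ?thesis using Mk_cf by metis
qed

lemma malg_distrib_left: "f * (g + h) = f * g + f * h" for f g h :: "('a, 'b) malg"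
  unfolding times_malg_def plus_malg_def
  by (simp add: additiveD(1)[OF additive_prod_right] lin_add_fun)

lemma malg_distrib_right: "(f + g) * h = f * h + g * h" for f g h :: "('a, 'b) malg"
  unfolding times_malg_def plus_malg_def
  by (simp add: additiveD(1)[OF additive_lin[OF additive_prod_left]])

lemma Mk_add: "Mk (p + q) = Mk p + Mk q" for p q :: "'a \<Rightarrow>\<^sub>0 'b"
  by (simp add: plus_malg_def)

lemma malg_mult_zero: "Mk 0 * f = Mk 0" "f * Mk 0 = Mk 0" for f :: "('a, 'b) malg"
  unfolding times_malg_def
  by (simp_all add: additiveD(2)[OF additive_prod_right] additiveD(2)[OF additive_lin[OF additive_prod_left]])
     (simp add: lin_def)

lemma malg_times_single:
  "Mk (Poly_Mapping.single v c) * Mk (Poly_Mapping.single w d) = Mk (zs (zmult v w) (c * d))"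
  for c d :: 'b
  using cf_times_single[of v c w d] by (simp add: malg_eq_iff)

lemma malg_assoc: "f * g * h = f * (g * h)" for f g h :: "('a, 'b) malg"
proof (induction f rule: malg_induct_aux)
  case (3 u c)
  show ?case
  proof (induction g rule: malg_induct_aux)
    case (3 v d)
    show ?case
    proof (induction h rule: malg_induct_aux)
      case (3 w e)
      show ?case
        using zassoc[of u v w]
        by (cases "zmult u v"; cases "zmult v w")
          (auto simp: malg_times_single zs_def malg_mult_zero mult.assoc split: option.splits)
    qed (simp_all add: malg_mult_zero Mk_add malg_distrib_left)
  qed (simp_all add: malg_mult_zero Mk_add malg_distrib_left malg_distrib_right)
qed (simp_all add: malg_mult_zero Mk_add malg_distrib_right)

instance
proof
  fix f g h :: "('a, 'b) malg"
  show "f * g * h = f * (g * h)" by (rule malg_assoc)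
  show "1 * f = f"
    unfolding one_malg_def
    by (induction f rule: malg_induct_aux) (simp_all add: malg_mult_zero Mk_add malg_distrib_left malg_times_single zs_def)
  show "f * 1 = f"
    unfolding one_malg_def
    by (induction f rule: malg_induct_aux) (simp_all add: malg_mult_zero Mk_add malg_distrib_right malg_times_single zs_def)
  show "(0::('a, 'b) malg) \<noteq> 1"
    by (simp add: zero_malg_def one_malg_def malg_eq_iff)
      (metis lookup_single_eq lookup_zero zero_neq_one)
  show "f + g + h = f + (g + h)" "f + g = g + f" "0 + f = f" "- f + f = 0" "f - g = f + - g"
    by (simp_all add: zero_malg_def plus_malg_def minus_malg_def uminus_malg_def malg_eq_iff algebra_simps)
qed (simp_all add: malg_distrib_left malg_distrib_right)

end

lemma cf_0 [simp]: "cf 0 = 0" and cf_add [simp]: "cf (f + g) = cf f + cf g"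
  and cf_diff [simp]: "cf (f - g) = cf f - cf g" and cf_minus [simp]: "cf (- f) = - cf f"
  by (simp_all add: zero_malg_def plus_malg_def minus_malg_def uminus_malg_def)

lemma additive_cf: "additive (cf :: ('w::zmonoid, 'k::field) malg \<Rightarrow> _)"
  by (simp add: additive_def)

definition mon :: "'w \<Rightarrow> 'k \<Rightarrow> ('w::zmonoid, 'k::field) malg"
  where "mon w c = Mk (Poly_Mapping.single w c)"

definition zmon :: "'w option \<Rightarrow> 'k \<Rightarrow> ('w::zmonoid, 'k::field) malg"
  where "zmon o' c = (case o' of None \<Rightarrow> 0 | Some w \<Rightarrow> mon w c)"

lemma zmon_simps [simp]: "zmon None c = 0" "zmon (Some w) c = mon w c"
  by (simp_all add: zmon_def)

lemma cf_mon [simp]: "cf (mon w c) = Poly_Mapping.single w c"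
  by (simp add: mon_def)

lemma mon_times: "mon v c * mon w d = zmon (zmult v w) (c * d)"
  by (cases "zmult v w") (simp_all add: mon_def malg_times_single zs_def zero_malg_def)

lemma mon_zero [simp]: "mon w 0 = 0" and mon_add: "mon w (c + d) = mon w c + mon w d"
  by (simp_all add: malg_eq_iff single_add)

lemma mon_minus: "mon w (- c) = - mon w c"
  by (simp add: malg_eq_iff single_uminus)

lemma additive_mon: "additive (mon w)"
  by (simp add: additive_def mon_add)

lemma mon_zone_one: "mon zone 1 = 1"
  by (simp add: mon_def one_malg_def)

abbreviation supp :: "('w, 'k::zero) malg \<Rightarrow> 'w set"
  where "supp f \<equiv> Poly_Mapping.keys (cf f)"

abbreviation coeff :: "('w, 'k::zero) malg \<Rightarrow> 'w \<Rightarrow> 'k"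
  where "coeff f \<equiv> Poly_Mapping.lookup (cf f)"

lemma malg_induct [consumes 1, case_names zero add mon]:
  fixes f :: "('w::zmonoid, 'k::field) malg"
  assumes "supp f \<subseteq> K" "P 0" "\<And>p q. P p \<Longrightarrow> P q \<Longrightarrow> P (p + q)" "\<And>w c. w \<in> K \<Longrightarrow> P (mon w c)"
  shows "P f"
proof -
  have "P (Mk p)" if "Poly_Mapping.keys p \<subseteq> K" for p
    using that
  proof (induction rule: pm_induct_keys)
    case (add p q)
    then show ?case using assms(3)[of "Mk p" "Mk q"] by (simp add: plus_malg_def)
  qed (use assms in \<open>auto simp: zero_malg_def mon_def\<close>)
  from this[OF assms(1)] show ?thesis by simp
qed

lemma malg_additive_eq:
  fixes f g :: "('w::zmonoid, 'k::field) malg \<Rightarrow> 'd::ab_group_add"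
  assumes "additive f" "additive g" "supp p \<subseteq> K" and "\<And>w c. w \<in> K \<Longrightarrow> f (mon w c) = g (mon w c)"
  shows "f p = g p"
  using assms(3)
  by (induction rule: malg_induct) (simp_all add: assms additiveD[OF assms(1)] additiveD[OF assms(2)])

lemma malg_sum_mon: "(\<Sum>w\<in>supp f. mon w (coeff f w)) = (f :: ('w::zmonoid, 'k::field) malg)"
proof -
  have "cf (\<Sum>w\<in>supp f. mon w (coeff f w)) = (\<Sum>w\<in>supp f. cf (mon w (coeff f w)))"
    by (rule additiveD(5)[OF additive_cf])
  then show ?thesis by (simp add: malg_eq_iff pm_sum_single)
qed

abbreviation scal :: "'k \<Rightarrow> ('w::zmonoid, 'k::field) malg"
  where "scal \<equiv> mon zone"

lemma scal_times_mon: "scal c * mon w d = mon w (c * d)"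
  and mon_times_scal: "mon w d * scal c = mon w (d * c)"
  by (simp_all add: mon_times)

lemma scal_central: "scal c * f = f * scal c"
proof -
  have "supp f \<subseteq> UNIV" by simp
  then show ?thesis
    by (rule malg_additive_eq[OF additive_times_left additive_times_right])
      (simp add: scal_times_mon mon_times_scal mult.commute)
qed

lemma coeff_scal_times: "coeff (scal c * f) w = c * coeff f w"
proof -
  have "supp f \<subseteq> UNIV" by simp
  then show ?thesis
    by (induction rule: malg_induct)
      (simp_all add: scal_times_mon distrib_left lookup_add lookup_single when_def)
qed

lemma scal_add: "scal (c + d) = scal c + scal d" by (rule mon_add)
lemma scal_mult: "scal (c * d) = scal c * scal d" by (simp add: mon_times)

section \<open>Homogeneous elements and homogeneous components\<close>

definition hom :: "nat \<Rightarrow> ('w::zmonoid, 'k::field) malg set"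
  where "hom n = {f. \<forall>w\<in>supp f. zdeg w = n}"

lemma hom_0 [simp]: "0 \<in> hom n"
  and hom_add: "f \<in> hom n \<Longrightarrow> g \<in> hom n \<Longrightarrow> f + g \<in> hom n"
  and hom_diff: "f \<in> hom n \<Longrightarrow> g \<in> hom n \<Longrightarrow> f - g \<in> hom n"
  and hom_minus: "f \<in> hom n \<Longrightarrow> - f \<in> hom n"
  and hom_mon: "zdeg w = n \<Longrightarrow> mon w c \<in> hom n"
  using keys_add[of "cf f" "cf g"] keys_diff_subset[of "cf f" "cf g"]
  by (auto simp: hom_def keys_uminus_eq split: if_splits)

lemma hom_sum: "(\<And>i. i \<in> S \<Longrightarrow> f i \<in> hom n) \<Longrightarrow> sum f S \<in> hom n"
  by (induction S rule: infinite_finite_induct) (auto intro: hom_add)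

lemma hom_mult:
  assumes "f \<in> hom m" "g \<in> hom n"
  shows "f * g \<in> hom (m + n)"
proof -
  have "mon v c * g \<in> hom (m + n)" if "zdeg v = m" for v c
  proof -
    have "supp g \<subseteq> {w. zdeg w = n}" using assms(2) by (auto simp: hom_def)
    then show ?thesis
    proof (induction rule: malg_induct)
      case (mon w d)
      then show ?case using that zdeg_zmult[of v w]
        by (cases "zmult v w") (auto simp: mon_times intro!: hom_mon)
    qed (auto simp: distrib_left intro: hom_add)
  qed
  moreover have "supp f \<subseteq> {w. zdeg w = m}" using assms(1) by (auto simp: hom_def)
  ultimately show ?thesis
    by (intro malg_induct[where f=f and P="\<lambda>f. f * g \<in> hom (m + n)"])
      (auto simp: distrib_right intro: hom_add)
qed

lemma hom_scal: "scal c \<in> hom 0" by (simp add: hom_mon)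

lemma hom_scal_times: "f \<in> hom n \<Longrightarrow> scal c * f \<in> hom n"
  using hom_mult[OF hom_scal, of f n c] by simp

lemma hom_zero_iff: "f \<in> hom 0 \<longleftrightarrow> (\<exists>c. f = scal c)"
proof
  assume "f \<in> hom 0"
  then have "supp f \<subseteq> {zone}" by (auto simp: hom_def zdeg_eq_0)
  then show "\<exists>c. f = scal c"
    by (induction rule: malg_induct) (auto simp: mon_add[symmetric] intro: exI[of _ 0])
qed (auto simp: hom_scal)

definition pr :: "nat \<Rightarrow> ('w::zmonoid, 'k::field) malg \<Rightarrow> ('w, 'k) malg"
  where "pr n f = lin (\<lambda>w c. if zdeg w = n then mon w c else 0) (cf f)"

lemma additive_pr: "additive (pr n)"
  unfolding pr_def
  by (intro additive_compose[OF additive_lin additive_cf]) (auto simp: additive_def mon_add)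

lemma pr_mon: "pr n (mon w c) = (if zdeg w = n then mon w c else 0)"
  unfolding pr_def cf_mon by (subst lin_single) (auto simp: additive_def mon_add)

lemma pr_hom: "pr n f \<in> hom n"
  unfolding pr_def lin_def by (intro hom_sum) (auto intro: hom_mon)

lemma pr_of_hom: "f \<in> hom m \<Longrightarrow> pr n f = (if m = n then f else 0)"
proof -
  assume "f \<in> hom m"
  then have "supp f \<subseteq> {w. zdeg w = m}" by (auto simp: hom_def)
  then show ?thesis
    by (induction rule: malg_induct) (auto simp: additiveD[OF additive_pr] pr_mon)
qed

lemma coeff_pr: "coeff (pr n f) w = (if zdeg w = n then coeff f w else 0)"
proof -
  have "supp f \<subseteq> UNIV" by simp
  then show ?thesis
    by (induction rule: malg_induct)
      (auto simp: additiveD[OF additive_pr] pr_mon lookup_add lookup_single when_def)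
qed

lemma pr_times_left:
  assumes "b \<in> hom 1"
  shows "pr (Suc n) (b * f) = b * pr n f" and "pr 0 (b * f) = 0"
proof -
  have "supp f \<subseteq> UNIV" by simp
  then have "pr (Suc n) (b * f) = b * pr n f \<and> pr 0 (b * f) = 0"
  proof (induction rule: malg_induct)
    case (mon w c)
    have "b * mon w c \<in> hom (Suc (zdeg w))"
      using hom_mult[OF assms hom_mon[OF refl, of w c]] by simp
    then show ?case by (auto simp: pr_of_hom pr_mon)
  qed (auto simp: additiveD[OF additive_pr] distrib_left)
  then show "pr (Suc n) (b * f) = b * pr n f" "pr 0 (b * f) = 0" by auto
qed

lemma pr_times_right:
  assumes "b \<in> hom 1"
  shows "pr (Suc n) (f * b) = pr n f * b" and "pr 0 (f * b) = 0"
proof -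
  have "supp f \<subseteq> UNIV" by simp
  then have "pr (Suc n) (f * b) = pr n f * b \<and> pr 0 (f * b) = 0"
  proof (induction rule: malg_induct)
    case (mon w c)
    have "mon w c * b \<in> hom (Suc (zdeg w))"
      using hom_mult[OF hom_mon[OF refl, of w c] assms] by simp
    then show ?case by (auto simp: pr_of_hom pr_mon)
  qed (auto simp: additiveD[OF additive_pr] distrib_right)
  then show "pr (Suc n) (f * b) = pr n f * b" "pr 0 (f * b) = 0" by auto
qed

section \<open>The bar complex in a monomial basis\<close>

definition lsc :: "'r \<Rightarrow> ('b \<Rightarrow>\<^sub>0 'r) \<Rightarrow> ('b \<Rightarrow>\<^sub>0 'r::ring_1)"
  where "lsc a p = Poly_Mapping.map ((*) a) p"

lemma lookup_lsc [simp]: "Poly_Mapping.lookup (lsc a p) b = a * Poly_Mapping.lookup p b"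
  by (simp add: lsc_def map.rep_eq when_def)

lemma lsc_simps:
  "lsc a (p + q) = lsc a p + lsc a q" "lsc a (p - q) = lsc a p - lsc a q" "lsc a 0 = 0"
  "lsc (a + b) p = lsc a p + lsc b p" "lsc (a * b) p = lsc a (lsc b p)"
  "lsc 1 p = p" "lsc 0 p = 0" "lsc a (Poly_Mapping.single x c) = Poly_Mapping.single x (a * c)"
  by (rule poly_mapping_eqI, simp add: lookup_add lookup_minus algebra_simps lookup_single when_def)+

lemma additive_lsc: "additive (lsc a)"
  and additive_lsc_left: "additive (\<lambda>a. lsc a p)"
  by (simp_all add: additive_def lsc_simps)

lemma lsc_sum: "lsc a (sum f S) = (\<Sum>s\<in>S. lsc a (f s))"
  by (rule additiveD(5)[OF additive_lsc])

lemma keys_lsc: "Poly_Mapping.keys (lsc a p) \<subseteq> Poly_Mapping.keys p"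
  by (auto simp: in_keys_iff)

text \<open>
  For the contracted monoid algebra \<open>R\<close> of \<open>'w\<close>, the element \<open>a \<otimes> [w\<^sub>1|\<dots>|w\<^sub>i]\<close> of the bar
  resolution \<open>R \<otimes> R\<^sub>+\<^bsup>\<otimes>i\<^esup>\<close> is the function with value \<open>a\<close> at the list \<open>[w\<^sub>1,\<dots>,w\<^sub>i]\<close>.  The contraction
  sends \<open>a \<otimes> ws\<close> to \<open>1 \<otimes> [a\<^sub>+|ws]\<close>.
\<close>

type_synonym ('w, 'k) bres = "'w list \<Rightarrow>\<^sub>0 ('w, 'k) malg"

definition bres_contr :: "('w::zmonoid, 'k::field) bres \<Rightarrow> ('w, 'k) bres"
  where "bres_contr = lin (\<lambda>ws a. lin (\<lambda>w c. if w = zone then 0 else Poly_Mapping.single (w # ws) (scal c)) (cf a))"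

text \<open>The differential of 1 \<otimes> [w|ws] without the alternating sum over faces. For w
  other than the unit this element is s(w \<otimes> ws), s being the contraction, and the equation d
  s + s d = id leaves w \<otimes> ws - s(d(w \<otimes> ws)) as the only choice. The value 0 at
  \<open>[]\<close> leaves the augmentation to k out of the complex.\<close>

primrec bres_d0 :: "'w list \<Rightarrow> ('w::zmonoid, 'k::field) bres"
  where
    "bres_d0 [] = 0"
  | "bres_d0 (w # ws) = Poly_Mapping.single ws (mon w 1) - bres_contr (lsc (mon w 1) (bres_d0 ws))"

definition bres_d :: "('w::zmonoid, 'k::field) bres \<Rightarrow> ('w, 'k) bres"
  where "bres_d = lin (\<lambda>ws a. lsc a (bres_d0 ws))"

lemma additive_if: "(b \<Longrightarrow> additive f) \<Longrightarrow> (\<not> b \<Longrightarrow> additive g) \<Longrightarrow> additive (\<lambda>x. if b then f x else g x)"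
  for f g :: "'a::ab_group_add \<Rightarrow> 'b::ab_group_add"
  by (simp add: additive_def)

lemma additive_contr_aux:
  "additive (\<lambda>a :: ('w::zmonoid, 'k::field) malg.
     lin (\<lambda>w c. if w = zone then 0 else Poly_Mapping.single (w # ws) (scal c :: ('w, 'k) malg)) (cf a))"
  and additive_contr_aux2:
  "additive (\<lambda>c. if w = zone then 0 else Poly_Mapping.single (w # ws) (scal c :: ('w, 'k) malg))"
  by (intro additive_compose[OF additive_lin additive_cf] additive_if additive_zero
      additive_compose[OF additive_single additive_mon])+

lemma additive_contr: "additive (bres_contr :: ('w::zmonoid, 'k::field) bres \<Rightarrow> _)"
  unfolding bres_contr_def by (intro additive_lin additive_contr_aux)

lemma additive_d: "additive (bres_d :: ('w::zmonoid, 'k::field) bres \<Rightarrow> _)"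
  unfolding bres_d_def by (intro additive_lin additive_lsc_left)

lemmas contr_simps = additiveD[OF additive_contr] and d_simps = additiveD[OF additive_d]

lemma contr_single:
  "bres_contr (Poly_Mapping.single ws (mon w c)) =
     (if w = zone then 0 else Poly_Mapping.single (w # ws) (scal c))"
  unfolding bres_contr_def
  by (subst lin_single[OF additive_contr_aux], subst cf_mon, subst lin_single[OF additive_contr_aux2]) simp

lemma d_single: "bres_d (Poly_Mapping.single ws a) = lsc a (bres_d0 ws)"
  unfolding bres_d_def by (subst lin_single[OF additive_lsc_left]) simp

lemma bres_induct [consumes 1, case_names zero add single]:
  fixes \<zeta> :: "('w::zmonoid, 'k::field) bres"
  assumes "\<And>ws w. ws \<in> Poly_Mapping.keys \<zeta> \<Longrightarrow> w \<in> supp (Poly_Mapping.lookup \<zeta> ws) \<Longrightarrow> Q ws w"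
    and "P 0" "\<And>p q. P p \<Longrightarrow> P q \<Longrightarrow> P (p + q)"
    and "\<And>ws w c. Q ws w \<Longrightarrow> P (Poly_Mapping.single ws (mon w c))"
  shows "P \<zeta>"
proof -
  have P_sum: "P (sum f S)" if "\<And>s. s \<in> S \<Longrightarrow> P (f s)" for f :: "'x \<Rightarrow> _" and S
    using that by (induction S rule: infinite_finite_induct) (auto intro: assms)
  have "P (Poly_Mapping.single ws (Poly_Mapping.lookup \<zeta> ws))" if ws: "ws \<in> Poly_Mapping.keys \<zeta>" for ws
  proof -
    let ?a = "Poly_Mapping.lookup \<zeta> ws"
    have "Poly_Mapping.single ws ?a = (\<Sum>w\<in>supp ?a. Poly_Mapping.single ws (mon w (coeff ?a w)))"
      by (subst malg_sum_mon[symmetric]) (rule additiveD(5)[OF additive_single])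
    then show ?thesis using assms(1)[OF ws] by (auto intro!: P_sum assms(4))
  qed
  then show ?thesis by (subst pm_sum_single[symmetric]) (rule P_sum)
qed

lemma bres_additive_eq:
  fixes f g :: "('w::zmonoid, 'k::field) bres \<Rightarrow> 'd::ab_group_add"
  assumes "additive f" "additive g" "\<And>ws w c. f (Poly_Mapping.single ws (mon w c)) = g (Poly_Mapping.single ws (mon w c))"
  shows "f p = g p"
  by (rule bres_induct[where Q="\<lambda>_ _. True"])
    (simp_all add: assms additiveD[OF assms(1)] additiveD[OF assms(2)])

lemma d_lsc: "bres_d (lsc a \<zeta>) = lsc a (bres_d \<zeta>)"
  by (rule bres_additive_eq)
    (simp_all add: additive_compose[OF additive_d additive_lsc] additive_compose[OF additive_lsc additive_d]
      lsc_simps d_single)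

lemma contr_lsc_scal: "bres_contr (lsc (scal c) \<zeta>) = lsc (scal c) (bres_contr \<zeta>)"
  by (rule bres_additive_eq)
    (simp_all add: additive_compose[OF additive_contr additive_lsc] additive_compose[OF additive_lsc additive_contr]
      lsc_simps contr_single scal_times_mon)

text \<open>The contraction leaves only constants in the coefficient slot, and it sends constants to
  0.\<close>

lemma contr_contr: "bres_contr (bres_contr \<zeta>) = 0"
  by (rule bres_additive_eq)
    (simp_all add: additive_compose[OF additive_contr additive_contr] additive_zero contr_single contr_simps)

definition bres_hom :: "nat \<Rightarrow> nat \<Rightarrow> ('w::zmonoid, 'k::field) bres set"
  where "bres_hom i j = {\<zeta>. \<forall>ws\<in>Poly_Mapping.keys \<zeta>. length ws = i \<and> zone \<notin> set ws \<and>
    (\<forall>w\<in>supp (Poly_Mapping.lookup \<zeta> ws). zdeg w + sum_list (map zdeg ws) = j)}"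

lemma malg_supp_nonempty: "f \<noteq> 0 \<Longrightarrow> \<exists>w. w \<in> supp (f :: ('w::zmonoid, 'k::field) malg)"
  by (metis cf_0 keys_eq_empty malg_eq_iff ex_in_conv)

lemma bres_homI:
  "(\<And>ws w. Poly_Mapping.lookup \<zeta> ws \<noteq> 0 \<Longrightarrow> w \<in> supp (Poly_Mapping.lookup \<zeta> ws) \<Longrightarrow>
     length ws = i \<and> zone \<notin> set ws \<and> zdeg w + sum_list (map zdeg ws) = j) \<Longrightarrow> \<zeta> \<in> bres_hom i j"
  unfolding bres_hom_def using malg_supp_nonempty by (fastforce simp: in_keys_iff)

lemma bres_hom_iff:
  "\<zeta> \<in> bres_hom i j \<longleftrightarrow> (\<forall>ws w. coeff (Poly_Mapping.lookup \<zeta> ws) w \<noteq> 0 \<longrightarrow>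
     length ws = i \<and> zone \<notin> set ws \<and> zdeg w + sum_list (map zdeg ws) = j)"
proof
  assume *: "\<zeta> \<in> bres_hom i j"
  show "\<forall>ws w. coeff (Poly_Mapping.lookup \<zeta> ws) w \<noteq> 0 \<longrightarrow>
     length ws = i \<and> zone \<notin> set ws \<and> zdeg w + sum_list (map zdeg ws) = j"
  proof (intro allI impI)
    fix ws w assume c: "coeff (Poly_Mapping.lookup \<zeta> ws) w \<noteq> 0"
    then have "ws \<in> Poly_Mapping.keys \<zeta>" by (auto simp: in_keys_iff)
    then show "length ws = i \<and> zone \<notin> set ws \<and> zdeg w + sum_list (map zdeg ws) = j"
      using * c by (auto simp: bres_hom_def in_keys_iff)
  qed
next
  assume "\<forall>ws w. coeff (Poly_Mapping.lookup \<zeta> ws) w \<noteq> 0 \<longrightarrow>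
     length ws = i \<and> zone \<notin> set ws \<and> zdeg w + sum_list (map zdeg ws) = j"
  then show "\<zeta> \<in> bres_hom i j" by (intro bres_homI) (auto simp: in_keys_iff)
qed

lemma bres_hom_0 [simp]: "0 \<in> bres_hom i j"
  by (simp add: bres_hom_iff)

lemma bres_hom_add: "\<zeta> \<in> bres_hom i j \<Longrightarrow> \<eta> \<in> bres_hom i j \<Longrightarrow> \<zeta> + \<eta> \<in> bres_hom i j"
  unfolding bres_hom_iff by (auto simp: lookup_add) (metis add.right_neutral)+

lemma bres_hom_diff: "\<zeta> \<in> bres_hom i j \<Longrightarrow> \<eta> \<in> bres_hom i j \<Longrightarrow> \<zeta> - \<eta> \<in> bres_hom i j"
  unfolding bres_hom_iff by (auto simp: lookup_minus) (metis diff_0_right)+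

lemma bres_hom_sum: "(\<And>s. s \<in> S \<Longrightarrow> f s \<in> bres_hom i j) \<Longrightarrow> sum f S \<in> bres_hom i j"
  by (induction S rule: infinite_finite_induct) (auto intro: bres_hom_add)

lemma bres_hom_single:
  "a \<in> hom n \<Longrightarrow> zone \<notin> set ws \<Longrightarrow> n + sum_list (map zdeg ws) = j \<Longrightarrow>
    Poly_Mapping.single ws a \<in> bres_hom (length ws) j"
  unfolding bres_hom_iff hom_def by (auto simp: lookup_single when_def in_keys_iff)

lemma bres_hom_induct [consumes 1, case_names zero add single]:
  fixes \<zeta> :: "('w::zmonoid, 'k::field) bres"
  assumes "\<zeta> \<in> bres_hom i j" "P 0" "\<And>p q. P p \<Longrightarrow> P q \<Longrightarrow> P (p + q)"
    and "\<And>ws w c. length ws = i \<Longrightarrow> zone \<notin> set ws \<Longrightarrow> zdeg w + sum_list (map zdeg ws) = j \<Longrightarrow>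
      P (Poly_Mapping.single ws (mon w c))"
  shows "P \<zeta>"
  by (rule bres_induct[where Q="\<lambda>ws w. length ws = i \<and> zone \<notin> set ws \<and> zdeg w + sum_list (map zdeg ws) = j"])
    (use assms in \<open>auto simp: bres_hom_def\<close>)

lemma bres_hom_lookup:
  assumes "\<zeta> \<in> bres_hom i j" "ws \<in> Poly_Mapping.keys \<zeta>"
  shows "\<exists>n. Poly_Mapping.lookup \<zeta> ws \<in> hom n \<and> j = n + sum_list (map zdeg ws)"
    "length ws = i" "zone \<notin> set ws"
proof -
  have "Poly_Mapping.lookup \<zeta> ws \<noteq> 0" using assms(2) by (simp add: in_keys_iff)
  then obtain w where w: "w \<in> supp (Poly_Mapping.lookup \<zeta> ws)" using malg_supp_nonempty by blast
  have *: "zdeg v + sum_list (map zdeg ws) = j" if "v \<in> supp (Poly_Mapping.lookup \<zeta> ws)" for v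
    using assms that by (auto simp: bres_hom_def)
  have "Poly_Mapping.lookup \<zeta> ws \<in> hom (zdeg w)"
    using *[OF w] * unfolding hom_def by auto
  with *[OF w] show "\<exists>n. Poly_Mapping.lookup \<zeta> ws \<in> hom n \<and> j = n + sum_list (map zdeg ws)"
    by (intro exI[of _ "zdeg w"]) auto
qed (use assms in \<open>auto simp: bres_hom_def\<close>)

lemma bres_hom_lsc:
  assumes "b \<in> hom n" "\<zeta> \<in> bres_hom i j"
  shows "lsc b \<zeta> \<in> bres_hom i (n + j)"
  using assms(2)
proof (induction rule: bres_hom_induct)
  case (single ws w c)
  then show ?case using hom_mult[OF assms(1) hom_mon[OF refl, of w c]]
    by (auto simp: lsc_simps intro!: bres_hom_single)
qed (auto simp: lsc_simps intro: bres_hom_add)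

lemma contr_hom:
  assumes "\<zeta> \<in> bres_hom i j"
  shows "bres_contr \<zeta> \<in> bres_hom (Suc i) j"
  using assms
proof (induction rule: bres_hom_induct)
  case (single ws w c)
  then show ?case
    using bres_hom_single[OF hom_scal, where ws="w # ws"] by (auto simp: contr_single)
qed (auto simp: contr_simps intro: bres_hom_add)

lemma d0_hom:
  "zone \<notin> set ws \<Longrightarrow> length ws = Suc i \<Longrightarrow>
    (bres_d0 ws :: ('w::zmonoid, 'k::field) bres) \<in> bres_hom i (sum_list (map zdeg ws))"
proof (induction ws arbitrary: i)
  case (Cons w ws)
  have 1: "Poly_Mapping.single ws (mon w 1 :: ('w, 'k) malg) \<in> bres_hom i (sum_list (map zdeg (w # ws)))"
    using Cons.prems bres_hom_single[OF hom_mon[OF refl]] by auto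
  show ?case
  proof (cases ws)
    case Nil
    then show ?thesis using 1 by (simp add: lsc_simps contr_simps)
  next
    case (Cons v vs)
    then obtain i' where i': "i = Suc i'" "length ws = Suc i'" using Cons.prems by (cases i) auto
    have "bres_contr (lsc (mon w 1) (bres_d0 ws :: ('w, 'k) bres)) \<in> bres_hom (Suc i') (sum_list (map zdeg (w # ws)))"
      using contr_hom[OF bres_hom_lsc[OF hom_mon[OF refl] Cons.IH[of i']]] Cons.prems i' by auto
    then show ?thesis using 1 i' by (simp add: bres_hom_diff)
  qed
qed simp

lemma d_hom:
  assumes "\<zeta> \<in> bres_hom (Suc i) j"
  shows "bres_d \<zeta> \<in> bres_hom i j"
  using assms
proof (induction rule: bres_hom_induct)
  case (single ws w c)
  then show ?case
    using bres_hom_lsc[OF hom_mon[OF refl] d0_hom[of ws i]] by (auto simp: d_single)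
qed (auto simp: d_simps intro: bres_hom_add)

lemma d_hom_0: "\<zeta> \<in> bres_hom 0 j \<Longrightarrow> bres_d \<zeta> = 0"
  by (induction rule: bres_hom_induct) (auto simp: d_single d_simps lsc_simps)

text \<open>For a non-unit coefficient this is the recursion for \<open>bres_d0\<close> read
  backwards; for a constant one the first term vanishes and \<open>contr_contr\<close> removes the
  correction term. Bidegree (0, 0) is excluded because the identity there would need the omitted
  augmentation.\<close>

lemma homotopy:
  assumes "\<zeta> \<in> bres_hom i j" "0 < i \<or> 0 < j"
  shows "bres_d (bres_contr \<zeta>) + bres_contr (bres_d \<zeta>) = \<zeta>"
  using assms(1)
proof (induction rule: bres_hom_induct)
  case (single ws w c)
  have eq: "lsc (scal c) (lsc (mon v 1) \<xi>) = lsc (mon v c) \<xi>" for v c and \<xi> :: "('a, 'b) bres"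
    by (simp add: lsc_simps(5)[symmetric] scal_times_mon)
  show ?case
  proof (cases "w = zone")
    case False
    then show ?thesis
      by (simp add: contr_single d_single lsc_simps scal_times_mon contr_lsc_scal[symmetric] eq)
  next
    case True
    with single assms(2) obtain v vs where "ws = v # vs" "v \<noteq> zone" by (cases ws) auto
    then show ?thesis using True
      by (simp add: contr_single d_single lsc_simps scal_times_mon contr_lsc_scal[symmetric] eq
          d_simps contr_simps contr_contr)
  qed
next
  case (add p q)
  have "bres_d (bres_contr (p + q)) + bres_contr (bres_d (p + q)) =
    (bres_d (bres_contr p) + bres_contr (bres_d p)) + (bres_d (bres_contr q) + bres_contr (bres_d q))"
    by (simp add: d_simps contr_simps)
  then show ?case by (simp only: add.IH)
qed (simp add: d_simps contr_simps)

text \<open>With Y = w d(ws), the claim amounts to Y = d(s(Y)), which is the homotopy identity since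
  d Y = 0 by induction.\<close>

lemma d_d0: "zone \<notin> set ws \<Longrightarrow> bres_d (bres_d0 ws :: ('w::zmonoid, 'k::field) bres) = 0"
proof (induction ws)
  case (Cons w ws)
  show ?case
  proof (cases ws)
    case Nil
    then show ?thesis by (simp add: d_simps lsc_simps contr_simps d_single)
  next
    case ws: (Cons v vs)
    let ?Y = "lsc (mon w 1) (bres_d0 ws :: ('w, 'k) bres)"
    have Y: "?Y \<in> bres_hom (length vs) (zdeg w + sum_list (map zdeg ws))"
      using d0_hom[of ws "length vs"] Cons.prems ws by (intro bres_hom_lsc hom_mon) auto
    have "bres_d (bres_contr ?Y) + bres_contr (bres_d ?Y) = ?Y"
      using Cons.prems zdeg_eq_0[of w] by (intro homotopy[OF Y]) auto
    moreover have "bres_d ?Y = 0" using Cons by (simp add: d_lsc lsc_simps)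
    ultimately show ?thesis by (simp add: d_simps contr_simps d_single)
  qed
qed (simp add: d_simps)

lemma d_d: "\<zeta> \<in> bres_hom i j \<Longrightarrow> bres_d (bres_d \<zeta>) = 0"
  by (induction rule: bres_hom_induct) (auto simp: d_single d_simps d_lsc d_d0 lsc_simps)

text \<open>This is A_+ \<otimes> A_+^i, as a vector space the reduced bar complex in homological
  degree i + 1; hence the shift by one in all comparisons below.\<close>

definition bres_plus :: "nat \<Rightarrow> nat \<Rightarrow> ('w::zmonoid, 'k::field) bres set"
  where "bres_plus i j = {\<zeta> \<in> bres_hom i j. \<forall>ws. zone \<notin> supp (Poly_Mapping.lookup \<zeta> ws)}"

section \<open>A criterion for Koszulness\<close>

text \<open>Only the products \<open>c * g c\<close> have to vanish, not the \<open>g c\<close>: the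
  right ideals c A form a direct sum, but they need not be free.\<close>

definition direct :: "'r::ring_1 set \<Rightarrow> bool"
  where "direct T \<longleftrightarrow> (\<forall>g. (\<Sum>c\<in>T. c * g c) = 0 \<longrightarrow> (\<forall>c\<in>T. c * g c = 0))"

text \<open>
  A Koszul filtration in which every right ideal is a direct sum of principal ones: \<open>S\<close> is the set
  of their generators, \<open>T b\<close> generates the right annihilator of \<open>b\<close>, and \<open>T\<^sub>0\<close> the augmentation ideal.
\<close>

locale koszul_filtration =
  fixes S T0 :: "('w::zmonoid, 'k::field) malg set" and T :: "('w, 'k) malg \<Rightarrow> ('w, 'k) malg set"
  assumes S_hom: "S \<subseteq> hom 1"
    and T0: "finite T0" "T0 \<subseteq> S" "direct T0"
    and T: "\<And>b. b \<in> S \<Longrightarrow> finite (T b)" "\<And>b. b \<in> S \<Longrightarrow> T b \<subseteq> S" "\<And>b. b \<in> S \<Longrightarrow> direct (T b)"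
    and T_ann: "\<And>b c. b \<in> S \<Longrightarrow> c \<in> T b \<Longrightarrow> b * c = 0"
    and ann_T: "\<And>b a. b \<in> S \<Longrightarrow> b * a = 0 \<Longrightarrow> \<exists>g. a = (\<Sum>c\<in>T b. c * g c)"
    and T0_gen: "\<And>a n. a \<in> hom (Suc n) \<Longrightarrow> \<exists>g. a = (\<Sum>c\<in>T0. c * g c)"
begin

text \<open>As the generators have degree 1, the cofactors can be replaced by their components in
  the one degree that fits, which makes every \<open>G c\<close> homogeneous. In internal degree 0
  nothing fits, so the truncated \<open>j - 1\<close> does no harm.\<close>

lemma bres_decompose:
  assumes "finite V" "V \<subseteq> S" "\<zeta> \<in> bres_hom i j"
    and "\<And>ws. ws \<in> Poly_Mapping.keys \<zeta> \<Longrightarrow> \<exists>g. Poly_Mapping.lookup \<zeta> ws = (\<Sum>c\<in>V. c * g c)"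
  shows "\<exists>G. \<zeta> = (\<Sum>c\<in>V. lsc c (G c)) \<and> (\<forall>c\<in>V. G c \<in> bres_hom i (j - 1))"
    and "j = 0 \<Longrightarrow> \<zeta> = 0"
proof -
  obtain g where g: "\<And>ws. ws \<in> Poly_Mapping.keys \<zeta> \<Longrightarrow> Poly_Mapping.lookup \<zeta> ws = (\<Sum>c\<in>V. c * g ws c)"
    using assms(4) by metis
  let ?n = "\<lambda>ws. j - 1 - sum_list (map zdeg ws)"
  have pos: "Poly_Mapping.lookup \<zeta> ws = (\<Sum>c\<in>V. c * pr (?n ws) (g ws c)) \<and> sum_list (map zdeg ws) < j"
    if ws: "ws \<in> Poly_Mapping.keys \<zeta>" for ws
  proof -
    obtain n where n: "Poly_Mapping.lookup \<zeta> ws \<in> hom n" "j = n + sum_list (map zdeg ws)"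
      using bres_hom_lookup[OF assms(3) ws] by auto
    have eq: "Poly_Mapping.lookup \<zeta> ws = (\<Sum>c\<in>V. pr n (c * g ws c))"
      using pr_of_hom[OF n(1), of n] g[OF ws] by (simp add: additiveD(5)[OF additive_pr])
    show ?thesis
    proof (cases n)
      case 0
      have "(\<Sum>c\<in>V. pr n (c * g ws c)) = 0"
        using S_hom assms(2) by (intro sum.neutral) (auto simp: 0 intro!: pr_times_left(2))
      with eq ws show ?thesis by (simp add: in_keys_iff)
    next
      case (Suc m)
      have "(\<Sum>c\<in>V. pr n (c * g ws c)) = (\<Sum>c\<in>V. c * pr m (g ws c))"
        using S_hom assms(2) by (intro sum.cong) (auto simp: Suc intro!: pr_times_left(1))
      with eq n(2) Suc show ?thesis by simp
    qed
  qed
  show "\<zeta> = 0" if "j = 0"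
    using pos that by (intro poly_mapping_eqI) (auto simp: in_keys_iff)
  define G where "G c = (\<Sum>ws\<in>Poly_Mapping.keys \<zeta>. Poly_Mapping.single ws (pr (?n ws) (g ws c)))" for c
  have "\<zeta> = (\<Sum>c\<in>V. lsc c (G c))"
  proof -
    have "(\<Sum>c\<in>V. lsc c (G c)) =
        (\<Sum>ws\<in>Poly_Mapping.keys \<zeta>. Poly_Mapping.single ws (\<Sum>c\<in>V. c * pr (?n ws) (g ws c)))"
      unfolding G_def lsc_sum lsc_simps
      by (subst sum.swap) (simp add: additiveD(5)[OF additive_single])
    also have "\<dots> = (\<Sum>ws\<in>Poly_Mapping.keys \<zeta>. Poly_Mapping.single ws (Poly_Mapping.lookup \<zeta> ws))"
      using pos by (intro sum.cong) auto
    finally show ?thesis by (simp add: pm_sum_single)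
  qed
  moreover have "G c \<in> bres_hom i (j - 1)" for c
    unfolding G_def
  proof (rule bres_hom_sum)
    fix ws assume ws: "ws \<in> Poly_Mapping.keys \<zeta>"
    from pos[OF ws] bres_hom_lookup[OF assms(3) ws]
    show "Poly_Mapping.single ws (pr (?n ws) (g ws c)) \<in> bres_hom i (j - 1)"
      using bres_hom_single[OF pr_hom[of "?n ws" "g ws c"], of ws "j - 1"] by auto
  qed
  ultimately show "\<exists>G. \<zeta> = (\<Sum>c\<in>V. lsc c (G c)) \<and> (\<forall>c\<in>V. G c \<in> bres_hom i (j - 1))"
    by blast
qed

lemma direct_bres:
  assumes "direct V" "(\<Sum>c\<in>V. lsc c (G c)) = 0" "c \<in> V"
  shows "lsc c (G c) = 0"
proof (rule poly_mapping_eqI)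
  fix ws
  have "(\<Sum>c\<in>V. c * Poly_Mapping.lookup (G c) ws) = 0"
    using arg_cong[OF assms(2), of "\<lambda>p. Poly_Mapping.lookup p ws"] by (simp add: lookup_sum)
  then show "Poly_Mapping.lookup (lsc c (G c)) ws = Poly_Mapping.lookup 0 ws"
    using assms(1,3) by (auto simp: direct_def)
qed

text \<open>The elements \<open>lsc b \<zeta>\<close> form b A tensored over A with the bar
  resolution, so this says that Tor_i(b A, k) lives only in internal degree i + 1. The induction on
  i follows the exact sequence 0 -> ann(b) -> A -> b A -> 0.\<close>

lemma principal_exact:
  assumes "b \<in> S" "\<zeta> \<in> bres_hom i j" "i \<noteq> j" "bres_d (lsc b \<zeta>) = 0"
  shows "\<exists>\<eta>\<in>bres_hom (Suc i) j. lsc b \<zeta> = bres_d (lsc b \<eta>)"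
  using assms
proof (induction i arbitrary: b j \<zeta>)
  case 0
  \<comment> \<open>Here i = 0, so j is positive and the bidegree excluded from the homotopy does
    not occur.\<close>
  then have "bres_d (bres_contr \<zeta>) = \<zeta>" using homotopy[of \<zeta> 0 j] by (simp add: d_hom_0 contr_simps)
  then show ?case using 0 contr_hom by (intro bexI[of _ "bres_contr \<zeta>"]) (auto simp: d_lsc)
next
  case (Suc i)
  have dh: "bres_d \<zeta> \<in> bres_hom i j" using Suc.prems d_hom by blast
  have "\<exists>g. Poly_Mapping.lookup (bres_d \<zeta>) ws = (\<Sum>c\<in>T b. c * g c)" for ws
  proof (rule ann_T[OF Suc.prems(1)])
    show "b * Poly_Mapping.lookup (bres_d \<zeta>) ws = 0"
      using arg_cong[OF Suc.prems(4), of "\<lambda>p. Poly_Mapping.lookup p ws"] by (simp add: d_lsc)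
  qed
  note dec = bres_decompose[OF T(1,2)[OF Suc.prems(1)] dh this]
  \<comment> \<open>The chain \<theta> has the same differential as \<zeta> but is killed by b. Then
    \<zeta> - \<theta> is a cycle, the contraction makes it a boundary, and b does not see the
    difference.\<close>
  have "\<exists>\<theta>\<in>bres_hom (Suc i) j. bres_d \<theta> = bres_d \<zeta> \<and> lsc b \<theta> = 0"
  proof (cases j)
    case 0
    then have "bres_d \<zeta> = 0" using dec(2) by simp
    then show ?thesis by (intro bexI[of _ 0]) (auto simp: d_simps lsc_simps)
  next
    case (Suc j')
    obtain G where G: "bres_d \<zeta> = (\<Sum>c\<in>T b. lsc c (G c))" "\<And>c. c \<in> T b \<Longrightarrow> G c \<in> bres_hom i j'"
      using dec(1) Suc by auto
    have "(\<Sum>c\<in>T b. lsc c (bres_d (G c))) = bres_d (bres_d \<zeta>)"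
      unfolding G(1) d_simps(5) by (simp add: d_lsc)
    also have "\<dots> = 0" using d_d Suc.prems(2) by blast
    \<comment> \<open>Directness splits the cycle condition: every summand is a cycle on its own, so
      the induction hypothesis applies to it with both degrees lowered by one.\<close>
    finally have "bres_d (lsc c (G c)) = 0" if "c \<in> T b" for c
      using direct_bres[OF T(3)[OF Suc.prems(1)] _ that, of "\<lambda>c. bres_d (G c)"] by (simp add: d_lsc)
    then have "\<exists>\<eta>\<in>bres_hom (Suc i) j'. lsc c (G c) = bres_d (lsc c \<eta>)" if "c \<in> T b" for c
      using Suc.IH[of c "G c" j'] that G(2) T(2)[OF Suc.prems(1)] Suc.prems(3) Suc by auto
    then obtain \<eta> where \<eta>: "\<And>c. c \<in> T b \<Longrightarrow> \<eta> c \<in> bres_hom (Suc i) j' \<and> lsc c (G c) = bres_d (lsc c (\<eta> c))"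
      by metis
    have "(\<Sum>c\<in>T b. lsc c (\<eta> c)) \<in> bres_hom (Suc i) j"
      using \<eta> T(2)[OF Suc.prems(1)] S_hom bres_hom_lsc[of _ 1]
      by (intro bres_hom_sum) (fastforce simp: Suc)
    moreover have "bres_d (\<Sum>c\<in>T b. lsc c (\<eta> c)) = bres_d \<zeta>"
      unfolding G(1) d_simps(5) using \<eta> by (intro sum.cong) auto
    moreover have "lsc b (\<Sum>c\<in>T b. lsc c (\<eta> c)) = 0"
      unfolding lsc_sum lsc_simps(5)[symmetric]
      using T_ann[OF Suc.prems(1)] by (intro sum.neutral) (auto simp: lsc_simps)
    ultimately show ?thesis by blast
  qed
  then obtain \<theta> where \<theta>: "\<theta> \<in> bres_hom (Suc i) j" "bres_d \<theta> = bres_d \<zeta>" "lsc b \<theta> = 0" by blast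
  have h: "\<zeta> - \<theta> \<in> bres_hom (Suc i) j" using \<theta> Suc.prems bres_hom_diff by blast
  have "bres_d (bres_contr (\<zeta> - \<theta>)) = \<zeta> - \<theta>"
    using homotopy[OF h] \<theta>(2) by (simp add: d_simps contr_simps)
  then show ?case
    using contr_hom[OF h] \<theta>(3) by (intro bexI[of _ "bres_contr (\<zeta> - \<theta>)"]) (auto simp: d_lsc lsc_simps)
qed

text \<open>This is the vanishing of Tor_i(A_+, k)_j = Tor_(i+1)(k, k)_j, hence the condition
  \<open>Suc i \<noteq> j\<close>. The ideal A_+ is the direct sum of the c A with c in
  \<open>T0\<close>, and \<open>principal_exact\<close> treats each summand.\<close>

theorem bres_plus_exact:
  fixes \<zeta> :: "('w, 'k) bres"
  assumes "\<zeta> \<in> bres_plus i j" "Suc i \<noteq> j" "bres_d \<zeta> = 0"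
  shows "\<exists>\<eta>\<in>bres_plus (Suc i) j. \<zeta> = bres_d \<eta>"
proof -
  have h: "\<zeta> \<in> bres_hom i j" using assms(1) by (simp add: bres_plus_def)
  have "\<exists>g. Poly_Mapping.lookup \<zeta> ws = (\<Sum>c\<in>T0. c * g c)" if ws: "ws \<in> Poly_Mapping.keys \<zeta>" for ws
  proof -
    obtain n where n: "Poly_Mapping.lookup \<zeta> ws \<in> hom n" using bres_hom_lookup[OF h ws] by auto
    have "n \<noteq> 0"
    proof
      assume "n = 0"
      then have "supp (Poly_Mapping.lookup \<zeta> ws) \<subseteq> {zone}" using n by (auto simp: hom_def zdeg_eq_0)
      moreover have "zone \<notin> supp (Poly_Mapping.lookup \<zeta> ws)" using assms(1) by (simp add: bres_plus_def)
      ultimately have "supp (Poly_Mapping.lookup \<zeta> ws) = {}" by blast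
      then show False using ws malg_supp_nonempty[of "Poly_Mapping.lookup \<zeta> ws"] by (simp add: in_keys_iff)
    qed
    then show ?thesis using T0_gen[of _ "n - 1"] n by auto
  qed
  note dec = bres_decompose[OF T0(1,2) h this]
  show ?thesis
  proof (cases j)
    case 0
    then have "\<zeta> = 0" using dec(2) by simp
    then show ?thesis by (intro bexI[of _ 0]) (auto simp: d_simps bres_plus_def)
  next
    case (Suc j')
    obtain G where G: "\<zeta> = (\<Sum>c\<in>T0. lsc c (G c))" "\<And>c. c \<in> T0 \<Longrightarrow> G c \<in> bres_hom i j'"
      using dec(1) Suc by auto
    have "(\<Sum>c\<in>T0. lsc c (bres_d (G c))) = bres_d \<zeta>"
      unfolding G(1) d_simps(5) by (simp add: d_lsc)
    then have "bres_d (lsc c (G c)) = 0" if "c \<in> T0" for c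
      using direct_bres[OF T0(3) _ that, of "\<lambda>c. bres_d (G c)"] assms(3) by (simp add: d_lsc)
    then have "\<exists>\<eta>\<in>bres_hom (Suc i) j'. lsc c (G c) = bres_d (lsc c \<eta>)" if "c \<in> T0" for c
      using principal_exact[of c "G c" i j'] that G(2) T0(2) assms(2) Suc by auto
    then obtain \<eta> where \<eta>: "\<And>c. c \<in> T0 \<Longrightarrow> \<eta> c \<in> bres_hom (Suc i) j' \<and> lsc c (G c) = bres_d (lsc c (\<eta> c))"
      by metis
    let ?\<eta> = "\<Sum>c\<in>T0. lsc c (\<eta> c)"
    have "?\<eta> \<in> bres_hom (Suc i) j"
      using \<eta> T0(2) S_hom bres_hom_lsc[of _ 1] by (intro bres_hom_sum) (fastforce simp: Suc)
    \<comment> \<open>Every coefficient of the preimage is a sum of multiples of elements of degree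
      1 and so has no constant term.\<close>
    moreover have "zone \<notin> supp (Poly_Mapping.lookup ?\<eta> ws)" for ws
    proof -
      have "pr 0 (Poly_Mapping.lookup ?\<eta> ws) = (\<Sum>c\<in>T0. pr 0 (c * Poly_Mapping.lookup (\<eta> c) ws))"
        by (simp add: lookup_sum additiveD(5)[OF additive_pr])
      also have "\<dots> = 0"
        using T0(2) S_hom by (intro sum.neutral) (auto intro!: pr_times_left(2))
      finally show ?thesis using coeff_pr[of 0 "Poly_Mapping.lookup ?\<eta> ws" zone] by (simp add: in_keys_iff)
    qed
    moreover have "bres_d ?\<eta> = \<zeta>"
      unfolding G(1) d_simps(5) using \<eta> by (intro sum.cong) auto
    ultimately show ?thesis by (intro bexI[of _ ?\<eta>]) (auto simp: bres_plus_def)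
  qed
qed

end

section \<open>Transport to records\<close>

interpretation malg_vs: vector_space "\<lambda>c (f :: ('w::zmonoid, 'k::field) malg). scal c * f"
  by unfold_locales (simp_all add: algebra_simps scal_add scal_mult mon_zone_one)

lemma pm_scale_lsc: "pm_scale = lsc"
  by (intro ext) (simp add: pm_scale_def lsc_def)

lemma lsc_scal_comm: "lsc f (lsc (scal c) p) = lsc (scal c) (lsc f p)"
  by (simp add: lsc_simps(5)[symmetric] scal_central)

interpretation pm_vs: vector_space "pm_scale :: 'k::field \<Rightarrow> ('b \<Rightarrow>\<^sub>0 'k) \<Rightarrow> _"
  rewrites "Modules.module.span pm_scale = pm_span"
proof -
  show "vector_space (pm_scale :: 'k::field \<Rightarrow> ('b \<Rightarrow>\<^sub>0 'k) \<Rightarrow> _)"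
    by unfold_locales (simp_all add: pm_scale_lsc lsc_simps)
qed (simp add: pm_span_def)

text \<open>The bridge between records and type classes: \<open>\<rho>\<close> is an isomorphism
  onto the record R, so everything defined for records is computed in \<open>malg\<close>. It is
  used for the presented algebra and for the copy of the dual.\<close>

locale graded_model =
  fixes R :: "('k::field, 'a) graded_algebra" and \<rho> :: "('w::zmonoid, 'k) malg \<Rightarrow> 'a"
  assumes inj_model: "inj \<rho>"
    and carrier_model: "carrier R = range \<rho>"
    and add_model: "\<rho> f \<oplus>\<^bsub>R\<^esub> \<rho> g = \<rho> (f + g)"
    and mult_model: "\<rho> f \<otimes>\<^bsub>R\<^esub> \<rho> g = \<rho> (f * g)"
    and zero_model: "\<zero>\<^bsub>R\<^esub> = \<rho> 0"
    and one_model: "\<one>\<^bsub>R\<^esub> = \<rho> 1"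
    and smult_model: "c \<odot>\<^bsub>R\<^esub> \<rho> f = \<rho> (scal c * f)"
    and hcomp_model: "hcomp R n = \<rho> ` hom n"
begin

lemmas ops_model = add_model mult_model zero_model one_model smult_model hcomp_model

lemma ring_model: "ring R"
proof (rule ringI)
  show "abelian_group R"
  proof (rule abelian_groupI)
    fix x assume "x \<in> carrier R"
    then obtain f where "x = \<rho> f" by (auto simp: carrier_model)
    then show "\<exists>y\<in>carrier R. y \<oplus>\<^bsub>R\<^esub> x = \<zero>\<^bsub>R\<^esub>"
      by (intro bexI[of _ "\<rho> (- f)"]) (auto simp: carrier_model ops_model)
  qed (auto simp: carrier_model ops_model algebra_simps)
  show "monoid R"
    by (rule monoidI) (auto simp: carrier_model ops_model mult.assoc)
qed (auto simp: carrier_model ops_model distrib_left distrib_right)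

lemma module_model: "module (ring_of_type_algebra :: 'k ring) R"
proof (rule moduleI[OF cring_from_type_algebra ring.is_abelian_group[OF ring_model]])
  fix x assume "x \<in> carrier R"
  then obtain f where x: "x = \<rho> f" by (auto simp: carrier_model)
  show "\<one>\<^bsub>ring_of_type_algebra :: 'k ring\<^esub> \<odot>\<^bsub>R\<^esub> x = x"
    by (simp add: x ring_of_type_algebra_def smult_model mon_zone_one)
  fix a b :: 'k
  show "a \<odot>\<^bsub>R\<^esub> x \<in> carrier R" by (simp add: x carrier_model smult_model)
  show "(a \<oplus>\<^bsub>ring_of_type_algebra\<^esub> b) \<odot>\<^bsub>R\<^esub> x = a \<odot>\<^bsub>R\<^esub> x \<oplus>\<^bsub>R\<^esub> b \<odot>\<^bsub>R\<^esub> x"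
    by (simp add: x ring_of_type_algebra_def smult_model add_model scal_add distrib_right)
  show "(a \<otimes>\<^bsub>ring_of_type_algebra\<^esub> b) \<odot>\<^bsub>R\<^esub> x = a \<odot>\<^bsub>R\<^esub> (b \<odot>\<^bsub>R\<^esub> x)"
    by (simp only: x ring_of_type_algebra_def smult_model scal_mult mult.assoc partial_object.simps monoid.simps)
  fix y assume "y \<in> carrier R"
  then obtain g where y: "y = \<rho> g" by (auto simp: carrier_model)
  show "a \<odot>\<^bsub>R\<^esub> (x \<oplus>\<^bsub>R\<^esub> y) = a \<odot>\<^bsub>R\<^esub> x \<oplus>\<^bsub>R\<^esub> a \<odot>\<^bsub>R\<^esub> y"
    by (simp add: x y smult_model add_model distrib_left)
qed

lemma minus_model: "\<ominus>\<^bsub>R\<^esub> \<rho> f = \<rho> (- f)"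
proof -
  interpret ring R by (rule ring_model)
  show ?thesis
    by (rule minus_equality) (auto simp: carrier_model ops_model)
qed

lemma submodule_model_iff:
  "submodule W (ring_of_type_algebra :: 'k ring) R \<longleftrightarrow> (\<exists>V. W = \<rho> ` V \<and> malg_vs.subspace V)"
proof
  interpret M: module "ring_of_type_algebra :: 'k ring" R by (rule module_model)
  assume W: "submodule W (ring_of_type_algebra :: 'k ring) R"
  note E = M.submoduleE[OF W]
  let ?V = "\<rho> -` W"
  have "W = \<rho> ` ?V" using E(1) by (auto simp: carrier_model)
  moreover have "malg_vs.subspace ?V"
  proof (rule malg_vs.subspaceI)
    obtain w where w: "w \<in> W" using E(2) by blast
    then obtain f where "w = \<rho> f" using E(1) by (auto simp: carrier_model)
    then show "0 \<in> ?V"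
      using E(5)[OF w E(3)[OF w]] by (simp add: minus_model ops_model)
  next
    fix f g assume "f \<in> ?V" "g \<in> ?V"
    then show "f + g \<in> ?V" using E(5)[of "\<rho> f" "\<rho> g"] by (simp add: ops_model)
  next
    fix c f assume "f \<in> ?V"
    then show "scal c * f \<in> ?V"
      using E(4)[of c "\<rho> f"] by (simp add: ops_model ring_of_type_algebra_def)
  qed
  ultimately show "\<exists>V. W = \<rho> ` V \<and> malg_vs.subspace V" by blast
next
  interpret M: module "ring_of_type_algebra :: 'k ring" R by (rule module_model)
  assume "\<exists>V. W = \<rho> ` V \<and> malg_vs.subspace V"
  then obtain V where V: "W = \<rho> ` V" "malg_vs.subspace V" by blast
  show "submodule W (ring_of_type_algebra :: 'k ring) R"
    unfolding V(1)
    by (rule M.submoduleI)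
      (auto simp: carrier_model minus_model ops_model malg_vs.subspace_0[OF V(2)]
        intro!: imageI malg_vs.subspace_neg[OF V(2)] malg_vs.subspace_add[OF V(2)] malg_vs.subspace_scale[OF V(2)])
qed

lemma subspace_hom: "malg_vs.subspace (hom n :: ('w, 'k) malg set)"
  by (rule malg_vs.subspaceI) (auto intro: hom_add hom_scal_times)

lemma kspan_model: "kspan R (\<rho> ` S) = \<rho> ` malg_vs.span S"
proof
  show "kspan R (\<rho> ` S) \<subseteq> \<rho> ` malg_vs.span S"
    unfolding kspan_def using malg_vs.span_superset[of S]
    by (intro Inter_lower) (auto simp: submodule_model_iff)
  show "\<rho> ` malg_vs.span S \<subseteq> kspan R (\<rho> ` S)"
    unfolding kspan_def
  proof (rule Inter_greatest)
    fix W assume "W \<in> {W. submodule W (ring_of_type_algebra :: 'k ring) R \<and> \<rho> ` S \<subseteq> W}"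
    then obtain V where V: "W = \<rho> ` V" "malg_vs.subspace V" "\<rho> ` S \<subseteq> \<rho> ` V"
      by (auto simp: submodule_model_iff)
    then have "S \<subseteq> V" using inj_image_subset_iff[OF inj_model] by blast
    then show "\<rho> ` malg_vs.span S \<subseteq> W" using malg_vs.span_minimal V by blast
  qed
qed

lemma is_basis_model_iff:
  "is_basis R (\<rho> ` B) (\<rho> ` V) \<longleftrightarrow> B \<subseteq> V \<and> malg_vs.span B = V \<and> malg_vs.independent B"
proof -
  have "\<rho> ` B - {\<rho> b} = \<rho> ` (B - {b})" for b using inj_model by (auto simp: inj_def)
  then show ?thesis
    by (auto simp: is_basis_def kspan_model inj_image_subset_iff[OF inj_model]
        inj_image_eq_iff[OF inj_model] inj_image_mem_iff[OF inj_model] malg_vs.dependent_def)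
qed

lemma hom_basis:
  fixes n
  defines "E \<equiv> (\<lambda>w. mon w 1 :: ('w, 'k) malg) ` {w. zdeg w = n}"
  shows "malg_vs.span E = hom n" "malg_vs.independent E" "E \<subseteq> hom n"
    "card E = card {w :: 'w. zdeg w = n}"
proof -
  show E: "E \<subseteq> hom n" by (auto simp: E_def hom_mon)
  have "f \<in> malg_vs.span E" if "f \<in> hom n" for f
  proof -
    have "supp f \<subseteq> {w. zdeg w = n}" using that by (auto simp: hom_def)
    then show ?thesis
    proof (induction rule: malg_induct)
      case (mon w c)
      then have "scal c * mon w 1 \<in> malg_vs.span E"
        by (intro malg_vs.span_scale malg_vs.span_base) (auto simp: E_def)
      then show ?case by (simp add: scal_times_mon)
    qed (auto intro: malg_vs.span_zero malg_vs.span_add)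
  qed
  then show "malg_vs.span E = hom n" using malg_vs.span_minimal[OF E subspace_hom] by blast
  have inj: "inj (\<lambda>w. mon w 1 :: ('w, 'k) malg)"
    by (rule injI) (metis cf_mon lookup_single_eq lookup_single_not_eq zero_neq_one)
  then show "card E = card {w :: 'w. zdeg w = n}" unfolding E_def
    by (intro card_image) (auto simp: inj_on_def)
  have "mon w 1 \<notin> malg_vs.span (E - {mon w 1})" if "zdeg w = n" for w
  proof -
    have "malg_vs.span (E - {mon w 1}) \<subseteq> {f. coeff f w = 0}"
    proof (rule malg_vs.span_minimal)
      show "E - {mon w 1} \<subseteq> {f. coeff f w = 0}"
        by (auto simp: E_def lookup_single when_def)
    qed (auto intro!: malg_vs.subspaceI simp: lookup_add coeff_scal_times)
    then show ?thesis by auto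
  qed
  then show "malg_vs.independent E" by (auto simp: malg_vs.dependent_def E_def)
qed

text \<open>Whichever basis the choice in \<open>kdim\<close> returns, its preimage under
  \<open>\<rho>\<close> is a basis of \<open>hom n\<close>, and its cardinality is compared with
  that of the monomial basis.\<close>

lemma kdim_hcomp: "kdim R (hcomp R n) = card {w :: 'w. zdeg w = n}"
proof -
  let ?E = "(\<lambda>w. mon w 1 :: ('w, 'k) malg) ` {w. zdeg w = n}"
  have "is_basis R (\<rho> ` ?E) (hcomp R n)"
    unfolding hcomp_model is_basis_model_iff using hom_basis[of n] by simp
  then have *: "is_basis R (SOME B. is_basis R B (hcomp R n)) (hcomp R n)" (is "is_basis R ?B _")
    by (rule someI)
  then obtain B where B: "?B = \<rho> ` B"
    by (metis hcomp_model is_basis_def subset_imageE)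
  then have "B \<subseteq> hom n" "malg_vs.span B = hom n" "malg_vs.independent B"
    using *[unfolded B] unfolding hcomp_model is_basis_model_iff by auto
  then have "card B = malg_vs.dim (hom n :: ('w, 'k) malg set)" by (intro malg_vs.basis_card_eq_dim) auto
  also have "\<dots> = card ?E"
    using hom_basis[of n] by (intro malg_vs.basis_card_eq_dim[symmetric]) auto
  finally have "card B = card {w :: 'w. zdeg w = n}" using hom_basis(4)[of n] by simp
  then show ?thesis unfolding kdim_def B
    using card_image[of \<rho> B] inj_model by (metis inj_on_subset subset_UNIV)
qed

lemma finsum_model: "finsum R (\<lambda>n. \<rho> (g n)) S = \<rho> (sum g S)" if "finite S"
  using that
proof (induction S rule: finite_induct)
  case empty
  interpret ring R by (rule ring_model)
  show ?case by (simp add: ops_model)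
next
  case (insert x F)
  interpret ring R by (rule ring_model)
  show ?case using insert by (subst finsum_insert) (auto simp: carrier_model ops_model)
qed

lemma sum_pr: "(\<Sum>n\<in>{n. pr n f \<noteq> 0}. pr n f) = f" and finite_pr: "finite {n. pr n f \<noteq> 0}"
  for f :: "('w, 'k) malg"
proof -
  have sub: "{n. pr n f \<noteq> 0} \<subseteq> zdeg ` supp f"
  proof
    fix n assume "n \<in> {n. pr n f \<noteq> 0}"
    then obtain w where "w \<in> supp (pr n f)" using malg_supp_nonempty[of "pr n f"] by auto
    then show "n \<in> zdeg ` supp f" by (auto simp: in_keys_iff coeff_pr split: if_splits)
  qed
  show fin: "finite {n. pr n f \<noteq> 0}" by (rule finite_subset[OF sub]) simp
  have "(\<Sum>n\<in>{n. pr n f \<noteq> 0}. pr n f) = (\<Sum>n\<in>zdeg ` supp f. pr n f)"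
    using sub by (intro sum.mono_neutral_left) auto
  also have "\<dots> = f"
    unfolding malg_eq_iff additiveD(5)[OF additive_cf]
    by (rule poly_mapping_eqI) (auto simp: lookup_sum coeff_pr sum.delta' in_keys_iff)
  finally show "(\<Sum>n\<in>{n. pr n f \<noteq> 0}. pr n f) = f" .
qed

lemma connected_graded_model: "connected_graded_algebra R"
proof (intro connected_graded_algebra.intro ring_model module_model connected_graded_algebra_axioms.intro)
  fix x assume "x \<in> carrier R"
  then obtain f where x: "x = \<rho> f" by (auto simp: carrier_model)
  have eq0: "\<rho> g = \<rho> 0 \<longleftrightarrow> g = 0" for g using inj_model by (auto simp: inj_def)
  show "\<exists>!f. (\<forall>n. f n \<in> hcomp R n) \<and> finite {n. f n \<noteq> \<zero>\<^bsub>R\<^esub>} \<and> x = (\<Oplus>\<^bsub>R\<^esub>n\<in>{n. f n \<noteq> \<zero>\<^bsub>R\<^esub>}. f n)"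
  proof (rule ex1I[of _ "\<lambda>n. \<rho> (pr n f)"])
    show "(\<forall>n. \<rho> (pr n f) \<in> hcomp R n) \<and> finite {n. \<rho> (pr n f) \<noteq> \<zero>\<^bsub>R\<^esub>} \<and>
      x = (\<Oplus>\<^bsub>R\<^esub>n\<in>{n. \<rho> (pr n f) \<noteq> \<zero>\<^bsub>R\<^esub>}. \<rho> (pr n f))"
      by (auto simp: ops_model pr_hom eq0 finite_pr finsum_model sum_pr x)
  next
    fix h assume h: "(\<forall>n. h n \<in> hcomp R n) \<and> finite {n. h n \<noteq> \<zero>\<^bsub>R\<^esub>} \<and> x = (\<Oplus>\<^bsub>R\<^esub>n\<in>{n. h n \<noteq> \<zero>\<^bsub>R\<^esub>}. h n)"
    then have "\<forall>n. \<exists>g\<in>hom n. h n = \<rho> g" by (auto simp: hcomp_model)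
    then obtain g where g: "\<And>n. g n \<in> hom n" "\<And>n. h n = \<rho> (g n)" by metis
    then have hg: "h = (\<lambda>n. \<rho> (g n))" by auto
    from h have fin: "finite {n. g n \<noteq> 0}" and "\<rho> f = \<rho> (\<Sum>n\<in>{n. g n \<noteq> 0}. g n)"
      by (auto simp: hg zero_model eq0 finsum_model x)
    then have f: "f = (\<Sum>n\<in>{n. g n \<noteq> 0}. g n)" using inj_model by (auto simp: inj_def)
    have "pr m f = g m" for m
      unfolding f additiveD(5)[OF additive_pr] using fin
      by (auto simp: pr_of_hom[OF g(1)])
    then show "h = (\<lambda>n. \<rho> (pr n f))" by (simp add: hg)
  qed
next
  fix n show "submodule (hcomp R n) (ring_of_type_algebra :: 'k ring) R"
    using subspace_hom by (auto simp: submodule_model_iff hcomp_model)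
next
  show "\<one>\<^bsub>R\<^esub> \<noteq> \<zero>\<^bsub>R\<^esub>"
    using injD[OF inj_model, of 1 0] by (auto simp: ops_model)
next
  show "hcomp R 0 = {c \<odot>\<^bsub>R\<^esub> \<one>\<^bsub>R\<^esub> | c. True}"
    by (auto simp: ops_model hom_zero_iff intro: hom_scal)
next
  show "\<exists>B. finite B \<and> is_basis R B (hcomp R 1)"
    using hom_basis[of 1] finite_zdeg_1[where 'a='w]
    by (intro exI[of _ "\<rho> ` (\<lambda>w. mon w 1) ` {w. zdeg w = 1}"]) (simp add: hcomp_model is_basis_model_iff)
next
  fix x y c assume "x \<in> carrier R" "y \<in> carrier R"
  then obtain f g where "x = \<rho> f" "y = \<rho> g" by (auto simp: carrier_model)
  then show "(c \<odot>\<^bsub>R\<^esub> x) \<otimes>\<^bsub>R\<^esub> y = c \<odot>\<^bsub>R\<^esub> (x \<otimes>\<^bsub>R\<^esub> y)"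
    "x \<otimes>\<^bsub>R\<^esub> (c \<odot>\<^bsub>R\<^esub> y) = c \<odot>\<^bsub>R\<^esub> (x \<otimes>\<^bsub>R\<^esub> y)"
    using scal_central[of c f] by (simp_all add: ops_model mult.assoc[symmetric])
next
  fix x y m n assume "x \<in> hcomp R m" "y \<in> hcomp R n"
  then show "x \<otimes>\<^bsub>R\<^esub> y \<in> hcomp R (m + n)"
    by (auto simp: ops_model intro!: imageI hom_mult)
qed

subsection \<open>Comparison of the bar complexes\<close>

abbreviation \<sigma> :: "'a \<Rightarrow> ('w, 'k) malg" where "\<sigma> \<equiv> inv_into UNIV \<rho>"

lemma \<sigma>_\<rho> [simp]: "\<sigma> (\<rho> f) = f" by (rule inv_f_f[OF inj_model])

text \<open>Sends [a_1|...|a_i] to a_1 \<otimes> [a_2|...|a_i] expanded in monomials; in each step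
  the contraction turns the leading coefficient of the tail into a bar entry. The empty symbol has
  no first entry: its value 0 is a placeholder, and the comparison below concerns positive
  homological degree.\<close>

primrec em :: "'a list \<Rightarrow> ('w, 'k) bres"
  where
    "em [] = 0"
  | "em (a # as) = lsc (\<sigma> a) (if as = [] then Poly_Mapping.single [] 1 else bres_contr (em as))"

definition Em :: "('a list \<Rightarrow>\<^sub>0 'k) \<Rightarrow> ('w, 'k) bres"
  where "Em = lin (\<lambda>as c. lsc (scal c) (em as))"

lemma additive_Em: "additive Em"
  unfolding Em_def by (intro additive_lin additive_compose[OF additive_lsc_left additive_mon])

lemma Em_single: "Em (Poly_Mapping.single as c) = lsc (scal c) (em as)"
  unfolding Em_def by (rule lin_single[OF additive_compose[OF additive_lsc_left additive_mon]])

lemma Em_bar: "Em (bar as) = em as"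
  by (simp add: bar_def Em_single mon_zone_one lsc_simps)

lemma Em_scale: "Em (pm_scale c p) = lsc (scal c) (Em p)"
proof -
  have "Poly_Mapping.keys p \<subseteq> UNIV" by simp
  then show ?thesis
  proof (induction rule: pm_induct_keys)
    case (single as d)
    then show ?case
      by (simp only: pm_scale_lsc lsc_simps(8) Em_single scal_mult lsc_simps(5))
  qed (simp_all add: pm_scale_lsc lsc_simps additiveD[OF additive_Em])
qed

lemmas Em_simps = additiveD[OF additive_Em] Em_bar Em_scale

lemma has_degrees_simps:
  "has_degrees R [] ns \<longleftrightarrow> ns = []"
  "has_degrees R (a # as) ns \<longleftrightarrow> (\<exists>f n ms. a = \<rho> f \<and> f \<in> hom n \<and> 0 < n \<and> ns = n # ms \<and> has_degrees R as ms)"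
  by (auto simp: has_degrees_def hcomp_model list_all2_Cons1)

lemma has_degrees_append:
  "has_degrees R as ns \<Longrightarrow> has_degrees R bs ms \<Longrightarrow> has_degrees R (as @ bs) (ns @ ms)"
  by (auto simp: has_degrees_def list_all2_appendI)

lemma has_degrees_length: "has_degrees R as ns \<Longrightarrow> length as = length ns"
  by (auto simp: has_degrees_def list_all2_lengthD)

lemma em_hom:
  "has_degrees R as ns \<Longrightarrow> as \<noteq> [] \<Longrightarrow> em as \<in> bres_hom (length as - 1) (sum_list ns)"
proof (induction as arbitrary: ns)
  case (Cons a as)
  then obtain f n ms where *: "a = \<rho> f" "f \<in> hom n" "0 < n" "ns = n # ms" "has_degrees R as ms"
    by (auto simp: has_degrees_simps)
  show ?case
  proof (cases as)
    case Nil
    then have "ms = []" using * by (simp add: has_degrees_simps)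
    then show ?thesis using * Nil bres_hom_single[of f n "[]" n] by (simp add: lsc_simps)
  next
    case (Cons b bs)
    then show ?thesis
      using bres_hom_lsc[OF *(2) contr_hom[OF Cons.IH[OF *(5)]]] * by simp
  qed
qed simp

lemma hom_pos_zone: "f \<in> hom n \<Longrightarrow> 0 < n \<Longrightarrow> coeff f zone = 0"
  by (metis (mono_tags, lifting) hom_def in_keys_iff mem_Collect_eq less_numeral_extra(3) zdeg_zone)

lemma em_plus:
  assumes "has_degrees R as ns" "as \<noteq> []"
  shows "em as \<in> bres_plus (length as - 1) (sum_list ns)"
proof -
  obtain a as' where as: "as = a # as'" using assms(2) by (cases as) auto
  then obtain f n where f: "a = \<rho> f" "f \<in> hom n" "0 < n" using assms by (auto simp: has_degrees_simps)
  define \<zeta> where "\<zeta> = (if as' = [] then Poly_Mapping.single [] 1 else bres_contr (em as'))"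
  have \<zeta>: "Poly_Mapping.lookup \<zeta> ws \<in> hom 0" for ws
  proof (cases "as' = []")
    case True
    then show ?thesis by (auto simp: \<zeta>_def lookup_single when_def mon_zone_one[symmetric] hom_scal)
  next
    case False
    have "Poly_Mapping.lookup (bres_contr \<xi>) ws \<in> hom 0" for \<xi> :: "('w, 'k) bres"
      by (rule bres_induct[where Q="\<lambda>_ _. True"])
        (auto simp: contr_simps contr_single lookup_add lookup_single when_def hom_scal intro: hom_add)
    then show ?thesis using False by (simp add: \<zeta>_def)
  qed
  have "coeff (Poly_Mapping.lookup (em as) ws) zone = 0" for ws
    using hom_mult[OF f(2) \<zeta>, of ws] f(1,3) hom_pos_zone[of _ n]
    by (auto simp: as \<zeta>_def[symmetric])
  then show ?thesis using em_hom[OF assms] by (simp add: bres_plus_def in_keys_iff)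
qed

lemma em_slot:
  assumes "a \<in> carrier R" "b \<in> carrier R"
  shows "em (as @ [(c \<odot>\<^bsub>R\<^esub> a) \<oplus>\<^bsub>R\<^esub> b] @ bs) = lsc (scal c) (em (as @ [a] @ bs)) + em (as @ [b] @ bs)"
proof (induction as)
  case Nil
  then show ?case using assms by (auto simp: carrier_model ops_model lsc_simps single_add)
next
  case (Cons x as)
  then show ?case
    by (simp add: contr_simps contr_lsc_scal lsc_simps(1) lsc_scal_comm)
qed

subsection \<open>The kernel of the comparison map\<close>

lemma bar_multilin_Em: "r \<in> bar_multilin R i j \<Longrightarrow> Em r = 0"
proof -
  have "bar_multilin R i j \<subseteq> {r. Em r = 0}"
    unfolding bar_multilin_def
  proof (rule pm_vs.span_minimal, safe)
    fix as a b bs c ns m ns'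
    assume "has_degrees R [a] [m]" "has_degrees R [b] [m]"
    then have "a \<in> carrier R" "b \<in> carrier R" by (auto simp: has_degrees_simps carrier_model)
    from em_slot[OF this, of as c bs]
    show "Em (bar (as @ [c \<odot>\<^bsub>R\<^esub> a \<oplus>\<^bsub>R\<^esub> b] @ bs) - pm_scale c (bar (as @ [a] @ bs)) - bar (as @ [b] @ bs)) = 0"
      unfolding Em_simps by simp
  qed (rule pm_vs.subspaceI, auto simp: Em_simps lsc_simps)
  then show "r \<in> bar_multilin R i j \<Longrightarrow> Em r = 0" by auto
qed

lemma bar_multilin_subspace: "pm_vs.subspace (bar_multilin R i j)"
  unfolding bar_multilin_def by (rule pm_vs.subspace_span)

lemma bar_free_subspace: "pm_vs.subspace (bar_free R i j)"
  unfolding bar_free_def by (rule pm_vs.subspace_span)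

lemma bar_in_bar_free: "has_degrees R as ns \<Longrightarrow> length as = i \<Longrightarrow> sum_list ns = j \<Longrightarrow> bar as \<in> bar_free R i j"
  unfolding bar_free_def using has_degrees_length by (intro pm_vs.span_base) fastforce

lemma bar_multilin_gen:
  assumes "has_degrees R as ns" "has_degrees R bs ns'" "f \<in> hom m" "g \<in> hom m" "0 < m"
    and "length as + length bs + 1 = i" "sum_list ns + m + sum_list ns' = j"
  shows "bar (as @ [\<rho> (scal c * f + g)] @ bs) - pm_scale c (bar (as @ [\<rho> f] @ bs)) - bar (as @ [\<rho> g] @ bs)
    \<in> bar_multilin R i j"
  unfolding bar_multilin_def
proof (rule pm_vs.span_base, unfold mem_Collect_eq, intro exI conjI)
  show "bar (as @ [\<rho> (scal c * f + g)] @ bs) - pm_scale c (bar (as @ [\<rho> f] @ bs)) - bar (as @ [\<rho> g] @ bs) =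
    bar (as @ [(c \<odot>\<^bsub>R\<^esub> \<rho> f) \<oplus>\<^bsub>R\<^esub> \<rho> g] @ bs) - pm_scale c (bar (as @ [\<rho> f] @ bs)) - bar (as @ [\<rho> g] @ bs)"
    by (simp add: ops_model)
qed (use assms has_degrees_length in \<open>auto simp: has_degrees_simps\<close>)

definition m1 :: "'w \<Rightarrow> 'a" where "m1 w = \<rho> (mon w 1)"

definition slot :: "'a list \<Rightarrow> 'a list \<Rightarrow> ('w, 'k) malg \<Rightarrow> ('a list \<Rightarrow>\<^sub>0 'k)"
  where "slot as bs f = lin (\<lambda>w c. pm_scale c (bar (as @ [m1 w] @ bs))) (cf f)"

lemma additive_pm_scale: "additive (\<lambda>c. pm_scale c p)" "additive (pm_scale c)"
  by (simp_all add: pm_scale_lsc additive_lsc additive_lsc_left)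

lemma additive_slot: "additive (slot as bs)"
  unfolding slot_def by (intro additive_compose[OF additive_lin additive_cf] additive_pm_scale)

lemma slot_mon: "slot as bs (mon w c) = pm_scale c (bar (as @ [m1 w] @ bs))"
  unfolding slot_def cf_mon by (rule lin_single[OF additive_pm_scale(1)])

lemma slot_scal: "slot as bs (f * scal c) = pm_scale c (slot as bs f)"
proof -
  have "supp f \<subseteq> UNIV" by simp
  then show ?thesis
    by (induction rule: malg_induct)
      (simp_all add: mon_times_scal slot_mon pm_vs.scale_scale mult.commute distrib_right
        additiveD[OF additive_slot] pm_vs.scale_right_distrib)
qed

text \<open>A sum of monomials in one slot is taken apart by finitely many multilinearity relations.
  All monomials of f have the same degree m, so each intermediate symbol is homogeneous.\<close>

lemma slot_expand:
  assumes "has_degrees R as ns" "has_degrees R bs ns'" "f \<in> hom m" "0 < m"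
    and "length as + length bs + 1 = i" "sum_list ns + m + sum_list ns' = j"
  shows "bar (as @ [\<rho> f] @ bs) - slot as bs f \<in> bar_multilin R i j"
proof -
  note gen = bar_multilin_gen[OF assms(1,2) _ _ assms(4-6)]
  note sub = pm_vs.subspace_add[OF bar_multilin_subspace, of _ i j]
    pm_vs.subspace_diff[OF bar_multilin_subspace, of _ i j]
    pm_vs.subspace_neg[OF bar_multilin_subspace, of _ i j]
  \<comment> \<open>The relation with c = 1 and both entries 0 is minus this symbol.\<close>
  have zero: "bar (as @ [\<rho> 0] @ bs) \<in> bar_multilin R i j"
    using sub(3)[OF gen[OF hom_0 hom_0, of 1]] by simp
  have "supp f \<subseteq> {w. zdeg w = m}" using assms(3) by (auto simp: hom_def)
  then have "f \<in> hom m \<and> bar (as @ [\<rho> f] @ bs) - slot as bs f \<in> bar_multilin R i j"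
  proof (induction rule: malg_induct)
    case zero
    then show ?case using \<open>bar (as @ [\<rho> 0] @ bs) \<in> _\<close> by (simp add: additiveD[OF additive_slot])
  next
    case (add p q)
    have "bar (as @ [\<rho> (p + q)] @ bs) - bar (as @ [\<rho> p] @ bs) - bar (as @ [\<rho> q] @ bs) \<in> bar_multilin R i j"
      using gen[of p q 1] add.IH by (simp add: mon_zone_one)
    from sub(1)[OF this sub(1)[OF conjunct2[OF add.IH(1)] conjunct2[OF add.IH(2)]]]
    show ?case using add.IH by (simp add: additiveD[OF additive_slot] hom_add algebra_simps)
  next
    case (mon w c)
    then have h: "mon w 1 \<in> hom m" by (simp add: hom_mon)
    from sub(1)[OF gen[OF h hom_0, of c] zero] mon
    show ?case by (simp add: slot_mon m1_def scal_times_mon hom_mon)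
  qed
  then show ?thesis by simp
qed

text \<open>For \<open>qs = []\<close> this is an inverse of \<open>Em\<close> up to multilinearity;
  the prefix \<open>qs\<close> of entries not yet expanded serves the induction in
  \<open>tau_em\<close>.\<close>

definition tau :: "'a list \<Rightarrow> ('w, 'k) bres \<Rightarrow> ('a list \<Rightarrow>\<^sub>0 'k)"
  where "tau qs = lin (\<lambda>ws. slot qs (map m1 ws))"

lemma additive_tau: "additive (tau qs)"
  unfolding tau_def by (intro additive_lin additive_slot)

lemma tau_single: "tau qs (Poly_Mapping.single ws f) = slot qs (map m1 ws) f"
  unfolding tau_def by (rule lin_single[OF additive_slot])

lemma has_degrees_m1: "zone \<notin> set ws \<Longrightarrow> has_degrees R (map m1 ws) (map zdeg ws)"
  by (induction ws) (auto simp: has_degrees_simps m1_def hom_mon zdeg_eq_0 intro!: exI gr0I)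

lemma bres_plus_induct [consumes 1, case_names zero add single]:
  fixes \<zeta> :: "('w, 'k) bres"
  assumes "\<zeta> \<in> bres_plus i j" "P 0" "\<And>p q. P p \<Longrightarrow> P q \<Longrightarrow> P (p + q)"
    and "\<And>ws w c. length ws = i \<Longrightarrow> zone \<notin> set (w # ws) \<Longrightarrow> sum_list (map zdeg (w # ws)) = j \<Longrightarrow>
      P (Poly_Mapping.single ws (mon w c))"
  shows "P \<zeta>"
proof (rule bres_induct[where Q="\<lambda>ws w. length ws = i \<and> zone \<notin> set (w # ws) \<and> sum_list (map zdeg (w # ws)) = j"])
  fix ws w assume "ws \<in> Poly_Mapping.keys \<zeta>" "w \<in> supp (Poly_Mapping.lookup \<zeta> ws)"
  then show "length ws = i \<and> zone \<notin> set (w # ws) \<and> sum_list (map zdeg (w # ws)) = j"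
    using assms(1) unfolding bres_plus_def bres_hom_def by auto
qed (use assms in auto)

lemma em_m1: "zone \<notin> set (w # ws) \<Longrightarrow> em (map m1 (w # ws)) = Poly_Mapping.single ws (mon w 1)"
proof (induction ws arbitrary: w)
  case (Cons v vs)
  then have "em (map m1 (v # vs)) = Poly_Mapping.single vs (mon v 1)" by simp
  moreover have "em (map m1 (w # v # vs)) = lsc (mon w 1) (bres_contr (em (map m1 (v # vs))))"
    by (simp add: m1_def)
  moreover have "v \<noteq> zone" using Cons.prems by auto
  ultimately show ?case
    by (simp add: contr_single lsc_simps mon_zone_one del: em.simps list.map)
qed (simp add: m1_def lsc_simps)

lemma tau_section:
  assumes "\<eta> \<in> bres_plus i j"
  shows "tau [] \<eta> \<in> bar_free R (Suc i) j" "Em (tau [] \<eta>) = \<eta>"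
proof -
  have "tau [] \<eta> \<in> bar_free R (Suc i) j \<and> Em (tau [] \<eta>) = \<eta>"
    using assms
  proof (induction rule: bres_plus_induct)
    case zero
    then show ?case using pm_vs.subspace_0[OF bar_free_subspace] by (simp add: additiveD[OF additive_tau] Em_simps)
  next
    case (add p q)
    then show ?case using pm_vs.subspace_add[OF bar_free_subspace] by (simp add: additiveD[OF additive_tau] Em_simps)
  next
    case (single ws w c)
    have "tau [] (Poly_Mapping.single ws (mon w c)) = pm_scale c (bar (map m1 (w # ws)))"
      by (simp add: tau_single slot_mon)
    moreover have "bar (map m1 (w # ws)) \<in> bar_free R (Suc i) j"
      using bar_in_bar_free[OF has_degrees_m1[OF single(2)]] single by simp
    ultimately show ?case
      using pm_vs.subspace_scale[OF bar_free_subspace] em_m1[OF single(2)]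
      by (simp only: Em_simps lsc_simps scal_times_mon) simp
  qed
  then show "tau [] \<eta> \<in> bar_free R (Suc i) j" "Em (tau [] \<eta>) = \<eta>" by auto
qed

text \<open>Entries are expanded from the last to the first: the induction hypothesis, with a moved
  into the prefix, makes the tail monomial, and then a is expanded in front of monomials by
  \<open>slot_expand\<close>.\<close>

lemma tau_em:
  assumes "has_degrees R qs ms" "has_degrees R as ns" "as \<noteq> []"
    and "length qs + length as = i" "sum_list ms + sum_list ns = j"
  shows "bar (qs @ as) - tau qs (em as) \<in> bar_multilin R i j"
  using assms
proof (induction as arbitrary: qs ms ns)
  case (Cons a as)
  then obtain f n ns' where *: "a = \<rho> f" "f \<in> hom n" "0 < n" "ns = n # ns'" "has_degrees R as ns'"
    by (auto simp: has_degrees_simps)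
  show ?case
  proof (cases "as = []")
    case True
    then show ?thesis
      using slot_expand[OF Cons.prems(1) _ *(2,3), of "[]" "[]" i j] Cons.prems *
      by (simp add: has_degrees_simps lsc_simps tau_single)
  next
    case False
    have IH: "bar ((qs @ [a]) @ as) - tau (qs @ [a]) (em as) \<in> bar_multilin R i j"
      using Cons.prems * False
      by (intro Cons.IH[where ms="ms @ [n]" and ns=ns'] has_degrees_append) (auto simp: has_degrees_simps)
    have "tau (qs @ [a]) \<zeta> - tau qs (lsc f (bres_contr \<zeta>)) \<in> bar_multilin R i j"
      if "\<zeta> \<in> bres_plus (length as - 1) (sum_list ns')" for \<zeta>
      using that
    proof (induction rule: bres_plus_induct)
      case zero
      then show ?case using pm_vs.subspace_0[OF bar_multilin_subspace]
        by (simp add: additiveD[OF additive_tau] contr_simps lsc_simps)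
    next
      case (add p q)
      from pm_vs.subspace_add[OF bar_multilin_subspace add.IH]
      show ?case by (simp add: additiveD[OF additive_tau] contr_simps lsc_simps algebra_simps)
    next
      case (single ws w c)
      have "bar (qs @ [\<rho> f] @ map m1 (w # ws)) - slot qs (map m1 (w # ws)) f \<in> bar_multilin R i j"
        using Cons.prems * single False
        by (intro slot_expand[OF Cons.prems(1) has_degrees_m1[OF single(2)] *(2,3)]) auto
      moreover have "w \<noteq> zone" using single(2) by auto
      ultimately show ?case
        using pm_vs.subspace_scale[OF bar_multilin_subspace, of _ i j c]
        by (fastforce simp add: tau_single slot_mon contr_single lsc_simps slot_scal pm_vs.scale_right_diff_distrib *(1))
    qed
    from pm_vs.subspace_add[OF bar_multilin_subspace IH this[OF em_plus[OF *(5) False]]]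
    show ?thesis using False * by simp
  qed
qed simp

text \<open>By \<open>tau_em\<close> a chain p agrees with \<open>tau [] (Em p)\<close> modulo
  multilinearity. Together with \<open>bar_multilin_Em\<close> this makes
  \<open>bar_multilin\<close> the kernel of \<open>Em\<close>, so the quotient in the definition of
  the bar complex is the tensor power of A_+.\<close>

lemma Em_eq_0:
  assumes "p \<in> bar_free R (Suc i) j" "Em p = 0"
  shows "p \<in> bar_multilin R (Suc i) j"
proof -
  have "bar_free R (Suc i) j \<subseteq> {p. p - tau [] (Em p) \<in> bar_multilin R (Suc i) j}"
    unfolding bar_free_def
  proof (rule pm_vs.span_minimal, safe)
    fix as ns assume "has_degrees R as ns" "length ns = Suc i" "j = sum_list ns"
    then show "bar as - tau [] (Em (bar as)) \<in> bar_multilin R (Suc i) (sum_list ns)"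
      using tau_em[of "[]" "[]" as ns "Suc i" j] has_degrees_length[of as ns]
      by (cases "as = []") (auto simp: has_degrees_simps Em_simps)
  next
    have "tau [] (lsc (scal c) \<zeta>) = pm_scale c (tau [] \<zeta>)" for c \<zeta>
    proof (rule bres_induct[where Q="\<lambda>_ _. True" and \<zeta>=\<zeta>])
      fix ws and w :: 'w and d
      show "tau [] (lsc (scal c) (Poly_Mapping.single ws (mon w d))) = pm_scale c (tau [] (Poly_Mapping.single ws (mon w d)))"
        using scal_central[of c "mon w d"] by (simp add: lsc_simps(8) tau_single slot_scal)
    qed (simp_all add: lsc_simps additiveD[OF additive_tau] pm_vs.scale_right_distrib)
    then show "pm_vs.subspace {p. p - tau [] (Em p) \<in> bar_multilin R (Suc i) j}"
      using pm_vs.subspace_add[OF bar_multilin_subspace] pm_vs.subspace_scale[OF bar_multilin_subspace]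
        pm_vs.subspace_0[OF bar_multilin_subspace]
      by (intro pm_vs.subspaceI)
        (auto simp: Em_simps additiveD[OF additive_tau] add_diff_add pm_vs.scale_right_diff_distrib[symmetric])
  qed
  then show ?thesis using assms by (auto simp: additiveD[OF additive_tau])
qed

subsection \<open>Off-diagonal vanishing\<close>

definition bdl :: "'a list \<Rightarrow> ('a list \<Rightarrow>\<^sub>0 'k)"
  where "bdl as = (\<Sum>l<length as - 1. pm_scale ((-1) ^ Suc l) (bar (bar_face R l as)))"

lemma bar_diff_lin: "bar_diff R = lin (\<lambda>as c. pm_scale c (bdl as))"
  by (intro ext) (simp add: bar_diff_def lin_def bdl_def)

lemma additive_bar_diff: "additive (bar_diff R)"
  unfolding bar_diff_lin by (intro additive_lin additive_pm_scale)

lemma bar_diff_bar: "bar_diff R (bar as) = bdl as"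
  unfolding bar_diff_lin bar_def by (subst lin_single[OF additive_pm_scale(1)]) simp

lemma bar_diff_scale: "bar_diff R (pm_scale c p) = pm_scale c (bar_diff R p)"
proof -
  have "Poly_Mapping.keys p \<subseteq> UNIV" by simp
  then show ?thesis
  proof (induction rule: pm_induct_keys)
    case (single as d)
    then show ?case
      by (simp add: bar_diff_lin pm_scale_lsc lsc_simps lin_single[OF additive_lsc_left])
  qed (simp_all add: pm_scale_lsc lsc_simps additiveD[OF additive_bar_diff])
qed

lemmas bar_diff_simps = additiveD[OF additive_bar_diff] bar_diff_bar bar_diff_scale

lemma bdl_Cons: "bdl (a # b # as) = - bar ((a \<otimes>\<^bsub>R\<^esub> b) # as) -
    (\<Sum>l<length as. pm_scale ((-1) ^ Suc l) (bar (a # bar_face R l (b # as))))"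
proof -
  have "bdl (a # b # as) = (\<Sum>l<Suc (length as). pm_scale ((-1) ^ Suc l) (bar (bar_face R l (a # b # as))))"
    by (simp add: bdl_def)
  also have "\<dots> = pm_scale (-1) (bar (bar_face R 0 (a # b # as))) +
      (\<Sum>l<length as. pm_scale ((-1) ^ Suc (Suc l)) (bar (bar_face R (Suc l) (a # b # as))))"
    by (subst sum.lessThan_Suc_shift) simp
  finally show ?thesis
    by (simp add: bar_face_def sum_negf pm_vs.scale_minus_left)
qed

lemma bar_face_not_Nil: "bar_face R l as \<noteq> []"
  by (simp add: bar_face_def)

text \<open>The first face of [a|as] contributes -a em(as), the other faces a s(d(em(as))). By the
  homotopy identity for em(as) they add up to -a d(s(em(as))). The minus sign is that of the first
  face.\<close>

lemma Em_bdl: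
  assumes "has_degrees R as ns"
  shows "Em (bdl as) = - bres_d (em as)"
  using assms
proof (induction as arbitrary: ns)
  case Nil
  then show ?case by (simp add: bdl_def Em_simps d_simps)
next
  case (Cons a as)
  then obtain f n ms where *: "a = \<rho> f" "f \<in> hom n" "0 < n" "ns = n # ms" "has_degrees R as ms"
    by (auto simp: has_degrees_simps)
  show ?case
  proof (cases as)
    case Nil
    then show ?thesis by (simp add: bdl_def Em_simps d_lsc d_single lsc_simps)
  next
    case as: (Cons b bs)
    then obtain g m where g: "b = \<rho> g" "g \<in> hom m" "0 < m" "m \<le> sum_list ms"
      using *(5) by (auto simp: has_degrees_simps)
    have "Em (\<Sum>l<length bs. pm_scale ((-1) ^ Suc l) (bar (a # bar_face R l as)))
        = lsc f (bres_contr (Em (bdl as)))"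
      by (simp add: Em_simps(1-5) Em_bar Em_scale bar_face_not_Nil *(1) bdl_def as contr_simps
          lsc_sum contr_lsc_scal lsc_scal_comm additiveD[OF additive_lsc])
    also have "\<dots> = - lsc f (bres_contr (bres_d (em as)))"
      using Cons.IH[OF *(5)] by (simp add: contr_simps additiveD[OF additive_lsc])
    finally have "Em (bdl (a # as)) = - em ((a \<otimes>\<^bsub>R\<^esub> b) # bs) + lsc f (bres_contr (bres_d (em as)))"
      unfolding as bdl_Cons by (simp add: Em_simps as)
    also have "em ((a \<otimes>\<^bsub>R\<^esub> b) # bs) = lsc f (em as)"
      by (simp add: as * g ops_model lsc_simps)
    also have "lsc f (em as) = lsc f (bres_d (bres_contr (em as))) + lsc f (bres_contr (bres_d (em as)))"
      using arg_cong[OF homotopy[OF em_hom[OF *(5)]], of "lsc f"] as g(3,4) by (simp add: lsc_simps)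
    finally have "Em (bdl (a # as)) = - lsc f (bres_d (bres_contr (em as)))" by simp
    moreover have "em (a # as) = lsc f (bres_contr (em as))" by (simp add: as *(1))
    ultimately show ?thesis by (simp only: d_lsc)
  qed
qed

lemma Em_bar_diff: "p \<in> bar_free R i j \<Longrightarrow> Em (bar_diff R p) = - bres_d (Em p)"
proof -
  have "bar_free R i j \<subseteq> {p. Em (bar_diff R p) = - bres_d (Em p)}"
    unfolding bar_free_def
    by (rule pm_vs.span_minimal)
      (auto intro!: pm_vs.subspaceI simp: Em_simps bar_diff_simps Em_bdl d_simps d_lsc
        additiveD[OF additive_lsc])
  then show "p \<in> bar_free R i j \<Longrightarrow> Em (bar_diff R p) = - bres_d (Em p)" by auto
qed

lemma has_degrees_face:
  assumes "has_degrees R as ns" "Suc l < length as"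
  shows "\<exists>ms. has_degrees R (bar_face R l as) ms \<and> sum_list ms = sum_list ns"
  using assms
proof (induction l arbitrary: as ns)
  case 0
  then obtain a b bs where "as = a # b # bs" by (cases as; cases "tl as") auto
  with 0 obtain f n g m ms where "as = \<rho> f # \<rho> g # bs" "f \<in> hom n" "g \<in> hom m" "0 < n" "0 < m"
    "ns = n # m # ms" "has_degrees R bs ms"
    by (auto simp: has_degrees_simps)
  then show ?case
    by (intro exI[of _ "(n + m) # ms"]) (auto simp: bar_face_def has_degrees_simps ops_model hom_mult)
next
  case (Suc l)
  then obtain a bs where as: "as = a # bs" by (cases as) auto
  with Suc obtain n ms where *: "ns = n # ms" "has_degrees R [a] [n]" "has_degrees R bs ms"
    by (auto simp: has_degrees_simps)
  then obtain ms' where "has_degrees R (bar_face R l bs) ms' \<and> sum_list ms' = sum_list ms"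
    using Suc.IH[of bs ms] Suc.prems as by auto
  moreover have "bar_face R (Suc l) as = a # bar_face R l bs" by (simp add: as bar_face_def)
  ultimately show ?case
    using * by (intro exI[of _ "n # ms'"]) (auto simp: has_degrees_simps)
qed

lemma bar_diff_free:
  assumes "q \<in> bar_free R (Suc i) j"
  shows "bar_diff R q \<in> bar_free R i j"
proof -
  have "bar_free R (Suc i) j \<subseteq> {q. bar_diff R q \<in> bar_free R i j}"
    unfolding bar_free_def[of R "Suc i"]
  proof (rule pm_vs.span_minimal, safe)
    fix as ns assume as: "has_degrees R as ns" "length ns = Suc i" "j = sum_list ns"
    then have len: "length as = Suc i" using has_degrees_length by simp
    have "bar (bar_face R l as) \<in> bar_free R i (sum_list ns)" if l: "l < i" for l
    proof -
      obtain ms where "has_degrees R (bar_face R l as) ms" "sum_list ms = sum_list ns"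
        using has_degrees_face[OF as(1), of l] l len by auto
      moreover have "length (bar_face R l as) = i" using l len by (auto simp: bar_face_def)
      ultimately show ?thesis using bar_in_bar_free by blast
    qed
    then show "bar_diff R (bar as) \<in> bar_free R i (sum_list ns)"
      unfolding bar_diff_bar bdl_def len
      by (intro pm_vs.subspace_sum[OF bar_free_subspace] pm_vs.subspace_scale[OF bar_free_subspace]) auto
  qed (use bar_free_subspace in \<open>auto intro!: pm_vs.subspaceI simp: bar_diff_simps pm_vs.subspace_0
      pm_vs.subspace_add pm_vs.subspace_scale\<close>)
  then show ?thesis using assms by auto
qed

lemma Em_free:
  assumes "p \<in> bar_free R (Suc i) j"
  shows "Em p \<in> bres_plus i j"
proof -
  have "bar_free R (Suc i) j \<subseteq> {p. Em p \<in> bres_plus i j}"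
    unfolding bar_free_def
  proof (rule pm_vs.span_minimal, safe)
    fix as ns assume "has_degrees R as ns" "length ns = Suc i" "j = sum_list ns"
    then show "Em (bar as) \<in> bres_plus i (sum_list ns)"
      using em_plus[of as ns] has_degrees_length[of as ns] by (cases as) (auto simp: Em_simps)
  qed (auto intro!: pm_vs.subspaceI simp: Em_simps bres_plus_def bres_hom_add lookup_add in_keys_iff
      coeff_scal_times bres_hom_lsc[OF hom_scal, where j=j, simplified])
  then show ?thesis using assms by auto
qed

theorem koszul_model:
  fixes S T0 :: "('w, 'k) malg set"
  assumes "koszul_filtration S T0 T"
  shows "koszul R"
proof -
  interpret koszul_filtration S T0 T by (rule assms)
  have "Tor R i j = {bar_boundaries R i j}" if ij: "i \<noteq> j" for i j
  proof -
    let ?B = "bar_boundaries R i j"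
    note Mul = bar_multilin_subspace[of i j] and BF = bar_free_subspace[of "Suc i" j]
    have B0: "0 \<in> ?B"
      unfolding bar_boundaries_def mem_Collect_eq using pm_vs.subspace_0[OF Mul] pm_vs.subspace_0[OF BF]
      by (intro exI[of _ 0]) (simp add: bar_diff_simps)
    have Badd: "z + w \<in> ?B" if "z \<in> ?B" "w \<in> ?B" for z w
    proof -
      from that obtain q r q' r' where "z = bar_diff R q + r" "w = bar_diff R q' + r'"
        "q \<in> bar_free R (Suc i) j" "r \<in> bar_multilin R i j"
        "q' \<in> bar_free R (Suc i) j" "r' \<in> bar_multilin R i j"
        by (auto simp: bar_boundaries_def)
      then show ?thesis
        using pm_vs.subspace_add[OF Mul, of r r'] pm_vs.subspace_add[OF BF, of q q']
        unfolding bar_boundaries_def mem_Collect_eq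
        by (intro exI[of _ "q + q'"] exI[of _ "r + r'"]) (simp add: bar_diff_simps)
    qed
    have Bneg: "- z \<in> ?B" if "z \<in> ?B" for z
    proof -
      from that obtain q r where "z = bar_diff R q + r"
        "q \<in> bar_free R (Suc i) j" "r \<in> bar_multilin R i j"
        by (auto simp: bar_boundaries_def)
      then show ?thesis
        using pm_vs.subspace_neg[OF Mul, of r] pm_vs.subspace_neg[OF BF, of q]
        unfolding bar_boundaries_def mem_Collect_eq
        by (intro exI[of _ "- q"] exI[of _ "- r"]) (simp add: bar_diff_simps)
    qed
    have coset: "(+) z ` ?B = ?B" if "z \<in> ?B" for z
    proof
      show "(+) z ` ?B \<subseteq> ?B" using Badd that by auto
      show "?B \<subseteq> (+) z ` ?B"
      proof
        fix w assume "w \<in> ?B"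
        then have "- z + w \<in> ?B" using Badd Bneg that by blast
        then show "w \<in> (+) z ` ?B" by (metis add_minus_cancel image_eqI)
      qed
    qed
    have cycles: "z \<in> ?B" if z: "z \<in> bar_cycles R i j" for z
    proof (cases i)
      case 0
      \<comment> \<open>The empty symbol has internal degree 0, so off the diagonal there are no
        chains of homological degree 0.\<close>
      then have "bar_free R i j = pm_span {}" using ij unfolding bar_free_def
        by (intro arg_cong[where f=pm_span]) auto
      then have "z = 0" using z by (auto simp: bar_cycles_def)
      then show ?thesis using B0 by simp
    next
      case (Suc i')
      have zf: "z \<in> bar_free R (Suc i') j" and "bar_diff R z \<in> bar_multilin R i' j"
        using z by (auto simp: bar_cycles_def Suc)
      then have "bres_d (Em z) = 0" using Em_bar_diff[OF zf] bar_multilin_Em by auto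
      then obtain \<eta> where \<eta>: "\<eta> \<in> bres_plus (Suc i') j" "Em z = bres_d \<eta>"
        using bres_plus_exact[OF Em_free[OF zf]] ij Suc by auto
      \<comment> \<open>The sign cancels the one in \<open>Em_bar_diff\<close>. The rest z - d q is
        then killed by \<open>Em\<close>, hence a combination of multilinearity relations, which
        boundaries are allowed to contain.\<close>
      define q where "q = - tau [] \<eta>"
      have q: "q \<in> bar_free R (Suc i) j" unfolding q_def Suc
        by (intro pm_vs.subspace_neg[OF bar_free_subspace] tau_section \<eta>)
      have "Em (bar_diff R q) = Em z"
        using Em_bar_diff[OF q] tau_section(2)[OF \<eta>(1)] \<eta>(2)
        by (simp add: q_def Em_simps d_simps)
      then have "Em (z - bar_diff R q) = 0" by (simp add: Em_simps)
      moreover have "z - bar_diff R q \<in> bar_free R (Suc i') j"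
        using bar_diff_free[OF q] zf Suc by (intro pm_vs.subspace_diff[OF bar_free_subspace]) auto
      ultimately have "z - bar_diff R q \<in> bar_multilin R i j"
        using Em_eq_0 Suc by blast
      then show ?thesis unfolding bar_boundaries_def mem_Collect_eq using q
        by (intro exI[of _ q] exI[of _ "z - bar_diff R q"]) simp
    qed
    have "0 \<in> bar_cycles R i j"
      unfolding bar_cycles_def
      using pm_vs.subspace_0[OF bar_free_subspace] pm_vs.subspace_0[OF bar_multilin_subspace]
      by (simp add: bar_diff_simps)
    then show ?thesis unfolding Tor_def using cycles coset by (auto 0 3)
  qed
  then show ?thesis by (simp add: koszul_def connected_graded_model)
qed

end

section \<open>A resolution of length four\<close>

lemma pm_eqI: "(\<And>b. Poly_Mapping.lookup p b = Poly_Mapping.lookup q b) \<Longrightarrow> p = q"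
  by (rule poly_mapping_eqI)

definition rmul :: "'r \<Rightarrow> ('b \<Rightarrow>\<^sub>0 'r) \<Rightarrow> ('b \<Rightarrow>\<^sub>0 'r::ring_1)"
  where "rmul a p = Poly_Mapping.map (\<lambda>r. r * a) p"

lemma lookup_rmul [simp]: "Poly_Mapping.lookup (rmul a p) b = Poly_Mapping.lookup p b * a"
  by (simp add: rmul_def map.rep_eq when_def)

lemma rmul_simps:
  "rmul a (p + q) = rmul a p + rmul a q" "rmul a (p - q) = rmul a p - rmul a q" "rmul a 0 = 0"
  "rmul a (- p) = - rmul a p"
  "rmul a (Poly_Mapping.single x c) = Poly_Mapping.single x (c * a)"
  "rmul a (rmul b p) = rmul (b * a) p" "rmul 0 p = 0" "rmul (a + b) p = rmul a p + rmul b p"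
  by (rule pm_eqI, simp add: lookup_add lookup_minus algebra_simps lookup_single when_def)+

lemma keys_rmul: "Poly_Mapping.keys (rmul a p) \<subseteq> Poly_Mapping.keys p"
  by (auto simp: in_keys_iff)

text \<open>\<open>tensor r q\<close> is the image of \<open>r \<otimes> q\<close> under the identification of \<open>R \<otimes> k\<^bsup>(B)\<^esup>\<close> with \<open>R\<^bsup>(B)\<^esup>\<close>.\<close>

definition tensor :: "('w::zmonoid, 'k::field) malg \<Rightarrow> ('m \<Rightarrow>\<^sub>0 'k) \<Rightarrow> ('m \<Rightarrow>\<^sub>0 ('w, 'k) malg)"
  where "tensor r q = Poly_Mapping.map (\<lambda>c. r * scal c) q"

lemma lookup_tensor [simp]: "Poly_Mapping.lookup (tensor r q) b = r * scal (Poly_Mapping.lookup q b)"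
  by (simp add: tensor_def map.rep_eq when_def)

lemma tensor_simps:
  "tensor r (p + q) = tensor r p + tensor r q" "tensor r 0 = 0"
  "tensor (r + s) p = tensor r p + tensor s p" "tensor 0 p = 0"
  "tensor r (Poly_Mapping.single x c) = Poly_Mapping.single x (r * scal c)"
  "lsc s (tensor r q) = tensor (s * r) q"
  by (rule pm_eqI, simp add: lookup_add scal_add distrib_left distrib_right mult.assoc lookup_single when_def)+

lemma rmul_tensor: "rmul s (tensor r q) = tensor (r * s) q"
  by (rule pm_eqI) (simp only: lookup_rmul lookup_tensor mult.assoc scal_central)

lemma tensor_pm_scale: "tensor r (pm_scale c q) = tensor (r * scal c) q"
  by (rule pm_eqI) (simp only: pm_scale_lsc lookup_lsc lookup_tensor mult.assoc scal_mult)

lemmas tensor_mult = rmul_tensor tensor_pm_scale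

lemma keys_tensor: "Poly_Mapping.keys (tensor r q) \<subseteq> Poly_Mapping.keys q"
  by (auto simp: in_keys_iff)

text \<open>
  A left module with \<open>k\<close>-basis \<open>B\<close>; \<open>\<beta> a b\<close> is the coordinate vector of \<open>a b\<close>.
\<close>

locale based_module =
  fixes B :: "'m set" and \<beta> :: "('w::zmonoid, 'k::field) malg \<Rightarrow> 'm \<Rightarrow> ('m \<Rightarrow>\<^sub>0 'k)"
  assumes keys_\<beta>: "Poly_Mapping.keys (\<beta> a b) \<subseteq> B"
    and \<beta>_outside: "b \<notin> B \<Longrightarrow> \<beta> a b = 0"
    and \<beta>_one: "b \<in> B \<Longrightarrow> \<beta> 1 b = Poly_Mapping.single b 1"
    and \<beta>_add: "\<beta> (a + a') b = \<beta> a b + \<beta> a' b"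
    and \<beta>_scal: "\<beta> (scal c * a) b = pm_scale c (\<beta> a b)"
    and \<beta>_mult: "\<beta> (a * a') b = lin (\<lambda>b' c. pm_scale c (\<beta> a b')) (\<beta> a' b)"
begin

definition act :: "('w, 'k) malg \<Rightarrow> ('m \<Rightarrow>\<^sub>0 'k) \<Rightarrow> ('m \<Rightarrow>\<^sub>0 'k)"
  where "act a = lin (\<lambda>b c. pm_scale c (\<beta> a b))"

lemma \<beta>_act: "\<beta> (a * a') b = act a (\<beta> a' b)"
  by (simp add: \<beta>_mult act_def)

lemma additive_scale: "additive (\<lambda>c. pm_scale c p)" "additive (pm_scale c)"
  by (simp_all add: pm_scale_lsc additive_lsc additive_lsc_left)

lemma additive_act: "additive (act a)"
  unfolding act_def by (intro additive_lin additive_scale)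

lemma act_single: "act a (Poly_Mapping.single b c) = pm_scale c (\<beta> a b)"
  unfolding act_def by (rule lin_single[OF additive_scale(1)])

lemma act_scale: "act a (pm_scale c q) = pm_scale c (act a q)"
proof -
  have "Poly_Mapping.keys q \<subseteq> UNIV" by simp
  then show ?thesis
  proof (induction rule: pm_induct_keys)
    case (single b d)
    then show ?case by (simp add: pm_scale_lsc lsc_simps act_single[unfolded pm_scale_lsc])
  qed (simp_all add: pm_scale_lsc lsc_simps additiveD[OF additive_act])
qed

lemma act_act: "act a (act a' q) = act (a * a') q"
proof -
  have "Poly_Mapping.keys q \<subseteq> UNIV" by simp
  then show ?thesis
  proof (induction rule: pm_induct_keys)
    case (single b c)
    then show ?case by (simp add: act_single act_scale \<beta>_act)
  qed (simp_all add: additiveD[OF additive_act])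
qed

lemma act_scal_times: "act (scal c * a) q = pm_scale c (act a q)"
proof -
  have "Poly_Mapping.keys q \<subseteq> UNIV" by simp
  then show ?thesis
  proof (induction rule: pm_induct_keys)
    case (single b d)
    then show ?case by (simp add: act_single \<beta>_scal pm_vs.scale_scale mult.commute)
  qed (simp_all add: additiveD[OF additive_act] pm_vs.scale_right_distrib)
qed

lemma act_one: "Poly_Mapping.keys q \<subseteq> B \<Longrightarrow> act 1 q = q"
  by (induction rule: pm_induct_keys)
    (simp_all add: additiveD[OF additive_act] act_single \<beta>_one pm_scale_lsc lsc_simps)

lemma act_add_left: "act (a + a') q = act a q + act a' q"
  unfolding act_def lin_def by (simp add: \<beta>_add pm_vs.scale_right_distrib sum.distrib)

lemma keys_act: "Poly_Mapping.keys (act a q) \<subseteq> B"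
  unfolding act_def using keys_lin[of "\<lambda>b c. pm_scale c (\<beta> a b)" q] keys_\<beta> keys_lsc
  by (fastforce simp: pm_scale_lsc)

text \<open>Under the identification with A \<otimes> M this is r \<otimes> m -> r \<otimes> a m. It
  commutes with the left A-action and with \<open>rmul\<close>, which is r \<otimes> m -> r a
  \<otimes> m; \<open>eact\<close> is the multiplication A \<otimes> M -> M.\<close>

definition sact :: "('w, 'k) malg \<Rightarrow> ('m \<Rightarrow>\<^sub>0 ('w, 'k) malg) \<Rightarrow> ('m \<Rightarrow>\<^sub>0 ('w, 'k) malg)"
  where "sact a = lin (\<lambda>b r. tensor r (\<beta> a b))"

definition eact :: "('m \<Rightarrow>\<^sub>0 ('w, 'k) malg) \<Rightarrow> ('m \<Rightarrow>\<^sub>0 'k)"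
  where "eact = lin (\<lambda>b r. \<beta> r b)"

lemma additive_tensor_left: "additive (\<lambda>r. tensor r q)"
  by (simp add: additive_def tensor_simps)

lemma additive_\<beta>: "additive (\<lambda>a. \<beta> a b)"
  by (simp add: additive_def \<beta>_add)

lemma additive_sact: "additive (sact a)"
  unfolding sact_def by (intro additive_lin additive_tensor_left)

lemma additive_eact: "additive eact"
  unfolding eact_def by (intro additive_lin additive_\<beta>)

lemma sact_single: "sact a (Poly_Mapping.single b r) = tensor r (\<beta> a b)"
  unfolding sact_def by (rule lin_single[OF additive_tensor_left])

lemma eact_single: "eact (Poly_Mapping.single b r) = \<beta> r b"
  unfolding eact_def by (rule lin_single[OF additive_\<beta>])

lemmas sact_add = additiveD[OF additive_sact] and eact_add = additiveD[OF additive_eact]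

lemma sact_tensor: "sact a (tensor r q) = tensor r (act a q)"
proof -
  have "Poly_Mapping.keys q \<subseteq> UNIV" by simp
  then show ?thesis
    by (induction rule: pm_induct_keys)
      (simp_all add: tensor_simps tensor_mult sact_add additiveD[OF additive_act] sact_single act_single)
qed

lemma \<beta>_times_scal: "\<beta> (r * scal c) b = pm_scale c (\<beta> r b)"
  using \<beta>_scal[of c r b] by (simp add: scal_central)

lemma eact_tensor: "eact (tensor r q) = act r q"
proof -
  have "Poly_Mapping.keys q \<subseteq> UNIV" by simp
  then show ?thesis
    by (induction rule: pm_induct_keys)
      (simp_all add: tensor_simps tensor_mult eact_add additiveD[OF additive_act] eact_single act_single \<beta>_times_scal)
qed

lemma pm_eq_on_singles:
  fixes f g :: "('m \<Rightarrow>\<^sub>0 ('w, 'k) malg) \<Rightarrow> 'd::ab_group_add"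
  assumes "\<And>p q. f (p + q) = f p + f q" "\<And>p q. g (p + q) = g p + g q"
    and "\<And>b c. f (Poly_Mapping.single b c) = g (Poly_Mapping.single b c)"
  shows "f p = g p"
  using pm_additive_eq[OF additiveI additiveI subset_UNIV, of f g p] assms by blast

lemma sact_sact: "sact a (sact a' p) = sact (a * a') p"
  by (rule pm_eq_on_singles[where p=p])
    (simp_all add: sact_add sact_single sact_tensor \<beta>_act)

lemma sact_add_left: "sact (a + a') p = sact a p + sact a' p"
  by (rule pm_eq_on_singles[where p=p])
    (simp_all add: sact_add sact_single \<beta>_add tensor_simps)

lemma sact_0_left: "sact 0 p = 0"
  using sact_add_left[of 0 0 p] by simp

lemma sact_lsc: "sact a (lsc r p) = lsc r (sact a p)"
  by (rule pm_eq_on_singles[where p=p])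
    (simp_all add: sact_add sact_single lsc_simps tensor_simps)

lemma sact_rmul: "sact a (rmul r p) = rmul r (sact a p)"
  by (rule pm_eq_on_singles[where p=p])
    (simp_all add: sact_add sact_single rmul_simps tensor_simps tensor_mult)

lemma rmul_lsc: "rmul a (lsc r p) = lsc r (rmul a p)"
  by (rule pm_eqI) (simp add: mult.assoc)

lemma eact_rmul: "eact (rmul g p) = eact (sact g p)"
  by (rule pm_eq_on_singles[where p=p])
    (simp_all add: eact_add sact_add sact_single rmul_simps eact_single eact_tensor \<beta>_act)

lemma eact_lsc: "eact (lsc a p) = act a (eact p)"
  by (rule pm_eq_on_singles[where p=p])
    (simp_all add: eact_add lsc_simps additiveD[OF additive_act] eact_single \<beta>_act)

lemma keys_eact: "Poly_Mapping.keys (eact p) \<subseteq> B"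
  unfolding eact_def using keys_lin[of "\<lambda>b r. \<beta> r b" p] keys_\<beta> by fastforce

end

section \<open>Filtration by the degree in the first tensor factor\<close>

definition below :: "nat \<Rightarrow> ('w::zmonoid, 'k::field) malg set"
  where "below n = {a. \<forall>w\<in>supp a. zdeg w < n}"

lemma below_iff: "a \<in> below n \<longleftrightarrow> (\<forall>m\<ge>n. pr m a = 0)"
proof
  assume *: "a \<in> below n"
  show "\<forall>m\<ge>n. pr m a = 0"
  proof (intro allI impI)
    fix m assume "n \<le> m"
    have "coeff (pr m a) w = 0" for w
    proof (cases "w \<in> supp a")
      case True
      then have "zdeg w < n" using * by (simp add: below_def)
      then show ?thesis using \<open>n \<le> m\<close> by (simp add: coeff_pr)
    qed (simp add: coeff_pr in_keys_iff)
    then show "pr m a = 0" by (simp add: malg_eq_iff pm_eqI)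
  qed
next
  assume *: "\<forall>m\<ge>n. pr m a = 0"
  show "a \<in> below n"
    unfolding below_def
  proof safe
    fix w assume "w \<in> supp a"
    then have "coeff (pr (zdeg w) a) w \<noteq> 0" by (simp add: coeff_pr in_keys_iff)
    then have "pr (zdeg w) a \<noteq> 0" by auto
    then show "zdeg w < n" using * not_less by blast
  qed
qed

lemma below_simps:
  "0 \<in> below n" "a \<in> below n \<Longrightarrow> b \<in> below n \<Longrightarrow> a + b \<in> below n"
  "a \<in> below n \<Longrightarrow> b \<in> below n \<Longrightarrow> a - b \<in> below n" "a \<in> below n \<Longrightarrow> - a \<in> below n"
  "a \<in> below n \<Longrightarrow> n \<le> m \<Longrightarrow> a \<in> below m"
  by (auto simp: below_iff additiveD[OF additive_pr])

lemma below_0: "a \<in> below 0 \<longleftrightarrow> a = 0"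
  using malg_supp_nonempty[of a] by (auto simp: below_def malg_eq_iff)

lemma below_mult_scal: "a \<in> below n \<Longrightarrow> a * scal c \<in> below n"
  by (auto simp: below_def in_keys_iff scal_central[symmetric] coeff_scal_times)

lemma hom_below: "a \<in> hom m \<Longrightarrow> m < n \<Longrightarrow> a \<in> below n"
  by (auto simp: hom_def below_def)

lemma ex_below: "\<exists>n. a \<in> below n"
proof -
  have "\<forall>w\<in>supp a. zdeg w < Suc (Max (zdeg ` supp a))"
    by (auto intro!: Max_ge simp: less_Suc_eq_le)
  then show ?thesis unfolding below_def by blast
qed

lemma below_lower:
  assumes "a \<in> below (Suc n)"
  shows "a - pr n a \<in> below n"
  using assms unfolding below_iff
  by (auto simp: additiveD[OF additive_pr] pr_of_hom[OF pr_hom] Suc_le_eq)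

lemma pr_pr: "pr n (pr n a) = pr n a"
  by (simp add: pr_of_hom[OF pr_hom])

text \<open>If \<open>a * g\<close> does not reach degree n + 1, then the degree n component of a is
  killed by g, hence of the form b h, and b can be cut down to degree n - 1. For n = 0 that
  component is zero because h has degree 1.\<close>

lemma annihilator_top:
  assumes "g \<in> hom 1" "h \<in> hom 1" "\<And>a. a * g = 0 \<Longrightarrow> \<exists>b. a = b * h"
    and "a \<in> below (Suc n)" "a * g \<in> below (Suc n)"
  shows "\<exists>b\<in>below n. a - b * h \<in> below n"
proof -
  have "pr n a * g = 0"
    using assms(5) pr_times_right(1)[OF assms(1), of n a] by (auto simp: below_iff)
  then obtain b where b: "pr n a = b * h" using assms(3) by blast
  show ?thesis
  proof (cases n)
    case 0
    have "pr 0 a = pr 0 (b * h)" using b pr_pr[of n a] 0 by simp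
    then have "a - 0 * h \<in> below n"
      using below_lower[OF assms(4)] pr_times_right(2)[OF assms(2), of b] 0 by simp
    then show ?thesis using below_simps(1) by blast
  next
    case (Suc m)
    have "pr n a = pr n (b * h)" using b pr_pr[of n a] by simp
    then have "pr n a = pr m b * h" using pr_times_right(1)[OF assms(2)] Suc by simp
    then show ?thesis
      using below_lower[OF assms(4)] hom_below[OF pr_hom[of m b], of n] Suc by (intro bexI[of _ "pr m b"]) auto
  qed
qed

text \<open>
  The relations are \<open>u x = 0\<close>, \<open>x z = 0\<close>, \<open>z y = 0\<close> with \<open>u = x + y\<close>.  Every left annihilator in the
  chain \<open>u, x, z, y\<close> is generated by the previous element, and \<open>u\<close> is not a right zero divisor; on
  the other side the chain runs in the opposite direction.
\<close>

locale xyz_algebra =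
  fixes x y z :: "('w::zmonoid, 'k::field) malg"
  assumes xyz_hom: "x \<in> hom 1" "y \<in> hom 1" "z \<in> hom 1"
    and rels: "(x + y) * x = 0" "x * z = 0" "z * y = 0"
    and lann_u: "\<And>a. a * (x + y) = 0 \<Longrightarrow> a = 0"
    and lann_x: "\<And>a. a * x = 0 \<Longrightarrow> \<exists>b. a = b * (x + y)"
    and lann_z: "\<And>a. a * z = 0 \<Longrightarrow> \<exists>b. a = b * x"
    and lann_y: "\<And>a. a * y = 0 \<Longrightarrow> \<exists>b. a = b * z"
    and left_direct: "\<And>a b c. a * x + b * y + c * z = 0 \<Longrightarrow> a * x = 0 \<and> b * y = 0 \<and> c * z = 0"
    and left_gen: "\<And>a n. a \<in> hom (Suc n) \<Longrightarrow> \<exists>b c d. a = b * x + c * y + d * z"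
    and rann_u: "\<And>a. (x + y) * a = 0 \<Longrightarrow> \<exists>b. a = x * b"
    and rann_x: "\<And>a. x * a = 0 \<Longrightarrow> \<exists>b. a = z * b"
    and rann_z: "\<And>a. z * a = 0 \<Longrightarrow> \<exists>b. a = y * b"
    and rann_y: "\<And>a. y * a = 0 \<Longrightarrow> a = 0"
begin

abbreviation "u \<equiv> x + y"

lemma u_hom: "u \<in> hom 1" using xyz_hom hom_add by blast

end

locale xyz_module = xyz_algebra x y z + based_module B \<beta>
  for x y z :: "('w::zmonoid, 'k::field) malg" and B :: "'m set" and \<beta> :: "('w, 'k) malg \<Rightarrow> 'm \<Rightarrow> ('m \<Rightarrow>\<^sub>0 'k)"
begin

text \<open>In the differentials below \<open>rmul\<close> by a generator raises this level by at
  most one and \<open>sact\<close> preserves it, so leading terms involve right multiplication only.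
  This reduces exactness to left annihilators.\<close>

definition level :: "nat \<Rightarrow> ('m \<Rightarrow>\<^sub>0 ('w, 'k) malg) set"
  where "level n = {p. Poly_Mapping.keys p \<subseteq> B \<and> (\<forall>b. Poly_Mapping.lookup p b \<in> below n)}"

definition FB :: "('m \<Rightarrow>\<^sub>0 ('w, 'k) malg) set"
  where "FB = {p. Poly_Mapping.keys p \<subseteq> B}"

lemma level_FB: "p \<in> level n \<Longrightarrow> p \<in> FB"
  by (simp add: level_def FB_def)

lemma FB_simps:
  "0 \<in> FB" "p \<in> FB \<Longrightarrow> q \<in> FB \<Longrightarrow> p + q \<in> FB" "p \<in> FB \<Longrightarrow> q \<in> FB \<Longrightarrow> p - q \<in> FB"
  "p \<in> FB \<Longrightarrow> - p \<in> FB" "p \<in> FB \<Longrightarrow> rmul a p \<in> FB" "p \<in> FB \<Longrightarrow> lsc a p \<in> FB"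
  using keys_add[of p q] keys_diff_subset[of p q] keys_rmul[of a p] keys_lsc[of a p]
  by (auto simp: FB_def keys_uminus_eq)

lemma keys_sact: "Poly_Mapping.keys (sact a p) \<subseteq> B"
  unfolding sact_def using keys_lin[of "\<lambda>b r. tensor r (\<beta> a b)" p] keys_\<beta> keys_tensor by fastforce

lemma FB_sact: "sact a p \<in> FB" using keys_sact by (simp add: FB_def)

lemma ex_level: "p \<in> FB \<Longrightarrow> \<exists>n. p \<in> level n"
proof -
  assume p: "p \<in> FB"
  have "\<forall>b. \<exists>n. Poly_Mapping.lookup p b \<in> below n" using ex_below by blast
  then obtain N where N: "\<And>b. Poly_Mapping.lookup p b \<in> below (N b)" by metis
  have "Poly_Mapping.lookup p b \<in> below (\<Sum>b\<in>Poly_Mapping.keys p. N b)" for b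
  proof (cases "b \<in> Poly_Mapping.keys p")
    case True
    then have "N b \<le> (\<Sum>b\<in>Poly_Mapping.keys p. N b)" by (intro member_le_sum) auto
    then show ?thesis using N below_simps(5) by blast
  qed (simp add: in_keys_iff below_simps)
  then show ?thesis using p by (auto simp: level_def FB_def)
qed

lemma level_simps:
  "0 \<in> level n" "p \<in> level n \<Longrightarrow> q \<in> level n \<Longrightarrow> p + q \<in> level n"
  "p \<in> level n \<Longrightarrow> q \<in> level n \<Longrightarrow> p - q \<in> level n" "p \<in> level n \<Longrightarrow> - p \<in> level n"
  "p \<in> level n \<Longrightarrow> p \<in> level (Suc n)"
  using FB_simps(1) FB_simps(2,3)[of p q] FB_simps(4)[of p]
  by (auto simp: level_def FB_def lookup_add lookup_minus below_simps intro: below_simps(5))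

lemma level_0: "p \<in> level 0 \<longleftrightarrow> p = 0"
  by (auto simp: level_def below_0 intro!: pm_eqI)

lemma level_sact: "p \<in> level n \<Longrightarrow> sact a p \<in> level n"
proof -
  assume p: "p \<in> level n"
  have "Poly_Mapping.lookup (sact a p) c \<in> below n" for c
  proof -
    have *: "sum f S \<in> below n" if "\<And>b. f b \<in> below n" for f :: "'m \<Rightarrow> ('w, 'k) malg" and S
      by (induction S rule: infinite_finite_induct) (auto simp: below_simps that)
    have "Poly_Mapping.lookup (tensor (Poly_Mapping.lookup p b) (\<beta> a b)) c \<in> below n" for b
      using p by (simp add: below_mult_scal level_def)
    then show ?thesis unfolding sact_def lin_def lookup_sum by (intro *)
  qed
  then show ?thesis using keys_sact by (simp add: level_def)
qed

lemma annihilator_level: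
  assumes "g \<in> hom 1" "h \<in> hom 1" "\<And>a. a * g = 0 \<Longrightarrow> \<exists>b. a = b * h"
    and "p \<in> level (Suc n)" "rmul g p \<in> level (Suc n)"
  shows "\<exists>q\<in>level n. p - rmul h q \<in> level n"
proof -
  have "\<exists>c\<in>below n. Poly_Mapping.lookup p b - c * h \<in> below n" for b
    using assms(4,5) by (intro annihilator_top[OF assms(1-3)]) (auto simp: level_def)
  then obtain c where c: "\<And>b. c b \<in> below n" "\<And>b. Poly_Mapping.lookup p b - c b * h \<in> below n"
    by metis
  define q where "q = (\<Sum>b\<in>Poly_Mapping.keys p. Poly_Mapping.single b (c b))"
  have q: "Poly_Mapping.lookup q b = (if b \<in> Poly_Mapping.keys p then c b else 0)" for b
    by (simp add: q_def lookup_sum lookup_single when_def)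
  then have "Poly_Mapping.keys q \<subseteq> Poly_Mapping.keys p" by (auto simp: in_keys_iff)
  then have qB: "q \<in> FB" "p \<in> FB" using assms(4) by (auto simp: level_def FB_def)
  have "q \<in> level n" using qB c by (auto simp: level_def FB_def q below_simps)
  moreover have "Poly_Mapping.lookup (p - rmul h q) b \<in> below n" for b
    using c(2)[of b] by (auto simp: lookup_minus q in_keys_iff below_simps)
  ultimately show ?thesis
    using FB_simps(3)[OF qB(2) FB_simps(5)[OF qB(1)], of h] by (auto simp: level_def FB_def)
qed

lemma annihilator_level_u:
  assumes "p \<in> level (Suc n)" "rmul u p \<in> level (Suc n)"
  shows "p \<in> level n"
proof -
  have "\<exists>q\<in>level n. p - rmul x q \<in> level n \<and> q = 0 \<or> p \<in> level n"
  proof -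
    have "Poly_Mapping.lookup p b \<in> below n" for b
    proof -
      let ?a = "Poly_Mapping.lookup p b"
      have "pr n ?a * u = 0"
        using assms(2) pr_times_right(1)[OF u_hom, of n ?a] by (auto simp: level_def below_iff)
      then have "pr n ?a = 0" by (rule lann_u)
      then show ?thesis using below_lower[of ?a n] assms(1) by (simp add: level_def)
    qed
    then show ?thesis using assms(1) by (auto simp: level_def)
  qed
  then show ?thesis by (auto simp: rmul_simps)
qed

text \<open>The degree n + 1 component of the sum involves only the degree n components of p, q and
  r; since A x, A y, A z form a direct sum, its three summands vanish separately.\<close>

lemma direct_level:
  assumes "p \<in> level (Suc n)" "q \<in> level (Suc n)" "r \<in> level (Suc n)"
    and "rmul x p + rmul y q + rmul z r \<in> level (Suc n)"
  shows "rmul x p \<in> level (Suc n)" "rmul y q \<in> level (Suc n)" "rmul z r \<in> level (Suc n)"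
proof -
  have FB: "p \<in> FB" "q \<in> FB" "r \<in> FB" using assms level_FB by blast+
  have "Poly_Mapping.lookup p b * x \<in> below (Suc n) \<and> Poly_Mapping.lookup q b * y \<in> below (Suc n) \<and>
    Poly_Mapping.lookup r b * z \<in> below (Suc n)" for b
  proof -
    let ?p = "Poly_Mapping.lookup p b" and ?q = "Poly_Mapping.lookup q b" and ?r = "Poly_Mapping.lookup r b"
    have b: "?p \<in> below (Suc n)" "?q \<in> below (Suc n)" "?r \<in> below (Suc n)"
      using assms(1-3) by (auto simp: level_def)
    have "?p * x + ?q * y + ?r * z \<in> below (Suc n)"
      using assms(4) by (auto simp: level_def lookup_add)
    then have "pr (Suc n) (?p * x + ?q * y + ?r * z) = 0" by (auto simp: below_iff)
    then have "pr n ?p * x + pr n ?q * y + pr n ?r * z = 0"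
      by (simp add: additiveD[OF additive_pr] pr_times_right xyz_hom[simplified])
    then have *: "pr n ?p * x = 0 \<and> pr n ?q * y = 0 \<and> pr n ?r * z = 0" by (rule left_direct)
    have "a * g \<in> below (Suc n)" if "a \<in> below (Suc n)" "g \<in> hom 1" "pr n a * g = 0" for a g
      unfolding below_iff
    proof (intro allI impI)
      fix m assume "Suc n \<le> m"
      then obtain m' where m': "m = Suc m'" "n \<le> m'" by (cases m) auto
      show "pr m (a * g) = 0"
      proof (cases "m' = n")
        case False
        then have "pr m' a = 0" using m' that(1) by (auto simp: below_iff)
        then show ?thesis using m' pr_times_right(1)[OF that(2)] by simp
      qed (use m' pr_times_right(1)[OF that(2)] that(3) in simp)
    qed
    then show ?thesis using * b xyz_hom by blast
  qed
  then show "rmul x p \<in> level (Suc n)" "rmul y q \<in> level (Suc n)" "rmul z r \<in> level (Suc n)"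
    using FB FB_simps(5) by (auto simp: level_def FB_def)
qed

lemma sact_rels: "sact x (sact x p) + sact y (sact x p) = 0" "sact x (sact z p) = 0" "sact z (sact y p) = 0"
  using rels by (simp_all add: sact_sact sact_add_left[symmetric] distrib_right[symmetric] sact_0_left)

lemma rmul_rels: "rmul x (rmul x p) + rmul x (rmul y p) = 0" "rmul z (rmul x p) = 0" "rmul y (rmul z p) = 0"
  using rels by (simp_all add: rmul_simps(6) rmul_simps(8)[symmetric] distrib_right[symmetric] rmul_simps(7))

lemmas rs_simps = rmul_simps(1-4) sact_add(1-4) sact_rmul rmul_simps(8)

text \<open>The symbols \<open>ux, xz, zy\<close> index the relations, \<open>uxz, xzy\<close> and \<open>uxzy\<close> the higher syzygies.\<close>

definition d1 where "d1 = (\<lambda>(px, py, pz). (rmul x px - sact x px) + (rmul y py - sact y py) + (rmul z pz - sact z pz))"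
text \<open>A relation with terms v w sends a \<otimes> v w \<otimes> m to a v \<otimes> w \<otimes>
  m + a \<otimes> v \<otimes> w m, summed over the terms. In u x = x x + y x the left letter is x or
  y, hence \<open>sact x q1\<close> in both the x and the y component. The next two maps split off
  the first letter to the left and the last to the right; the sign of the second part alternates, as
  in the Koszul bimodule complex.\<close>

definition d2 where "d2 = (\<lambda>(q1, q2, q3). (rmul u q1 + sact x q1 + sact z q2, sact x q1 + rmul z q3, rmul x q2 + sact y q3))"
definition d3 where "d3 = (\<lambda>(s1, s2). (- sact z s1, rmul u s1 - sact y s2, rmul x s2))"
definition d4 where "d4 t = (sact y t, rmul u t)"

lemma d1_d2: "d1 (d2 q) = 0"
proof -
  obtain q1 q2 q3 where q: "q = (q1, q2, q3)" by (cases q)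
  have "d1 (d2 q) = (rmul x (rmul x q1) + rmul x (rmul y q1)) - (sact x (sact x q1) + sact y (sact x q1))
    - sact x (sact z q2) + rmul z (rmul x q2) + rmul y (rmul z q3) - sact z (sact y q3)"
    by (simp add: q d1_def d2_def rs_simps algebra_simps)
  then show ?thesis by (simp add: sact_rels rmul_rels)
qed

lemma d2_d3: "d2 (d3 s) = (0, 0, 0)"
proof -
  obtain s1 s2 where s: "s = (s1, s2)" by (cases s)
  have "d2 (d3 s) = (- sact x (sact z s1) - sact z (sact y s2), - sact x (sact z s1) + rmul z (rmul x s2),
     rmul x (rmul x s1) + rmul x (rmul y s1))"
    by (simp add: s d2_def d3_def rs_simps algebra_simps)
  then show ?thesis by (simp add: sact_rels rmul_rels)
qed

lemma d3_d4: "d3 (d4 t) = (0, 0, 0)"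
proof -
  have "d3 (d4 t) = (- sact z (sact y t), 0, rmul x (rmul x t) + rmul x (rmul y t))"
    by (simp add: d3_def d4_def rs_simps algebra_simps)
  then show ?thesis by (simp add: sact_rels rmul_rels)
qed

lemma d_add:
  "d1 (p + p') = d1 p + d1 p'" "d2 (q + q') = d2 q + d2 q'" "d3 (s + s') = d3 s + d3 s'" "d4 (t + t') = d4 t + d4 t'"
proof -
  show "d1 (p + p') = d1 p + d1 p'" by (cases p, cases p') (simp add: d1_def rs_simps)
  show "d2 (q + q') = d2 q + d2 q'" by (cases q, cases q') (simp add: d2_def rs_simps)
  show "d3 (s + s') = d3 s + d3 s'" by (cases s, cases s') (simp add: d3_def rs_simps)
  show "d4 (t + t') = d4 t + d4 t'" by (simp add: d4_def rs_simps)
qed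

lemmas d_additive = additiveI[of d1, OF d_add(1)] additiveI[of d2, OF d_add(2)]
  additiveI[of d3, OF d_add(3)] additiveI[of d4, OF d_add(4)]

lemma d4_inj: "rmul u t = 0 \<Longrightarrow> t = 0"
proof (rule pm_eqI)
  fix b assume "rmul u t = 0"
  then have "Poly_Mapping.lookup t b * u = 0" using lookup_rmul[of u t b] by simp
  then show "Poly_Mapping.lookup t b = Poly_Mapping.lookup 0 b" using lann_u by simp
qed

lemma FB3_add: "p \<in> FB \<times> FB \<times> FB \<Longrightarrow> q \<in> FB \<times> FB \<times> FB \<Longrightarrow> p + q \<in> FB \<times> FB \<times> FB"
  and FB2_add: "s \<in> FB \<times> FB \<Longrightarrow> t \<in> FB \<times> FB \<Longrightarrow> s + t \<in> FB \<times> FB"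
  by (auto simp: FB_simps)

text \<open>Descent on the level. The \<open>sact\<close> terms of \<open>d3 s = 0\<close> do not
  raise it, so the top parts of s1 and s2 are killed on the right by u and x: the first is 0, the
  second a multiple of u. Subtracting a suitable \<open>d4 t\<close> lowers the level.\<close>

lemma exact_3:
  "s \<in> level n \<times> level n \<Longrightarrow> d3 s = 0 \<Longrightarrow> \<exists>t\<in>FB. s = d4 t"
proof (induction n arbitrary: s)
  case 0
  then have "s = 0" by (auto simp: level_0 zero_prod_def)
  then show ?case using FB_simps(1) additiveD(2)[OF d_additive(4)] by (intro bexI[of _ 0]) simp_all
next
  case (Suc n)
  obtain s1 s2 where s: "s = (s1, s2)" "s1 \<in> level (Suc n)" "s2 \<in> level (Suc n)" using Suc.prems(1) by auto
  have "rmul u s1 - sact y s2 = 0" "rmul x s2 = 0"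
    using Suc.prems(2) by (simp_all add: d3_def s(1) zero_prod_def)
  then have eq: "rmul u s1 \<in> level (Suc n)" "rmul x s2 \<in> level (Suc n)"
    using s level_sact[of s2 "Suc n" y] level_simps(1) by simp_all
  have s1: "s1 \<in> level n" by (rule annihilator_level_u[OF s(2) eq(1)])
  obtain t where t: "t \<in> level n" "s2 - rmul u t \<in> level n"
    using annihilator_level[OF xyz_hom(1) u_hom lann_x s(3) eq(2)] by blast
  have "s - d4 t \<in> level n \<times> level n"
    using s1 t level_simps(3)[OF s1 level_sact[OF t(1)]] by (simp add: s(1) d4_def)
  moreover have "d3 (s - d4 t) = 0"
    using Suc.prems(2) d3_d4[of t] by (simp add: additiveD[OF d_additive(3)] zero_prod_def)
  ultimately have "\<exists>t'\<in>FB. s - d4 t = d4 t'" by (rule Suc.IH)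
  then obtain t' where t': "t' \<in> FB" "s - d4 t = d4 t'" ..
  then have "s = d4 (t' + t)" by (simp only: d_add(4) diff_eq_eq)
  then show ?case using FB_simps(2)[OF t'(1) level_FB[OF t(1)]] by blast
qed

lemma exact_2:
  "q \<in> level n \<times> level n \<times> level n \<Longrightarrow> d2 q = 0 \<Longrightarrow> \<exists>s\<in>FB \<times> FB. q = d3 s"
proof (induction n arbitrary: q)
  case 0
  from 0(1) have "q = 0" by (cases q) (simp add: level_0 zero_prod_def)
  then have "q = d3 0" by (simp only: additiveD(2)[OF d_additive(3)])
  moreover have "0 \<in> FB \<times> FB" by (simp add: zero_prod_def FB_simps(1))
  ultimately show ?case by (rule bexI)
next
  case (Suc n)
  obtain q1 q2 q3 where q: "q = (q1, q2, q3)"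
    "q1 \<in> level (Suc n)" "q2 \<in> level (Suc n)" "q3 \<in> level (Suc n)"
    using Suc.prems(1) by auto
  have 0: "rmul u q1 + sact x q1 + sact z q2 = 0" "sact x q1 + rmul z q3 = 0" "rmul x q2 + sact y q3 = 0"
    using Suc.prems(2) by (simp_all only: d2_def q(1) zero_prod_def prod.case prod.inject)
  have "rmul u q1 = (rmul u q1 + sact x q1 + sact z q2) - sact z q2 - sact x q1"
    "rmul z q3 = (sact x q1 + rmul z q3) - sact x q1" "rmul x q2 = (rmul x q2 + sact y q3) - sact y q3"
    by simp_all
  note eqs = this[unfolded 0]
  have eq: "rmul u q1 \<in> level (Suc n)" "rmul z q3 \<in> level (Suc n)" "rmul x q2 \<in> level (Suc n)"
    by (subst eqs; intro level_simps(1,3) level_sact q)+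
  have q1: "q1 \<in> level n" by (rule annihilator_level_u[OF q(2) eq(1)])
  obtain s1 where s1: "s1 \<in> level n" "q2 - rmul u s1 \<in> level n"
    using annihilator_level[OF xyz_hom(1) u_hom lann_x q(3) eq(3)] by blast
  obtain s2 where s2: "s2 \<in> level n" "q3 - rmul x s2 \<in> level n"
    using annihilator_level[OF xyz_hom(3,1) lann_z q(4) eq(2)] by blast
  have "q2 - (rmul u s1 - sact y s2) = (q2 - rmul u s1) + sact y s2" by simp
  also have "\<dots> \<in> level n" by (intro level_simps(2) level_sact s1 s2)
  finally have "q - d3 (s1, s2) \<in> level n \<times> level n \<times> level n"
    using s2 level_simps(2)[OF q1 level_sact[OF s1(1)]] by (simp add: q(1) d3_def)
  moreover have "d2 (q - d3 (s1, s2)) = 0"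
    using Suc.prems(2) d2_d3[of "(s1, s2)"] by (simp add: additiveD[OF d_additive(2)] zero_prod_def)
  ultimately have "\<exists>s'\<in>FB \<times> FB. q - d3 (s1, s2) = d3 s'" by (rule Suc.IH)
  then obtain s' where s': "s' \<in> FB \<times> FB" "q - d3 (s1, s2) = d3 s'" ..
  then have "q = d3 (s' + (s1, s2))" by (simp only: d_add(3) diff_eq_eq)
  moreover have "s' + (s1, s2) \<in> FB \<times> FB"
    using level_FB[OF s1(1)] level_FB[OF s2(1)] by (intro FB2_add s'(1)) simp
  ultimately show ?case by (rule bexI)
qed

text \<open>The same descent as in \<open>exact_3\<close>, but here the three leading terms fall
  into one component and are first separated by \<open>direct_level\<close>.\<close>

lemma exact_1:
  "p \<in> level n \<times> level n \<times> level n \<Longrightarrow> d1 p = 0 \<Longrightarrow> \<exists>q\<in>FB \<times> FB \<times> FB. p = d2 q"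
proof (induction n arbitrary: p)
  case 0
  from 0(1) have "p = 0" by (cases p) (simp add: level_0 zero_prod_def)
  then have "p = d2 0" by (simp only: additiveD(2)[OF d_additive(2)])
  moreover have "0 \<in> FB \<times> FB \<times> FB" by (simp add: zero_prod_def FB_simps(1))
  ultimately show ?case by (rule bexI)
next
  case (Suc n)
  obtain px py pz where p: "p = (px, py, pz)"
    "px \<in> level (Suc n)" "py \<in> level (Suc n)" "pz \<in> level (Suc n)"
    using Suc.prems(1) by auto
  have "rmul x px + rmul y py + rmul z pz = sact x px + sact y py + sact z pz"
    using Suc.prems(2) by (simp add: d1_def p(1) algebra_simps)
  moreover have "sact x px + sact y py + sact z pz \<in> level (Suc n)"
    using p by (intro level_simps(2) level_sact)
  ultimately have "rmul x px + rmul y py + rmul z pz \<in> level (Suc n)" by simp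
  note eq = direct_level[OF p(2-4) this]
  obtain q1 where q1: "q1 \<in> level n" "px - rmul u q1 \<in> level n"
    using annihilator_level[OF xyz_hom(1) u_hom lann_x p(2) eq(1)] by blast
  obtain q3 where q3: "q3 \<in> level n" "py - rmul z q3 \<in> level n"
    using annihilator_level[OF xyz_hom(2,3) lann_y p(3) eq(2)] by blast
  obtain q2 where q2: "q2 \<in> level n" "pz - rmul x q2 \<in> level n"
    using annihilator_level[OF xyz_hom(3,1) lann_z p(4) eq(3)] by blast
  have "px - (rmul u q1 + sact x q1 + sact z q2) = px - rmul u q1 - sact x q1 - sact z q2" by simp
  also have "\<dots> \<in> level n" by (intro level_simps(3) level_sact q1 q2)
  finally have 1: "px - (rmul u q1 + sact x q1 + sact z q2) \<in> level n" .
  have "py - (sact x q1 + rmul z q3) = py - rmul z q3 - sact x q1" by simp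
  also have "\<dots> \<in> level n" by (intro level_simps(3) level_sact q1 q3)
  finally have 2: "py - (sact x q1 + rmul z q3) \<in> level n" .
  have "pz - (rmul x q2 + sact y q3) = pz - rmul x q2 - sact y q3" by simp
  also have "\<dots> \<in> level n" by (intro level_simps(3) level_sact q2 q3)
  finally have "p - d2 (q1, q2, q3) \<in> level n \<times> level n \<times> level n"
    using 1 2 by (simp add: p(1) d2_def)
  moreover have "d1 (p - d2 (q1, q2, q3)) = 0"
    using Suc.prems(2) d1_d2[of "(q1, q2, q3)"] by (simp add: additiveD[OF d_additive(1)])
  ultimately have "\<exists>q'\<in>FB \<times> FB \<times> FB. p - d2 (q1, q2, q3) = d2 q'" by (rule Suc.IH)
  then obtain q' where q': "q' \<in> FB \<times> FB \<times> FB" "p - d2 (q1, q2, q3) = d2 q'" ..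
  then have "p = d2 (q' + (q1, q2, q3))" by (simp only: d_add(2) diff_eq_eq)
  moreover have "q' + (q1, q2, q3) \<in> FB \<times> FB \<times> FB"
    using level_FB[OF q1(1)] level_FB[OF q2(1)] level_FB[OF q3(1)] by (intro FB3_add q'(1)) simp
  ultimately show ?case by (rule bexI)
qed

lemma ex_level2: "s \<in> FB \<times> FB \<Longrightarrow> \<exists>n. s \<in> level n \<times> level n"
  and ex_level3: "p \<in> FB \<times> FB \<times> FB \<Longrightarrow> \<exists>n. p \<in> level n \<times> level n \<times> level n"
proof -
  have mono: "p \<in> level n \<Longrightarrow> p \<in> level (n + m)" for p n m
    by (induction m) (auto simp: level_simps(5))
  show "\<exists>n. s \<in> level n \<times> level n" if s: "s \<in> FB \<times> FB"
  proof -
    have "fst s \<in> FB" "snd s \<in> FB" using s by auto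
    then obtain n m where "fst s \<in> level n" "snd s \<in> level m"
      using ex_level by blast
    then have "s \<in> level (n + m) \<times> level (n + m)"
      using mono[of "fst s" n m] mono[of "snd s" m n] by (simp add: mem_Times_iff add.commute)
    then show ?thesis by blast
  qed
  show "\<exists>n. p \<in> level n \<times> level n \<times> level n" if p': "p \<in> FB \<times> FB \<times> FB"
  proof -
    obtain px py pz where p: "p = (px, py, pz)" "px \<in> FB" "py \<in> FB" "pz \<in> FB" using p' by auto
    then obtain l m n where "px \<in> level l" "py \<in> level m" "pz \<in> level n" using ex_level by metis
    then have "p \<in> level (l + m + n) \<times> level (l + m + n) \<times> level (l + m + n)"
      using mono[of px l "m + n"] mono[of py m "l + n"] mono[of pz n "l + m"] p(1)
      by (simp add: ac_simps)
    then show ?thesis by blast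
  qed
qed

definition im1 where "im1 = d1 ` (FB \<times> FB \<times> FB)"

lemma im1_add: "p \<in> im1 \<Longrightarrow> q \<in> im1 \<Longrightarrow> p + q \<in> im1"
proof -
  assume "p \<in> im1" "q \<in> im1"
  then obtain p' q' where "p = d1 p'" "q = d1 q'" "p' \<in> FB \<times> FB \<times> FB" "q' \<in> FB \<times> FB \<times> FB"
    by (auto simp: im1_def)
  then show ?thesis using FB3_add[of p' q'] d_add(1)[of p' q'] unfolding im1_def by (metis image_eqI)
qed

lemma im1_0: "0 \<in> im1"
proof -
  have "0 \<in> FB \<times> FB \<times> FB" using FB_simps(1) by (simp add: zero_prod_def)
  then show ?thesis using additiveD(2)[OF d_additive(1)] unfolding im1_def by (metis image_eqI)
qed

lemma im1_gen: "p \<in> FB \<Longrightarrow> g \<in> {x, y, z} \<Longrightarrow> rmul g p - sact g p \<in> im1"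
proof -
  assume p: "p \<in> FB" and g: "g \<in> {x, y, z}"
  from g consider "g = x" | "g = y" | "g = z" by auto
  then have "rmul g p - sact g p = d1 (p, 0, 0) \<or> rmul g p - sact g p = d1 (0, p, 0) \<or>
      rmul g p - sact g p = d1 (0, 0, p)"
    by cases (simp_all add: d1_def rs_simps sact_add)
  then show ?thesis unfolding im1_def using p FB_simps(1) by auto
qed

text \<open>Modulo the image of \<open>d1\<close>, e g \<otimes> m equals e \<otimes> g m for each
  generator g, so the letters of a move across the tensor sign one after the other.\<close>

lemma tensor_im1:
  "a \<in> hom n \<Longrightarrow> Poly_Mapping.keys q \<subseteq> B \<Longrightarrow> tensor a q - tensor 1 (act a q) \<in> im1"
proof (induction n arbitrary: a q)
  case 0
  then obtain c where a: "a = scal c" by (auto simp: hom_zero_iff)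
  have "act a q = pm_scale c q"
    using act_scal_times[of c 1 q] act_one[OF 0(2)] by (simp add: a)
  then show ?case by (simp add: tensor_pm_scale a im1_0)
next
  case (Suc n)
  obtain b c d where "a = b * x + c * y + d * z" using left_gen[OF Suc.prems(1)] by blast
  then have "pr (Suc n) a = pr n b * x + pr n c * y + pr n d * z"
    by (simp add: additiveD[OF additive_pr] pr_times_right xyz_hom[simplified])
  then have a: "a = pr n b * x + pr n c * y + pr n d * z" using pr_of_hom[OF Suc.prems(1)] by simp
  have step: "tensor (e * g) q - tensor 1 (act (e * g) q) \<in> im1" if "e \<in> hom n" "g \<in> {x, y, z}" for e g
  proof -
    have "tensor e q \<in> FB" using keys_tensor[of e q] Suc.prems(2) by (auto simp: FB_def)
    from im1_add[OF im1_gen[OF this that(2)] Suc.IH[OF that(1) keys_act[of g q]]]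
    show ?thesis by (simp add: rmul_tensor sact_tensor act_act)
  qed
  have "tensor a q - tensor 1 (act a q) = (tensor (pr n b * x) q - tensor 1 (act (pr n b * x) q)) +
     (tensor (pr n c * y) q - tensor 1 (act (pr n c * y) q)) + (tensor (pr n d * z) q - tensor 1 (act (pr n d * z) q))"
    by (subst (1 2) a) (simp add: tensor_simps act_add_left)
  also have "\<dots> \<in> im1" by (intro im1_add step pr_hom) auto
  finally show ?case .
qed

lemma exact_0:
  assumes "p \<in> FB" "eact p = 0"
  shows "p \<in> im1"
proof -
  have single: "Poly_Mapping.single b a - tensor 1 (\<beta> a b) \<in> im1" if b: "b \<in> B" for b a
  proof -
    have "supp a \<subseteq> UNIV" by simp
    then show ?thesis
    proof (induction rule: malg_induct)
      case zero
      have "\<beta> 0 b = 0" using additiveD(2)[OF additive_\<beta>] .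
      then show ?case by (simp add: tensor_simps im1_0)
    next
      case (add a a')
      from im1_add[OF add.IH] show ?case by (simp add: \<beta>_add tensor_simps single_add algebra_simps)
    next
      case (mon w c)
      have "tensor (mon w c) (Poly_Mapping.single b 1) - tensor 1 (act (mon w c) (Poly_Mapping.single b 1)) \<in> im1"
        using b by (intro tensor_im1[OF hom_mon[OF refl]]) auto
      then show ?case by (simp add: tensor_simps act_single mon_zone_one)
    qed
  qed
  have "Poly_Mapping.keys p \<subseteq> B" using assms(1) by (simp add: FB_def)
  then have "p - tensor 1 (eact p) \<in> im1"
  proof (induction rule: pm_induct_keys)
    case (add p q)
    from im1_add[OF add.IH] show ?case by (simp add: eact_add tensor_simps algebra_simps)
  qed (auto simp: im1_0 eact_add tensor_simps eact_single single)
  then show ?thesis using assms(2) by (simp add: tensor_simps)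
qed

lemma eact_d1: "eact (d1 p) = 0"
  by (cases p) (simp add: d1_def eact_add eact_rmul)

end

subsection \<open>Cardinalities\<close>

text \<open>All terms of a resolution have to live in the single type \<open>'m\<close>; this and
  the following embeddings show that there is room.\<close>

lemma inj_prod_infinite:
  assumes "infinite (UNIV :: 'm set)"
  shows "\<exists>f :: 'm \<times> 'm \<Rightarrow> 'm. inj f"
proof -
  have "\<exists>f. bij_betw f (UNIV \<times> UNIV :: ('m \<times> 'm) set) (UNIV :: 'm set)"
    using card_of_Times_same_infinite[OF assms] card_of_ordIso by blast
  then show ?thesis by (auto simp: bij_betw_def)
qed

lemma inj_prod_into:
  assumes "infinite (UNIV :: 'm set)" "\<exists>f :: 'a \<Rightarrow> 'm. inj f" "\<exists>g :: 'b \<Rightarrow> 'm. inj g"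
  shows "\<exists>h :: 'a \<times> 'b \<Rightarrow> 'm. inj h"
proof -
  obtain p :: "'m \<times> 'm \<Rightarrow> 'm" where p: "inj p" using inj_prod_infinite[OF assms(1)] by blast
  obtain f :: "'a \<Rightarrow> 'm" and g :: "'b \<Rightarrow> 'm" where f: "inj f" and g: "inj g" using assms by blast
  have "inj (\<lambda>(a, b). p (f a, g b))"
    by (auto intro!: injI dest!: injD[OF p] injD[OF f] injD[OF g])
  then show ?thesis by blast
qed

lemma inj_nat_infinite: "infinite (UNIV :: 'm set) \<Longrightarrow> \<exists>f :: nat \<Rightarrow> 'm. inj f"
  using infinite_countable_subset by blast

text \<open>A list is coded by its length and by iterated pairing of its entries. Once the lengths
  agree, the codes can be unpaired in parallel, whatever seed the fold starts from.\<close>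

lemma inj_list_into:
  assumes "infinite (UNIV :: 'm set)" "\<exists>f :: 'a \<Rightarrow> 'm. inj f"
  shows "\<exists>h :: 'a list \<Rightarrow> 'm. inj h"
proof -
  obtain p :: "nat \<times> 'm \<Rightarrow> 'm" where p: "inj p"
    using inj_prod_into[OF assms(1) inj_nat_infinite[OF assms(1)]] inj_on_id by blast
  obtain q :: "'m \<times> 'm \<Rightarrow> 'm" where q: "inj q" using inj_prod_infinite[OF assms(1)] by blast
  obtain f :: "'a \<Rightarrow> 'm" where f: "inj f" using assms by blast
  define c where "c = foldr (\<lambda>x y. q (f x, y))"
  have "xs = ys" if "length xs = length ys" "c xs m = c ys m" for xs ys m
    using that
  proof (induction xs ys rule: list_induct2)
    case (Cons x xs y ys)
    then have "q (f x, c xs m) = q (f y, c ys m)" by (simp add: c_def)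
    from injD[OF q this] show ?case using injD[OF f, of x y] Cons.IH by auto
  qed simp
  then have "inj (\<lambda>xs. p (length xs, c xs undefined))"
    by (auto intro!: injI dest!: injD[OF p])
  then show ?thesis by blast
qed

text \<open>A finitely supported function is coded by a list enumerating its graph over the
  support.\<close>

lemma inj_poly_mapping_into:
  assumes "infinite (UNIV :: 'm set)" "\<exists>f :: 'a \<Rightarrow> 'm. inj f" "\<exists>g :: 'b::zero \<Rightarrow> 'm. inj g"
  shows "\<exists>h :: ('a \<Rightarrow>\<^sub>0 'b) \<Rightarrow> 'm. inj h"
proof -
  obtain l :: "('a \<times> 'b) list \<Rightarrow> 'm" where l: "inj l"
    using inj_list_into[OF assms(1) inj_prod_into[OF assms]] by blast
  define G where "G p = (\<lambda>k. (k, Poly_Mapping.lookup p k)) ` Poly_Mapping.keys p" for p :: "'a \<Rightarrow>\<^sub>0 'b"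
  define L where "L p = (SOME xs. set xs = G p)" for p
  have "set (L p) = G p" for p
    unfolding L_def by (rule someI_ex) (simp add: G_def finite_list)
  moreover have "inj G"
  proof (rule injI, rule poly_mapping_eqI)
    fix p q :: "'a \<Rightarrow>\<^sub>0 'b" and k assume *: "G p = G q"
    have "k \<in> Poly_Mapping.keys p \<longleftrightarrow> k \<in> Poly_Mapping.keys q"
      using arg_cong[OF *, of "\<lambda>S. k \<in> fst ` S"] by (simp add: G_def image_image)
    moreover have "Poly_Mapping.lookup p k = Poly_Mapping.lookup q k" if "k \<in> Poly_Mapping.keys p"
    proof -
      have "(k, Poly_Mapping.lookup p k) \<in> G q" using that by (simp add: *[symmetric]) (simp add: G_def)
      then show ?thesis by (auto simp: G_def)
    qed
    ultimately show "Poly_Mapping.lookup p k = Poly_Mapping.lookup q k" by (auto simp: in_keys_iff)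
  qed
  ultimately have "inj (\<lambda>p. l (L p))"
    using l by (metis (mono_tags, lifting) inj_def)
  then show ?thesis by blast
qed

lemma inj_malg_into:
  assumes "infinite (UNIV :: 'm set)" "\<exists>f :: 'w \<Rightarrow> 'm. inj f" "\<exists>g :: 'k::zero \<Rightarrow> 'm. inj g"
  shows "\<exists>h :: ('w, 'k) malg \<Rightarrow> 'm. inj h"
proof -
  obtain h :: "('w \<Rightarrow>\<^sub>0 'k) \<Rightarrow> 'm" where h: "inj h" using inj_poly_mapping_into[OF assms] by blast
  have "inj (cf :: ('w, 'k) malg \<Rightarrow> _)" by (rule injI) (simp add: cf_inject)
  then have "inj (h \<circ> cf)" using h by (rule inj_compose[rotated])
  then show ?thesis by blast
qed

section \<open>Modules over the model\<close>

context graded_model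
begin

definition sm :: "('a, 'm) module \<Rightarrow> ('w, 'k) malg \<Rightarrow> 'm \<Rightarrow> 'm"
  where "sm M a m = \<rho> a \<odot>\<^bsub>M\<^esub> m"

lemma left_moduleI:
  assumes "abelian_group M"
    and "\<And>a x. x \<in> carrier M \<Longrightarrow> sm M a x \<in> carrier M"
    and "\<And>a b x. x \<in> carrier M \<Longrightarrow> sm M (a + b) x = sm M a x \<oplus>\<^bsub>M\<^esub> sm M b x"
    and "\<And>a x y. x \<in> carrier M \<Longrightarrow> y \<in> carrier M \<Longrightarrow> sm M a (x \<oplus>\<^bsub>M\<^esub> y) = sm M a x \<oplus>\<^bsub>M\<^esub> sm M a y"
    and "\<And>a b x. x \<in> carrier M \<Longrightarrow> sm M (a * b) x = sm M a (sm M b x)"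
    and "\<And>x. x \<in> carrier M \<Longrightarrow> sm M 1 x = x"
  shows "left_module R M"
  by (intro left_module.intro ring_model assms(1) left_module_axioms.intro)
    (use assms(2-) in \<open>auto simp: sm_def carrier_model ops_model\<close>)

context
  fixes M :: "('a, 'm) module"
  assumes M: "left_module R M"
begin

interpretation M: abelian_group M using M by (simp add: left_module_def)

lemma sm_closed: "x \<in> carrier M \<Longrightarrow> sm M a x \<in> carrier M"
  and sm_add_left: "x \<in> carrier M \<Longrightarrow> sm M (a + b) x = sm M a x \<oplus>\<^bsub>M\<^esub> sm M b x"
  and sm_add_right: "x \<in> carrier M \<Longrightarrow> y \<in> carrier M \<Longrightarrow> sm M a (x \<oplus>\<^bsub>M\<^esub> y) = sm M a x \<oplus>\<^bsub>M\<^esub> sm M a y"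
  and sm_mult: "x \<in> carrier M \<Longrightarrow> sm M (a * b) x = sm M a (sm M b x)"
  and sm_one: "x \<in> carrier M \<Longrightarrow> sm M 1 x = x"
  using left_module.smult_closed[OF M, of "\<rho> a"] left_module.smult_l_distr[OF M, of "\<rho> a" "\<rho> b"]
    left_module.smult_r_distr[OF M, of "\<rho> a"] left_module.smult_assoc1[OF M, of "\<rho> a" "\<rho> b"]
    left_module.smult_one[OF M]
  by (simp_all add: sm_def carrier_model ops_model)

lemma sm_zero_left: "x \<in> carrier M \<Longrightarrow> sm M 0 x = \<zero>\<^bsub>M\<^esub>"
  using sm_add_left[of x 0 0] sm_closed[of x 0] by (metis M.add.r_cancel_one' add_0)

lemma sm_zero_right: "sm M a \<zero>\<^bsub>M\<^esub> = \<zero>\<^bsub>M\<^esub>"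
  using sm_add_right[of "\<zero>\<^bsub>M\<^esub>" "\<zero>\<^bsub>M\<^esub>" a] sm_closed[of "\<zero>\<^bsub>M\<^esub>" a]
  by (metis M.add.r_cancel_one' M.zero_closed M.l_zero)

text \<open>The linear map out of a free module determined by the images of the basis; it is a
  \<open>finsum\<close> because the target is a record and not a type-class group.\<close>

definition ext :: "('j \<Rightarrow> 'm) \<Rightarrow> ('j \<Rightarrow>\<^sub>0 ('w, 'k) malg) \<Rightarrow> 'm"
  where "ext \<phi> p = finsum M (\<lambda>j. sm M (Poly_Mapping.lookup p j) (\<phi> j)) (Poly_Mapping.keys p)"

lemma ext_superset:
  assumes "\<phi> \<in> J \<rightarrow> carrier M" "finite S" "Poly_Mapping.keys p \<subseteq> S" "S \<subseteq> J"
  shows "ext \<phi> p = finsum M (\<lambda>j. sm M (Poly_Mapping.lookup p j) (\<phi> j)) S"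
  unfolding ext_def using assms
  by (intro M.add.finprod_mono_neutral_cong_left)
    (auto simp: in_keys_iff subset_iff Pi_iff intro!: sm_zero_left sm_closed)

lemma ext_closed:
  assumes "\<phi> \<in> J \<rightarrow> carrier M" "Poly_Mapping.keys p \<subseteq> J"
  shows "ext \<phi> p \<in> carrier M"
  unfolding ext_def using assms by (intro M.finsum_closed) (auto intro!: sm_closed)

lemma ext_add:
  assumes "\<phi> \<in> J \<rightarrow> carrier M" "Poly_Mapping.keys p \<subseteq> J" "Poly_Mapping.keys q \<subseteq> J"
  shows "ext \<phi> (p + q) = ext \<phi> p \<oplus>\<^bsub>M\<^esub> ext \<phi> q"
proof -
  let ?S = "Poly_Mapping.keys p \<union> Poly_Mapping.keys q"
  have S: "finite ?S" "?S \<subseteq> J" using assms by auto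
  have "ext \<phi> (p + q) = finsum M (\<lambda>j. sm M (Poly_Mapping.lookup (p + q) j) (\<phi> j)) ?S"
    using keys_add[of p q] by (intro ext_superset[OF assms(1) S(1) _ S(2)]) auto
  also have "\<dots> = finsum M (\<lambda>j. sm M (Poly_Mapping.lookup p j) (\<phi> j) \<oplus>\<^bsub>M\<^esub> sm M (Poly_Mapping.lookup q j) (\<phi> j)) ?S"
    using assms by (intro M.finsum_cong') (auto simp: lookup_add intro!: sm_add_left sm_closed)
  also have "\<dots> = finsum M (\<lambda>j. sm M (Poly_Mapping.lookup p j) (\<phi> j)) ?S \<oplus>\<^bsub>M\<^esub>
      finsum M (\<lambda>j. sm M (Poly_Mapping.lookup q j) (\<phi> j)) ?S"
    using assms by (intro M.finsum_addf) (auto intro!: sm_closed)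
  also have "\<dots> = ext \<phi> p \<oplus>\<^bsub>M\<^esub> ext \<phi> q"
    using ext_superset[OF assms(1) S(1) _ S(2), of p] ext_superset[OF assms(1) S(1) _ S(2), of q] by simp
  finally show ?thesis .
qed

lemma ext_single:
  assumes "\<phi> j \<in> carrier M"
  shows "ext \<phi> (Poly_Mapping.single j a) = sm M a (\<phi> j)"
proof -
  have "ext \<phi> (Poly_Mapping.single j a) = finsum M (\<lambda>i. sm M (Poly_Mapping.lookup (Poly_Mapping.single j a) i) (\<phi> i)) {j}"
    using assms by (intro ext_superset[where J="{j}"]) auto
  also have "\<dots> = sm M a (\<phi> j)"
    using assms sm_closed by (simp add: M.finsum_insert)
  finally show ?thesis .
qed

lemma ext_0: "ext \<phi> 0 = \<zero>\<^bsub>M\<^esub>"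
  by (simp add: ext_def)

lemma ext_lsc:
  assumes "\<phi> \<in> J \<rightarrow> carrier M" "Poly_Mapping.keys p \<subseteq> J"
  shows "ext \<phi> (lsc a p) = sm M a (ext \<phi> p)"
proof -
  from assms(2) have "Poly_Mapping.keys p \<subseteq> J \<and> ext \<phi> (lsc a p) = sm M a (ext \<phi> p)"
  proof (induction rule: pm_induct_keys)
    case zero
    then show ?case by (simp add: lsc_simps ext_0 sm_zero_right)
  next
    case (add p q)
    moreover from this have "Poly_Mapping.keys (lsc a p) \<subseteq> J" "Poly_Mapping.keys (lsc a q) \<subseteq> J"
      using keys_lsc[of a p] keys_lsc[of a q] by auto
    ultimately show ?case
      using keys_add[of p q] ext_closed[OF assms(1), of p] ext_closed[OF assms(1), of q]
      by (auto simp: lsc_simps ext_add[OF assms(1)] sm_add_right)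
  next
    case (single b c)
    then show ?case using assms(1)
      by (auto simp: lsc_simps ext_single sm_mult Pi_iff)
  qed
  then show ?thesis by simp
qed

end

subsection \<open>Transport of modules into the universe\<close>

text \<open>Transport of structure along an injection: constructions are carried out on subsets Y of
  type-class groups and then moved into \<open>'m\<close>, where projectivity and resolutions are
  defined.\<close>

definition tmod :: "('x::ab_group_add \<Rightarrow> 'm) \<Rightarrow> (('w, 'k) malg \<Rightarrow> 'x \<Rightarrow> 'x) \<Rightarrow> 'x set \<Rightarrow> ('a, 'm) module"
  where "tmod \<iota> sc Y = \<lparr>carrier = \<iota> ` Y, monoid.mult = (\<lambda>_ _. \<iota> 0), one = \<iota> 0, zero = \<iota> 0,
    add = (\<lambda>m n. \<iota> (inv_into UNIV \<iota> m + inv_into UNIV \<iota> n)),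
    module.smult = (\<lambda>a m. \<iota> (sc (\<sigma> a) (inv_into UNIV \<iota> m)))\<rparr>"

definition tmap :: "('x \<Rightarrow> 'm) \<Rightarrow> ('y \<Rightarrow> 'm) \<Rightarrow> ('x \<Rightarrow> 'y) \<Rightarrow> 'm \<Rightarrow> 'm"
  where "tmap \<iota> \<kappa> f m = \<kappa> (f (inv_into UNIV \<iota> m))"

lemma tmod_simps:
  assumes "inj \<iota>"
  shows "carrier (tmod \<iota> sc Y) = \<iota> ` Y" "\<zero>\<^bsub>tmod \<iota> sc Y\<^esub> = \<iota> 0"
    "\<iota> p \<oplus>\<^bsub>tmod \<iota> sc Y\<^esub> \<iota> q = \<iota> (p + q)" "\<rho> a \<odot>\<^bsub>tmod \<iota> sc Y\<^esub> \<iota> p = \<iota> (sc a p)"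
    "sm (tmod \<iota> sc Y) a (\<iota> p) = \<iota> (sc a p)"
  using assms by (simp_all add: tmod_def sm_def)

lemma tmap_simp: "inj \<iota> \<Longrightarrow> tmap \<iota> \<kappa> f (\<iota> p) = \<kappa> (f p)"
  by (simp add: tmap_def)

definition action_on :: "(('w, 'k) malg \<Rightarrow> 'x \<Rightarrow> 'x::ab_group_add) \<Rightarrow> 'x set \<Rightarrow> bool"
  where "action_on sc Y \<longleftrightarrow> 0 \<in> Y \<and> (\<forall>p\<in>Y. \<forall>q\<in>Y. p + q \<in> Y) \<and> (\<forall>p\<in>Y. - p \<in> Y) \<and>
    (\<forall>a. \<forall>p\<in>Y. sc a p \<in> Y) \<and> (\<forall>a b. \<forall>p\<in>Y. sc (a + b) p = sc a p + sc b p) \<and>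
    (\<forall>a. \<forall>p\<in>Y. \<forall>q\<in>Y. sc a (p + q) = sc a p + sc a q) \<and>
    (\<forall>a b. \<forall>p\<in>Y. sc (a * b) p = sc a (sc b p)) \<and> (\<forall>p\<in>Y. sc 1 p = p)"

lemma left_module_tmod:
  assumes "inj \<iota>" "action_on sc Y"
  shows "left_module R (tmod \<iota> sc Y)"
proof (rule left_moduleI)
  show "abelian_group (tmod \<iota> sc Y)"
  proof (rule abelian_groupI)
    fix x assume "x \<in> carrier (tmod \<iota> sc Y)"
    then obtain p where "x = \<iota> p" "p \<in> Y" by (auto simp: tmod_simps[OF assms(1)])
    then show "\<exists>y\<in>carrier (tmod \<iota> sc Y). y \<oplus>\<^bsub>tmod \<iota> sc Y\<^esub> x = \<zero>\<^bsub>tmod \<iota> sc Y\<^esub>"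
      using assms(2) by (intro bexI[of _ "\<iota> (- p)"]) (auto simp: tmod_simps[OF assms(1)] action_on_def)
  qed (use assms(2) in \<open>auto simp: tmod_simps[OF assms(1)] action_on_def add.assoc add.commute add.left_commute\<close>)
qed (use assms(2) in \<open>auto simp: tmod_simps[OF assms(1)] action_on_def\<close>)

lemma tmap_hom:
  assumes "inj \<iota>" "inj \<kappa>" "f \<in> Y \<rightarrow> Z"
    and "\<And>p q. p \<in> Y \<Longrightarrow> q \<in> Y \<Longrightarrow> f (p + q) = f p + f q"
    and "\<And>a p. p \<in> Y \<Longrightarrow> f (sc a p) = sc' a (f p)"
  shows "tmap \<iota> \<kappa> f \<in> module_hom R (tmod \<iota> sc Y) (tmod \<kappa> sc' Z)"
  unfolding module_hom_def using assms(3-5)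
  by (auto simp: tmod_simps[OF assms(1)] tmod_simps[OF assms(2)] tmap_simp[OF assms(1)] carrier_model)

lemma module_hom_simps:
  assumes "h \<in> module_hom R M N"
  shows "x \<in> carrier M \<Longrightarrow> h x \<in> carrier N"
    "x \<in> carrier M \<Longrightarrow> y \<in> carrier M \<Longrightarrow> h (x \<oplus>\<^bsub>M\<^esub> y) = h x \<oplus>\<^bsub>N\<^esub> h y"
    "x \<in> carrier M \<Longrightarrow> h (sm M a x) = sm N a (h x)"
  using assms by (auto simp: module_hom_def sm_def carrier_model)

lemma module_hom_zero:
  assumes "left_module R M" "left_module R N" "h \<in> module_hom R M N"
  shows "h \<zero>\<^bsub>M\<^esub> = \<zero>\<^bsub>N\<^esub>"
proof -
  interpret M: abelian_group M using assms(1) by (simp add: left_module_def)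
  have "h (sm M 0 \<zero>\<^bsub>M\<^esub>) = sm N 0 (h \<zero>\<^bsub>M\<^esub>)" by (rule module_hom_simps(3)[OF assms(3)]) simp
  then show ?thesis
    using sm_zero_left[OF assms(1)] sm_zero_left[OF assms(2)] module_hom_simps(1)[OF assms(3)] by simp
qed

lemma module_homI:
  assumes "\<And>x. x \<in> carrier M \<Longrightarrow> h x \<in> carrier N"
    "\<And>x y. x \<in> carrier M \<Longrightarrow> y \<in> carrier M \<Longrightarrow> h (x \<oplus>\<^bsub>M\<^esub> y) = h x \<oplus>\<^bsub>N\<^esub> h y"
    "\<And>a x. x \<in> carrier M \<Longrightarrow> h (sm M a x) = sm N a (h x)"
  shows "h \<in> module_hom R M N"
  using assms by (auto simp: module_hom_def sm_def carrier_model)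

text \<open>\<open>L\<close> identifies the free module on J with Y. A lift sends each basis vector
  to a chosen preimage and is extended by \<open>ext\<close>.\<close>

lemma projective_tmod:
  fixes L :: "('j \<Rightarrow>\<^sub>0 ('w, 'k) malg) \<Rightarrow> 'x::ab_group_add" and \<iota> :: "'x \<Rightarrow> 'm"
  assumes \<iota>: "inj \<iota>" and act: "action_on sc Y"
    and L: "additive L" "\<And>a p. L (lsc a p) = sc a (L p)" "L ` {p. Poly_Mapping.keys p \<subseteq> J} = Y"
      "\<And>p. L p = 0 \<Longrightarrow> Poly_Mapping.keys p \<subseteq> J \<Longrightarrow> p = 0"
  shows "projective R (tmod \<iota> sc Y)"
  unfolding projective_def
proof (intro conjI allI impI)
  show lm: "left_module R (tmod \<iota> sc Y)" by (rule left_module_tmod[OF \<iota> act])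
  fix M N :: "('a, 'm) module" and g f
  assume "left_module R M \<and> left_module R N \<and> g \<in> module_hom R M N \<and>
    g ` carrier M = carrier N \<and> f \<in> module_hom R (tmod \<iota> sc Y) N"
  then have M: "left_module R M" and N: "left_module R N" and g: "g \<in> module_hom R M N"
    and sur: "g ` carrier M = carrier N" and f: "f \<in> module_hom R (tmod \<iota> sc Y) N" by auto
  note tm = tmod_simps[OF \<iota>]
  let ?J = "{p. Poly_Mapping.keys p \<subseteq> J}"
  have inj: "inj_on L ?J"
  proof (rule inj_onI)
    fix p q assume "p \<in> ?J" "q \<in> ?J" "L p = L q"
    then have "p - q = 0" using keys_diff_subset[of p q]
      by (intro L(4)) (auto simp: additiveD[OF L(1)])
    then show "p = q" by simp
  qed
  have LY: "L p \<in> Y" if "Poly_Mapping.keys p \<subseteq> J" for p using L(3) that by auto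
  have "\<exists>m\<in>carrier M. g m = f (\<iota> (L (Poly_Mapping.single j 1)))" if "j \<in> J" for j
  proof -
    have "\<iota> (L (Poly_Mapping.single j 1)) \<in> carrier (tmod \<iota> sc Y)" using LY that by (auto simp: tm)
    then have "f (\<iota> (L (Poly_Mapping.single j 1))) \<in> g ` carrier M"
      using module_hom_simps(1)[OF f] sur by blast
    then show ?thesis by auto
  qed
  then obtain \<phi> where \<phi>: "\<And>j. j \<in> J \<Longrightarrow> \<phi> j \<in> carrier M \<and> g (\<phi> j) = f (\<iota> (L (Poly_Mapping.single j 1)))"
    by metis
  then have \<phi>J: "\<phi> \<in> J \<rightarrow> carrier M" by auto
  define h where "h m = ext M \<phi> (inv_into ?J L (inv_into UNIV \<iota> m))" for m
  have h: "h (\<iota> (L p)) = ext M \<phi> p" if "Poly_Mapping.keys p \<subseteq> J" for p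
    using inj that \<iota> by (simp add: h_def)
  have elem: "\<exists>p. Poly_Mapping.keys p \<subseteq> J \<and> m = \<iota> (L p)" if "m \<in> carrier (tmod \<iota> sc Y)" for m
    using that L(3) by (auto simp: tm)
  have "h \<in> module_hom R (tmod \<iota> sc Y) M"
  proof (rule module_homI)
    fix m assume "m \<in> carrier (tmod \<iota> sc Y)"
    then obtain p where p: "Poly_Mapping.keys p \<subseteq> J" "m = \<iota> (L p)" using elem by blast
    then show "h m \<in> carrier M" using h ext_closed[OF M \<phi>J] by simp
    show "h (sm (tmod \<iota> sc Y) a m) = sm M a (h m)" for a
      using p h[of p] h[of "lsc a p"] keys_lsc[of a p] ext_lsc[OF M \<phi>J, of p a]
      by (auto simp: tm L(2)[symmetric])
    fix n assume "n \<in> carrier (tmod \<iota> sc Y)"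
    then obtain q where q: "Poly_Mapping.keys q \<subseteq> J" "n = \<iota> (L q)" using elem by blast
    have "Poly_Mapping.keys (p + q) \<subseteq> J" using keys_add[of p q] p q by auto
    then show "h (m \<oplus>\<^bsub>tmod \<iota> sc Y\<^esub> n) = h m \<oplus>\<^bsub>M\<^esub> h n"
      using p q h[of p] h[of q] h[of "p + q"] ext_add[OF M \<phi>J, of p q]
      by (auto simp: tm additiveD(1)[OF L(1)])
  qed
  moreover have "g (h x) = f x" if x: "x \<in> carrier (tmod \<iota> sc Y)" for x
  proof -
    obtain p where p: "Poly_Mapping.keys p \<subseteq> J" "x = \<iota> (L p)" using elem[OF x] by blast
    from p(1) have "Poly_Mapping.keys p \<subseteq> J \<and> g (ext M \<phi> p) = f (\<iota> (L p))"
    proof (induction rule: pm_induct_keys)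
      case zero
      then show ?case
        using module_hom_zero[OF M N g] module_hom_zero[OF lm N f] by (simp add: ext_0[OF M] additiveD[OF L(1)] tm)
    next
      case (add p q)
      have "Poly_Mapping.keys (p + q) \<subseteq> J" using keys_add[of p q] add by auto
      moreover have "g (ext M \<phi> (p + q)) = f (\<iota> (L p) \<oplus>\<^bsub>tmod \<iota> sc Y\<^esub> \<iota> (L q))"
        using add LY ext_closed[OF M \<phi>J]
        by (subst module_hom_simps(2)[OF f]) (auto simp: tm ext_add[OF M \<phi>J] module_hom_simps(2)[OF g])
      ultimately show ?case by (simp add: tm additiveD[OF L(1)])
    next
      case (single j a)
      have "L (Poly_Mapping.single j a) = sc a (L (Poly_Mapping.single j 1))"
        by (simp add: L(2)[symmetric] lsc_simps)
      then have "f (\<iota> (L (Poly_Mapping.single j a))) = f (sm (tmod \<iota> sc Y) a (\<iota> (L (Poly_Mapping.single j 1))))"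
        by (simp add: tm)
      also have "\<dots> = sm N a (g (\<phi> j))"
        using single \<phi> LY[of "Poly_Mapping.single j 1"]
        by (subst module_hom_simps(3)[OF f]) (auto simp: tm)
      also have "\<dots> = g (ext M \<phi> (Poly_Mapping.single j a))"
        using single \<phi> by (simp add: ext_single[OF M] module_hom_simps(3)[OF g])
      finally show ?case using single by simp
    qed
    then show ?thesis using h p by simp
  qed
  ultimately show "\<exists>h\<in>module_hom R (tmod \<iota> sc Y) M. \<forall>x\<in>carrier (tmod \<iota> sc Y). g (h x) = f x"
    by blast
qed

subsection \<open>Existence of vector space bases of modules\<close>

text \<open>M is a record, so the basis is found in the free vector space on its carrier. Let N be
  the kernel of the evaluation \<open>\<theta>\<close> onto M and extend a basis \<open>B1\<close>
  of N by unit vectors. The added unit vectors, indexed by B, span a complement of N, which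
  \<open>\<theta>\<close> maps isomorphically onto M.\<close>

lemma based_module_exists:
  fixes M :: "('a, 'm) module"
  assumes M: "left_module R M"
  obtains B :: "'m set" and \<beta> :: "('w, 'k) malg \<Rightarrow> 'm \<Rightarrow> ('m \<Rightarrow>\<^sub>0 'k)" and \<theta>
  where "based_module B \<beta>" "\<And>q. Poly_Mapping.keys q \<subseteq> B \<Longrightarrow> \<theta> q \<in> carrier M"
    "\<And>p q. Poly_Mapping.keys p \<subseteq> B \<Longrightarrow> Poly_Mapping.keys q \<subseteq> B \<Longrightarrow> \<theta> (p + q) = \<theta> p \<oplus>\<^bsub>M\<^esub> \<theta> q"
    "\<And>a q. Poly_Mapping.keys q \<subseteq> B \<Longrightarrow> \<theta> (based_module.act \<beta> a q) = sm M a (\<theta> q)"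
    "\<And>m. m \<in> carrier M \<Longrightarrow> \<exists>q. Poly_Mapping.keys q \<subseteq> B \<and> \<theta> q = m"
    "\<And>q. Poly_Mapping.keys q \<subseteq> B \<Longrightarrow> \<theta> q = \<zero>\<^bsub>M\<^esub> \<Longrightarrow> q = 0"
proof -
  interpret M: abelian_group M using M by (simp add: left_module_def)
  let ?C = "carrier M" and ?K = "\<lambda>S. {q :: 'm \<Rightarrow>\<^sub>0 'k. Poly_Mapping.keys q \<subseteq> S}"
  have idC: "(\<lambda>m. m) \<in> ?C \<rightarrow> ?C" by simp
  define \<theta> where "\<theta> q = ext M (\<lambda>m. m) (tensor 1 q :: 'm \<Rightarrow>\<^sub>0 ('w, 'k) malg)" for q
  have keysC: "Poly_Mapping.keys (tensor 1 q :: 'm \<Rightarrow>\<^sub>0 ('w, 'k) malg) \<subseteq> ?C" if "q \<in> ?K ?C" for q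
    using keys_tensor[of 1 q] that by auto
  have \<theta>C: "\<theta> q \<in> ?C" if "q \<in> ?K ?C" for q
    unfolding \<theta>_def using that by (intro ext_closed[OF M idC] keysC)
  have \<theta>_add: "\<theta> (p + q) = \<theta> p \<oplus>\<^bsub>M\<^esub> \<theta> q" if "p \<in> ?K ?C" "q \<in> ?K ?C" for p q
    unfolding \<theta>_def using ext_add[OF M idC keysC[OF that(1)] keysC[OF that(2)]] by (simp add: tensor_simps)
  have \<theta>_0: "\<theta> 0 = \<zero>\<^bsub>M\<^esub>" by (simp add: \<theta>_def tensor_simps ext_0[OF M])
  have \<theta>_scale: "\<theta> (pm_scale c q) = sm M (scal c) (\<theta> q)" if "q \<in> ?K ?C" for c q
  proof -
    have "tensor 1 (pm_scale c q) = lsc (scal c) (tensor 1 q :: 'm \<Rightarrow>\<^sub>0 ('w, 'k) malg)"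
      by (simp add: tensor_pm_scale tensor_simps)
    then show ?thesis unfolding \<theta>_def using ext_lsc[OF M idC keysC[OF that]] by simp
  qed
  have \<theta>_single: "\<theta> (Poly_Mapping.single m 1) = m" if "m \<in> ?C" for m
    using that by (simp add: \<theta>_def tensor_simps mon_zone_one ext_single[OF M] sm_one[OF M])
  have KC: "pm_vs.subspace (?K S)" for S
  proof (rule pm_vs.subspaceI)
    fix p q assume "p \<in> ?K S" "q \<in> ?K S"
    then show "p + q \<in> ?K S" using keys_add[of p q] by auto
  next
    fix c q assume "q \<in> ?K S"
    then show "pm_scale c q \<in> ?K S" using keys_lsc[of c q] by (auto simp: pm_scale_lsc)
  qed simp
  define N where "N = {q \<in> ?K ?C. \<theta> q = \<zero>\<^bsub>M\<^esub>}"
  have N: "pm_vs.subspace N"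
  proof (rule pm_vs.subspaceI)
    fix p q assume "p \<in> N" "q \<in> N"
    then show "p + q \<in> N" using \<theta>_add[of p q] pm_vs.subspace_add[OF KC, of p ?C q] by (auto simp: N_def)
  next
    fix c q assume "q \<in> N"
    then show "pm_scale c q \<in> N"
      using \<theta>_scale[of q c] pm_vs.subspace_scale[OF KC, of q ?C c] sm_zero_right[OF M] by (auto simp: N_def)
  qed (simp add: N_def \<theta>_0)
  obtain B1 where B1: "B1 \<subseteq> N" "pm_vs.independent B1" "N \<subseteq> pm_span B1"
    using pm_vs.maximal_independent_subset by metis
  let ?X = "(\<lambda>m. Poly_Mapping.single m (1::'k)) ` ?C"
  obtain B2 where B2: "B1 \<subseteq> B2" "B2 \<subseteq> B1 \<union> ?X" "pm_vs.independent B2" "B1 \<union> ?X \<subseteq> pm_span B2"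
    using pm_vs.maximal_independent_subset_extend[of B1 "B1 \<union> ?X"] B1(2) by blast
  define B where "B = {m \<in> ?C. Poly_Mapping.single m (1::'k) \<in> B2 - B1}"
  have BC: "B \<subseteq> ?C" by (auto simp: B_def)
  then have KBC: "?K B \<subseteq> ?K ?C" by auto
  have B2B1: "B2 - B1 = (\<lambda>m. Poly_Mapping.single m 1) ` B"
    using B2(2) by (auto simp: B_def)
  have spanN: "pm_span B1 = N" using B1 pm_vs.span_minimal[OF B1(1) N] by auto
  have spanB: "pm_span (B2 - B1) = ?K B"
  proof
    show "pm_span (B2 - B1) \<subseteq> ?K B" by (rule pm_vs.span_minimal[OF _ KC]) (auto simp: B2B1)
    show "?K B \<subseteq> pm_span (B2 - B1)"
    proof
      fix q assume "q \<in> ?K B"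
      then have "Poly_Mapping.keys q \<subseteq> B" by simp
      then show "q \<in> pm_span (B2 - B1)"
      proof (induction rule: pm_induct_keys)
        case (single m c)
        have "pm_scale c (Poly_Mapping.single m 1) \<in> pm_span (B2 - B1)"
          using single by (intro pm_vs.span_scale pm_vs.span_base) (auto simp: B2B1)
        then show ?case by (simp add: pm_scale_lsc lsc_simps)
      qed (auto intro: pm_vs.span_zero pm_vs.span_add)
    qed
  qed
  \<comment> \<open>Such a q has two expansions in the independent set \<open>B2\<close>, one
    supported on \<open>B1\<close> and one on its complement, so all its coefficients
    vanish.\<close>
  have zero: "q = 0" if "q \<in> ?K B" "\<theta> q = \<zero>\<^bsub>M\<^esub>" for q
  proof -
    have q1: "q \<in> pm_span B1" using that KBC by (auto simp: spanN N_def)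
    have q2: "q \<in> pm_span (B2 - B1)" using that spanB by simp
    have "pm_vs.representation B2 q = pm_vs.representation B1 q"
      by (rule pm_vs.representation_extend[OF B2(3) q1 B2(1)])
    moreover have "pm_vs.representation B2 q = pm_vs.representation (B2 - B1) q"
      by (rule pm_vs.representation_extend[OF B2(3) q2 Diff_subset])
    ultimately have "pm_vs.representation B2 q v = 0" for v
      using pm_vs.representation_ne_zero[of B1 q v] pm_vs.representation_ne_zero[of "B2 - B1" q v] by auto
    moreover have "q \<in> pm_span B2" using q1 pm_vs.span_mono[OF B2(1)] by blast
    ultimately show "q = 0" using pm_vs.sum_nonzero_representation_eq[OF B2(3), of q] by simp
  qed
  have surj: "\<exists>q. Poly_Mapping.keys q \<subseteq> B \<and> \<theta> q = m" if m: "m \<in> ?C" for m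
  proof -
    have "Poly_Mapping.single m 1 \<in> pm_span (B1 \<union> (B2 - B1))"
      using B2(1,4) m by (metis Un_Diff_cancel imageI sup.absorb2 sup.cobounded2 subset_iff)
    then obtain v w where vw: "Poly_Mapping.single m 1 = v + w" "v \<in> pm_span B1" "w \<in> pm_span (B2 - B1)"
      unfolding pm_vs.span_Un by blast
    then have "v \<in> N" "w \<in> ?K B" using spanN spanB by auto
    then have "\<theta> (v + w) = \<theta> w" using \<theta>_add[of v w] KBC \<theta>C[of w] by (auto simp: N_def)
    then have "\<theta> w = m" using \<theta>_single[OF m] vw(1) by simp
    then show ?thesis using \<open>w \<in> ?K B\<close> by auto
  qed
  have unique: "p = q" if "p \<in> ?K B" "q \<in> ?K B" "\<theta> p = \<theta> q" for p q
  proof -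
    have pq: "p - q \<in> ?K B" using pm_vs.subspace_diff[OF KC that(1,2)] .
    have "\<theta> (p - q) \<oplus>\<^bsub>M\<^esub> \<theta> q = \<theta> ((p - q) + q)"
      using pq that BC by (intro \<theta>_add[symmetric]) auto
    then have "\<theta> (p - q) \<oplus>\<^bsub>M\<^esub> \<theta> q = \<theta> q" using that(3) by simp
    then have "\<theta> (p - q) = \<zero>\<^bsub>M\<^esub>"
      using M.add.r_cancel_one[OF \<theta>C[OF subsetD[OF KBC that(2)]] \<theta>C[OF subsetD[OF KBC pq]]] by simp
    then show "p = q" using zero[OF pq] by simp
  qed
  define \<kappa> where "\<kappa> m = (SOME q. Poly_Mapping.keys q \<subseteq> B \<and> \<theta> q = m)" for m
  have \<kappa>: "\<kappa> m \<in> ?K B" "\<theta> (\<kappa> m) = m" if "m \<in> ?C" for m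
    using someI_ex[OF surj[OF that]] by (auto simp: \<kappa>_def)
  have \<kappa>I: "\<kappa> m = q" if "\<theta> q = m" "q \<in> ?K B" for m q
    using that \<theta>C[of q] KBC \<kappa>[of m] by (intro unique) auto
  define \<beta> where "\<beta> a b = (if b \<in> B then \<kappa> (sm M a b) else 0)" for a b
  have smC: "sm M a b \<in> ?C" if "b \<in> ?C" for a b using sm_closed[OF M that] .
  \<comment> \<open>The coordinates of a m in terms of the coordinates q of m. Taken at the
    coordinates of a' b, this is the axiom \<open>\<beta>_mult\<close>.\<close>
  have lin\<beta>: "\<kappa> (sm M a (\<theta> q)) = lin (\<lambda>b c. pm_scale c (\<beta> a b)) q" if "Poly_Mapping.keys q \<subseteq> B" for a q
  proof -
    have addB: "\<And>b. additive (\<lambda>c. pm_scale c (\<beta> a b))" by (simp add: pm_scale_lsc additive_lsc_left)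
    from that have "q \<in> ?K B \<and> lin (\<lambda>b c. pm_scale c (\<beta> a b)) q \<in> ?K B \<and>
      \<theta> (lin (\<lambda>b c. pm_scale c (\<beta> a b)) q) = sm M a (\<theta> q)"
    proof (induction rule: pm_induct_keys)
      case zero
      then show ?case by (simp add: lin_def \<theta>_0 sm_zero_right[OF M])
    next
      case (add p q)
      let ?l = "lin (\<lambda>b c. pm_scale c (\<beta> a b))"
      have l: "?l (p + q) = ?l p + ?l q" by (rule additiveD(1)[OF additive_lin[OF addB]])
      have K: "p \<in> ?K ?C" "q \<in> ?K ?C" "?l p \<in> ?K ?C" "?l q \<in> ?K ?C" using add KBC by auto
      have "\<theta> (?l (p + q)) = sm M a (\<theta> (p + q))"
        using add \<theta>_add[OF K(1,2)] \<theta>_add[OF K(3,4)] \<theta>C[OF K(1)] \<theta>C[OF K(2)]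
        by (simp add: l sm_add_right[OF M])
      moreover have "p + q \<in> ?K B" "?l (p + q) \<in> ?K B"
        unfolding l using add by (intro pm_vs.subspace_add[OF KC]; simp)+
      ultimately show ?case by blast
    next
      case (single b c)
      then have b: "b \<in> ?C" using BC by auto
      have "\<theta> (pm_scale c (\<beta> a b)) = sm M (scal c) (sm M a b)"
        using \<kappa>[OF smC[OF b, of a]] KBC single by (subst \<theta>_scale) (auto simp: \<beta>_def)
      also have "\<dots> = sm M a (sm M (scal c) b)"
        using b by (simp add: sm_mult[OF M, symmetric] scal_central)
      also have "sm M (scal c) b = \<theta> (Poly_Mapping.single b c)"
        using b by (simp add: \<theta>_def tensor_simps ext_single[OF M])
      finally have "\<theta> (pm_scale c (\<beta> a b)) = sm M a (\<theta> (Poly_Mapping.single b c))" .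
      moreover have "pm_scale c (\<beta> a b) \<in> ?K B"
        using \<kappa>(1)[OF smC[OF b, of a]] by (intro pm_vs.subspace_scale[OF KC]) (auto simp: \<beta>_def)
      moreover have "lin (\<lambda>b c. pm_scale c (\<beta> a b)) (Poly_Mapping.single b c) = pm_scale c (\<beta> a b)"
        by (rule lin_single[OF addB])
      ultimately show ?case using single by simp
    qed
    then show ?thesis by (intro \<kappa>I) auto
  qed
  have based: "based_module B \<beta>"
  proof
    show "Poly_Mapping.keys (\<beta> a b) \<subseteq> B" for a b
      using \<kappa>(1)[of "sm M a b"] BC smC by (auto simp: \<beta>_def split: if_splits)
    show "b \<notin> B \<Longrightarrow> \<beta> a b = 0" for a b by (simp add: \<beta>_def)
    show "\<beta> 1 b = Poly_Mapping.single b 1" if "b \<in> B" for b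
      using that BC \<theta>_single[of b] by (auto simp: \<beta>_def sm_one[OF M] intro!: \<kappa>I)
    show "\<beta> (a + a') b = \<beta> a b + \<beta> a' b" for a a' b
    proof (cases "b \<in> B")
      case True
      then have b: "b \<in> ?C" using BC by auto
      have "\<kappa> (sm M (a + a') b) = \<kappa> (sm M a b) + \<kappa> (sm M a' b)"
        using \<theta>_add[of "\<kappa> (sm M a b)" "\<kappa> (sm M a' b)"] \<kappa>[OF smC[OF b, of a]] \<kappa>[OF smC[OF b, of a']] KBC
          pm_vs.subspace_add[OF KC, of "\<kappa> (sm M a b)" B "\<kappa> (sm M a' b)"]
        by (intro \<kappa>I) (auto simp: sm_add_left[OF M b])
      then show ?thesis using True by (simp add: \<beta>_def)
    qed (simp add: \<beta>_def)
    show "\<beta> (scal c * a) b = pm_scale c (\<beta> a b)" for c a b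
    proof (cases "b \<in> B")
      case True
      then have b: "b \<in> ?C" using BC by auto
      have "\<kappa> (sm M (scal c * a) b) = pm_scale c (\<kappa> (sm M a b))"
        using \<theta>_scale[of "\<kappa> (sm M a b)" c] \<kappa>[OF smC[OF b, of a]] KBC
          pm_vs.subspace_scale[OF KC, of "\<kappa> (sm M a b)" B c]
        by (intro \<kappa>I) (auto simp: sm_mult[OF M b])
      then show ?thesis using True by (simp add: \<beta>_def)
    qed (simp add: \<beta>_def)
    show "\<beta> (a * a') b = lin (\<lambda>b' c. pm_scale c (\<beta> a b')) (\<beta> a' b)" for a a' b
    proof (cases "b \<in> B")
      case True
      then have b: "b \<in> ?C" using BC by auto
      show ?thesis
        using True lin\<beta>[of "\<kappa> (sm M a' b)" a] \<kappa>[OF smC[OF b, of a']]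
        by (simp add: \<beta>_def sm_mult[OF M b])
    qed (simp add: \<beta>_def lin_def)
  qed
  show ?thesis
  proof (rule that[OF based])
    show "\<theta> (based_module.act \<beta> a q) = sm M a (\<theta> q)" if "Poly_Mapping.keys q \<subseteq> B" for a q
    proof -
      have "sm M a (\<theta> q) \<in> ?C" using that KBC by (intro smC \<theta>C) auto
      then show ?thesis
        using \<kappa>(2)[of "sm M a (\<theta> q)"] lin\<beta>[OF that, of a] by (simp add: based_module.act_def[OF based])
    qed
    show "\<theta> (p + q) = \<theta> p \<oplus>\<^bsub>M\<^esub> \<theta> q" if "Poly_Mapping.keys p \<subseteq> B" "Poly_Mapping.keys q \<subseteq> B" for p q
      using that KBC by (intro \<theta>_add) auto
  qed (use surj zero \<theta>C KBC in auto)
qed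

end

section \<open>The global dimension\<close>

definition lsc2 :: "'r::ring_1 \<Rightarrow> ('b \<Rightarrow>\<^sub>0 'r) \<times> ('b \<Rightarrow>\<^sub>0 'r) \<Rightarrow> _"
  where "lsc2 a = (\<lambda>(p, q). (lsc a p, lsc a q))"

definition lsc3 :: "'r::ring_1 \<Rightarrow> ('b \<Rightarrow>\<^sub>0 'r) \<times> ('b \<Rightarrow>\<^sub>0 'r) \<times> ('b \<Rightarrow>\<^sub>0 'r) \<Rightarrow> _"
  where "lsc3 a = (\<lambda>(p, q, r). (lsc a p, lsc a q, lsc a r))"

text \<open>Pairs and triples of elements of the free module on B form the free module on two or
  three disjoint copies of B; \<open>slice\<close> and \<open>embed\<close> are the projections and
  inclusions.\<close>

definition slice :: "nat \<Rightarrow> (nat \<times> 'm \<Rightarrow>\<^sub>0 'r) \<Rightarrow> ('m \<Rightarrow>\<^sub>0 'r::ring_1)"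
  where "slice n p = Poly_Mapping.map_key (Pair n) p"

lemma lookup_slice [simp]: "Poly_Mapping.lookup (slice n p) b = Poly_Mapping.lookup p (n, b)"
  by (simp add: slice_def map_key.rep_eq inj_def)

lemma slice_add: "slice n (p + q) = slice n p + slice n q"
  and slice_lsc: "slice n (lsc a p) = lsc a (slice n p)"
  by (rule pm_eqI, simp add: lookup_add)+

lemma keys_slice: "Poly_Mapping.keys p \<subseteq> I \<times> B \<Longrightarrow> Poly_Mapping.keys (slice n p) \<subseteq> B"
  by (auto simp: in_keys_iff)

definition embed :: "nat \<Rightarrow> ('m \<Rightarrow>\<^sub>0 'r) \<Rightarrow> (nat \<times> 'm \<Rightarrow>\<^sub>0 'r::ring_1)"
  where "embed n q = lin (\<lambda>b. Poly_Mapping.single (n, b)) q"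

lemma lookup_embed [simp]:
  "Poly_Mapping.lookup (embed n q) (m, b) = (if m = n then Poly_Mapping.lookup q b else 0)"
  by (auto simp: embed_def lin_def lookup_sum lookup_single when_def in_keys_iff)

lemma slice_embed: "slice m (embed n q) = (if m = n then q else 0)"
  by (rule pm_eqI) simp

lemma keys_embed: "Poly_Mapping.keys q \<subseteq> B \<Longrightarrow> n \<in> I \<Longrightarrow> Poly_Mapping.keys (embed n q) \<subseteq> I \<times> B"
  by (auto simp: in_keys_iff split: if_splits)

context xyz_module
begin

lemma d_FB:
  "p \<in> FB \<times> FB \<times> FB \<Longrightarrow> d1 p \<in> FB" "q \<in> FB \<times> FB \<times> FB \<Longrightarrow> d2 q \<in> FB \<times> FB \<times> FB"
  "s \<in> FB \<times> FB \<Longrightarrow> d3 s \<in> FB \<times> FB \<times> FB" "t \<in> FB \<Longrightarrow> d4 t \<in> FB \<times> FB"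
  by (auto simp: d1_def d2_def d3_def d4_def intro!: FB_simps FB_sact)

lemma d_lsc:
  "d1 (lsc3 a p) = lsc a (d1 p)" "d2 (lsc3 a q) = lsc3 a (d2 q)" "d3 (lsc2 a s) = lsc3 a (d3 s)"
  "d4 (lsc a t) = lsc2 a (d4 t)"
proof -
  note simps = rmul_lsc sact_lsc lsc_simps(1,2) additiveD(3)[OF additive_lsc]
  show "d1 (lsc3 a p) = lsc a (d1 p)" by (cases p) (simp only: d1_def lsc3_def prod.case simps)
  show "d2 (lsc3 a q) = lsc3 a (d2 q)" by (cases q) (simp only: d2_def lsc3_def prod.case simps)
  show "d3 (lsc2 a s) = lsc3 a (d3 s)" by (cases s) (simp only: d3_def lsc2_def lsc3_def prod.case simps)
  show "d4 (lsc a t) = lsc2 a (d4 t)" by (simp only: d4_def lsc2_def prod.case simps)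
qed

end

text \<open>The unit coefficient is the augmentation A -> k. It is multiplicative because degrees
  add up and only the unit has degree 0.\<close>

lemma coeff_mult_zone: "coeff (a * b) zone = coeff a zone * coeff b zone"
proof -
  have mon: "coeff (mon v c * b) zone = coeff (mon v c) zone * coeff b zone" for v c
  proof -
    have "supp b \<subseteq> UNIV" by simp
    then show ?thesis
    proof (induction rule: malg_induct)
      case (mon w d)
      show ?case
      proof (cases "v = zone \<and> w = zone")
        case True
        then show ?thesis by (simp add: mon_times)
      next
        case False
        have "u \<noteq> zone" if "zmult v w = Some u" for u
          using zdeg_zmult[OF that] False zdeg_eq_0[of u] zdeg_eq_0[of v] zdeg_eq_0[of w] by auto
        then show ?thesis using False
          by (cases "zmult v w") (auto simp: mon_times lookup_single when_def)
      qed
    qed (simp_all add: distrib_left lookup_add)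
  qed
  have "supp a \<subseteq> UNIV" by simp
  then show ?thesis
    by (induction rule: malg_induct) (simp_all add: distrib_right lookup_add mon)
qed

locale graded_xyz = graded_model R \<rho> + xyz_algebra x y z
  for R :: "('k::field, 'a) graded_algebra" and \<rho> :: "('w::zmonoid, 'k) malg \<Rightarrow> 'a" and x y z :: "('w, 'k) malg"
begin

lemma proj_dim_le:
  fixes M :: "('a, 'm) module"
  assumes M: "left_module R M" and inf: "infinite (UNIV :: 'm set)"
    and w: "\<exists>f :: 'w \<Rightarrow> 'm. inj f" and k: "\<exists>g :: 'k \<Rightarrow> 'm. inj g"
  shows "proj_dim R M \<le> 4"
proof -
  obtain B :: "'m set" and \<beta> :: "('w, 'k) malg \<Rightarrow> 'm \<Rightarrow> ('m \<Rightarrow>\<^sub>0 'k)" and \<theta>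
    where based: "based_module B \<beta>"
      and \<theta>: "\<And>q. Poly_Mapping.keys q \<subseteq> B \<Longrightarrow> \<theta> q \<in> carrier M"
      "\<And>p q. Poly_Mapping.keys p \<subseteq> B \<Longrightarrow> Poly_Mapping.keys q \<subseteq> B \<Longrightarrow> \<theta> (p + q) = \<theta> p \<oplus>\<^bsub>M\<^esub> \<theta> q"
      "\<And>a q. Poly_Mapping.keys q \<subseteq> B \<Longrightarrow> \<theta> (based_module.act \<beta> a q) = sm M a (\<theta> q)"
      "\<And>m. m \<in> carrier M \<Longrightarrow> \<exists>q. Poly_Mapping.keys q \<subseteq> B \<and> \<theta> q = m"
      "\<And>q. Poly_Mapping.keys q \<subseteq> B \<Longrightarrow> \<theta> q = \<zero>\<^bsub>M\<^esub> \<Longrightarrow> q = 0"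
    using based_module_exists[OF M] by blast
  interpret xyz_module x y z B \<beta> by (intro xyz_module.intro xyz_algebra_axioms based)
  have inj1: "\<exists>f :: ('m \<Rightarrow>\<^sub>0 ('w, 'k) malg) \<Rightarrow> 'm. inj f"
    using inj_poly_mapping_into[OF inf _ inj_malg_into[OF inf w k]] inj_on_id by blast
  then obtain i1 :: "('m \<Rightarrow>\<^sub>0 ('w, 'k) malg) \<Rightarrow> 'm" where i1: "inj i1" by blast
  have inj2: "\<exists>f :: ('m \<Rightarrow>\<^sub>0 ('w, 'k) malg) \<times> ('m \<Rightarrow>\<^sub>0 ('w, 'k) malg) \<Rightarrow> 'm. inj f"
    by (rule inj_prod_into[OF inf inj1 inj1])
  then obtain i2 :: "('m \<Rightarrow>\<^sub>0 ('w, 'k) malg) \<times> ('m \<Rightarrow>\<^sub>0 ('w, 'k) malg) \<Rightarrow> 'm" where i2: "inj i2" by blast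
  obtain i3 :: "('m \<Rightarrow>\<^sub>0 ('w, 'k) malg) \<times> ('m \<Rightarrow>\<^sub>0 ('w, 'k) malg) \<times> ('m \<Rightarrow>\<^sub>0 ('w, 'k) malg) \<Rightarrow> 'm" where i3: "inj i3"
    using inj_prod_into[OF inf inj1 inj2] by blast
  let ?M1 = "tmod i1 lsc FB" and ?M2 = "tmod i2 lsc2 (FB \<times> FB)" and ?M3 = "tmod i3 lsc3 (FB \<times> FB \<times> FB)"
    and ?M0 = "tmod i1 lsc {0}"
  note t1 = tmod_simps[OF i1] and t2 = tmod_simps[OF i2] and t3 = tmod_simps[OF i3]
  have act0: "action_on lsc ({0} :: ('m \<Rightarrow>\<^sub>0 ('w, 'k) malg) set)" by (simp add: action_on_def lsc_simps)
  have act1: "action_on lsc FB" by (auto simp: action_on_def FB_simps lsc_simps)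
  have act2: "action_on lsc2 (FB \<times> FB)"
    by (auto simp: action_on_def FB_simps lsc_simps lsc2_def zero_prod_def)
  have act3: "action_on lsc3 (FB \<times> FB \<times> FB)"
    by (auto simp: action_on_def FB_simps lsc_simps lsc3_def zero_prod_def)
  have p0: "projective R ?M0"
    by (rule projective_tmod[OF i1 act0, where J="{}" and L="\<lambda>p. p"]) (auto simp: additive_id)
  have p1: "projective R ?M1"
    by (rule projective_tmod[OF i1 act1, where J=B and L="\<lambda>p. p"]) (auto simp: additive_id FB_def)
  have p2: "projective R ?M2"
  proof (rule projective_tmod[OF i2 act2, where J="{0, 1} \<times> B" and L="\<lambda>p. (slice 0 p, slice 1 p)"])
    show "additive (\<lambda>p :: nat \<times> 'm \<Rightarrow>\<^sub>0 ('w, 'k) malg. (slice 0 p, slice 1 p))"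
      by (rule additiveI) (simp add: slice_add)
    show "(slice 0 (lsc a p), slice 1 (lsc a p)) = lsc2 a (slice 0 p, slice 1 p)" for a and p :: "nat \<times> 'm \<Rightarrow>\<^sub>0 ('w, 'k) malg"
      by (simp add: slice_lsc lsc2_def)
    show "(\<lambda>p. (slice 0 p, slice 1 p)) ` {p. Poly_Mapping.keys p \<subseteq> {0, 1} \<times> B} = FB \<times> FB"
    proof
      show "(\<lambda>p. (slice 0 p, slice 1 p)) ` {p. Poly_Mapping.keys p \<subseteq> {0, 1} \<times> B} \<subseteq> FB \<times> FB"
        unfolding FB_def using keys_slice by blast
      show "FB \<times> FB \<subseteq> (\<lambda>p. (slice 0 p, slice 1 p)) ` {p. Poly_Mapping.keys p \<subseteq> {0, 1} \<times> B}"
      proof safe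
        fix s t assume st: "s \<in> FB" "t \<in> FB"
        have "Poly_Mapping.keys (embed 0 s + embed 1 t) \<subseteq> {0, 1} \<times> B"
          using keys_add[of "embed 0 s" "embed 1 t"] keys_embed[of s B 0 "{0, 1}"] keys_embed[of t B 1 "{0, 1}"] st
          unfolding FB_def by blast
        then show "(s, t) \<in> (\<lambda>p. (slice 0 p, slice 1 p)) ` {p. Poly_Mapping.keys p \<subseteq> {0, 1} \<times> B}"
          by (intro image_eqI[of _ _ "embed 0 s + embed 1 t"]) (simp_all add: slice_add slice_embed)
      qed
    qed
    show "p = 0" if "(slice 0 p, slice 1 p) = 0" "Poly_Mapping.keys p \<subseteq> {0, 1} \<times> B" for p :: "nat \<times> 'm \<Rightarrow>\<^sub>0 ('w, 'k) malg"
    proof (rule pm_eqI)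
      fix b :: "nat \<times> 'm"
      have "Poly_Mapping.lookup (slice 0 p) (snd b) = 0" "Poly_Mapping.lookup (slice 1 p) (snd b) = 0"
        using that(1) by (simp_all only: zero_prod_def prod.inject lookup_zero)
      then show "Poly_Mapping.lookup p b = Poly_Mapping.lookup 0 b"
        using that(2) by (cases b; cases "b \<in> Poly_Mapping.keys p") (auto simp: in_keys_iff)
    qed
  qed
  have p3: "projective R ?M3"
  proof (rule projective_tmod[OF i3 act3, where J="{0, 1, 2} \<times> B" and L="\<lambda>p. (slice 0 p, slice 1 p, slice 2 p)"])
    show "additive (\<lambda>p :: nat \<times> 'm \<Rightarrow>\<^sub>0 ('w, 'k) malg. (slice 0 p, slice 1 p, slice 2 p))"
      by (rule additiveI) (simp add: slice_add)
    show "(slice 0 (lsc a p), slice 1 (lsc a p), slice 2 (lsc a p)) = lsc3 a (slice 0 p, slice 1 p, slice 2 p)"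
      for a and p :: "nat \<times> 'm \<Rightarrow>\<^sub>0 ('w, 'k) malg"
      by (simp add: slice_lsc lsc3_def)
    show "(\<lambda>p. (slice 0 p, slice 1 p, slice 2 p)) ` {p. Poly_Mapping.keys p \<subseteq> {0, 1, 2} \<times> B} = FB \<times> FB \<times> FB"
    proof
      show "(\<lambda>p. (slice 0 p, slice 1 p, slice 2 p)) ` {p. Poly_Mapping.keys p \<subseteq> {0, 1, 2} \<times> B} \<subseteq> FB \<times> FB \<times> FB"
        unfolding FB_def using keys_slice by blast
      show "FB \<times> FB \<times> FB \<subseteq> (\<lambda>p. (slice 0 p, slice 1 p, slice 2 p)) ` {p. Poly_Mapping.keys p \<subseteq> {0, 1, 2} \<times> B}"
      proof safe
        fix s t r assume st: "s \<in> FB" "t \<in> FB" "r \<in> FB"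
        let ?p = "embed 0 s + (embed 1 t + embed 2 r)"
        have "Poly_Mapping.keys ?p \<subseteq> {0, 1, 2} \<times> B"
          using keys_add[of "embed 0 s" "embed 1 t + embed 2 r"] keys_add[of "embed 1 t" "embed 2 r"]
            keys_embed[of s B 0 "{0, 1, 2}"] keys_embed[of t B 1 "{0, 1, 2}"] keys_embed[of r B 2 "{0, 1, 2}"] st
          unfolding FB_def by blast
        then show "(s, t, r) \<in> (\<lambda>p. (slice 0 p, slice 1 p, slice 2 p)) ` {p. Poly_Mapping.keys p \<subseteq> {0, 1, 2} \<times> B}"
          by (intro image_eqI[of _ _ ?p]) (simp_all add: slice_add slice_embed)
      qed
    qed
    show "p = 0" if "(slice 0 p, slice 1 p, slice 2 p) = 0" "Poly_Mapping.keys p \<subseteq> {0, 1, 2} \<times> B"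
      for p :: "nat \<times> 'm \<Rightarrow>\<^sub>0 ('w, 'k) malg"
    proof (rule pm_eqI)
      fix b :: "nat \<times> 'm"
      have "Poly_Mapping.lookup (slice 0 p) (snd b) = 0" "Poly_Mapping.lookup (slice 1 p) (snd b) = 0"
        "Poly_Mapping.lookup (slice 2 p) (snd b) = 0"
        using that(1) by (simp_all only: zero_prod_def prod.inject lookup_zero)
      then show "Poly_Mapping.lookup p b = Poly_Mapping.lookup 0 b"
        using that(2) by (cases b; cases "b \<in> Poly_Mapping.keys p") (auto simp: in_keys_iff)
    qed
  qed
  have h1: "tmap i3 i1 d1 \<in> module_hom R ?M3 ?M1"
    by (rule tmap_hom[OF i3 i1]) (use d_FB(1) d_add(1) d_lsc(1) in auto)
  have h2: "tmap i3 i3 d2 \<in> module_hom R ?M3 ?M3"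
    by (rule tmap_hom[OF i3 i3]) (use d_FB(2) d_add(2) d_lsc(2) in auto)
  have h3: "tmap i2 i3 d3 \<in> module_hom R ?M2 ?M3"
    by (rule tmap_hom[OF i2 i3]) (use d_FB(3) d_add(3) d_lsc(3) in auto)
  have h4: "tmap i1 i2 d4 \<in> module_hom R ?M1 ?M2"
    by (rule tmap_hom[OF i1 i2]) (use d_FB(4) d_add(4) d_lsc(4) in auto)
  have h5: "tmap i1 i1 (\<lambda>p. p) \<in> module_hom R ?M0 ?M1"
    by (rule tmap_hom[OF i1 i1]) (auto simp: FB_simps)
  have h6: "tmap i1 i1 (\<lambda>p. p) \<in> module_hom R ?M0 ?M0"
    by (rule tmap_hom[OF i1 i1]) auto
  define e where "e m = \<theta> (eact (inv_into UNIV i1 m))" for m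
  have e: "e (i1 p) = \<theta> (eact p)" for p by (simp add: e_def i1)
  have eh: "e \<in> module_hom R ?M1 M"
  proof (rule module_homI)
    fix m assume "m \<in> carrier ?M1"
    then obtain p where m: "m = i1 p" by (auto simp: t1)
    show "e m \<in> carrier M" using \<theta>(1)[OF keys_eact] by (simp add: m e)
    show "e (sm ?M1 a m) = sm M a (e m)" for a
      by (simp add: m t1 e eact_lsc \<theta>(3)[OF keys_eact])
    fix n assume "n \<in> carrier ?M1"
    then obtain q where n: "n = i1 q" by (auto simp: t1)
    show "e (m \<oplus>\<^bsub>?M1\<^esub> n) = e m \<oplus>\<^bsub>M\<^esub> e n"
      by (simp add: m n t1 e eact_add \<theta>(2)[OF keys_eact keys_eact])
  qed
  have "\<theta> (0 + 0) = \<theta> 0 \<oplus>\<^bsub>M\<^esub> \<theta> 0" by (rule \<theta>(2)) simp_all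
  then have \<theta>0: "\<theta> 0 = \<zero>\<^bsub>M\<^esub>"
  proof -
    interpret M: abelian_group M using M by (simp add: left_module_def)
    assume "\<theta> (0 + 0) = \<theta> 0 \<oplus>\<^bsub>M\<^esub> \<theta> 0"
    then show ?thesis using \<theta>(1)[of 0] by simp
  qed
  have e_surj: "e ` carrier ?M1 = carrier M"
  proof
    show "e ` carrier ?M1 \<subseteq> carrier M" using module_hom_simps(1)[OF eh] by blast
    show "carrier M \<subseteq> e ` carrier ?M1"
    proof
      fix m assume "m \<in> carrier M"
      then obtain q where q: "Poly_Mapping.keys q \<subseteq> B" "\<theta> q = m" using \<theta>(4) by blast
      have "tensor 1 q \<in> FB" using keys_tensor[of 1 q] q(1) by (auto simp: FB_def)
      moreover have "e (i1 (tensor 1 q)) = m" using q by (simp add: e eact_tensor act_one)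
      ultimately show "m \<in> e ` carrier ?M1" by (force simp: t1)
    qed
  qed
  have ker_e: "tmap i3 i1 d1 ` carrier ?M3 = {m \<in> carrier ?M1. e m = \<zero>\<^bsub>M\<^esub>}"
  proof -
    have "{m \<in> carrier ?M1. e m = \<zero>\<^bsub>M\<^esub>} = i1 ` {p \<in> FB. eact p = 0}"
      using \<theta>(5)[OF keys_eact] \<theta>0 by (auto simp: t1 e)
    also have "{p \<in> FB. eact p = 0} = d1 ` (FB \<times> FB \<times> FB)"
      using exact_0 d_FB(1) eact_d1 by (auto simp: im1_def)
    finally show ?thesis by (auto simp: t3 tmap_simp[OF i3] image_image)
  qed
  have ker1: "tmap i3 i3 d2 ` carrier ?M3 = {m \<in> carrier ?M3. tmap i3 i1 d1 m = \<zero>\<^bsub>?M1\<^esub>}"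
  proof -
    have "{m \<in> carrier ?M3. tmap i3 i1 d1 m = \<zero>\<^bsub>?M1\<^esub>} = i3 ` {p \<in> FB \<times> FB \<times> FB. d1 p = 0}"
      using injD[OF i1] by (auto simp: t1 t3 tmap_simp[OF i3])
    also have "{p \<in> FB \<times> FB \<times> FB. d1 p = 0} = d2 ` (FB \<times> FB \<times> FB)"
    proof
      show "{p \<in> FB \<times> FB \<times> FB. d1 p = 0} \<subseteq> d2 ` (FB \<times> FB \<times> FB)"
        using exact_1 ex_level3 by (simp add: subset_iff image_iff) blast
      show "d2 ` (FB \<times> FB \<times> FB) \<subseteq> {p \<in> FB \<times> FB \<times> FB. d1 p = 0}"
        using d_FB(2) d1_d2 by blast
    qed
    finally show ?thesis by (simp add: t3 tmap_simp[OF i3] image_image)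
  qed
  have ker2: "tmap i2 i3 d3 ` carrier ?M2 = {m \<in> carrier ?M3. tmap i3 i3 d2 m = \<zero>\<^bsub>?M3\<^esub>}"
  proof -
    have "{m \<in> carrier ?M3. tmap i3 i3 d2 m = \<zero>\<^bsub>?M3\<^esub>} = i3 ` {p \<in> FB \<times> FB \<times> FB. d2 p = 0}"
      by (auto simp: t3 tmap_simp[OF i3] inj_eq[OF i3] simp del: split_paired_All)
    also have "{p \<in> FB \<times> FB \<times> FB. d2 p = 0} = d3 ` (FB \<times> FB)"
    proof
      show "{p \<in> FB \<times> FB \<times> FB. d2 p = 0} \<subseteq> d3 ` (FB \<times> FB)"
        using exact_2 ex_level3 by (simp add: subset_iff image_iff) blast
      show "d3 ` (FB \<times> FB) \<subseteq> {p \<in> FB \<times> FB \<times> FB. d2 p = 0}"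
        using d_FB(3) d2_d3[folded zero_prod_def] by blast
    qed
    finally show ?thesis by (simp add: t2 tmap_simp[OF i2] image_image)
  qed
  have ker3: "tmap i1 i2 d4 ` carrier ?M1 = {m \<in> carrier ?M2. tmap i2 i3 d3 m = \<zero>\<^bsub>?M3\<^esub>}"
  proof -
    have "{m \<in> carrier ?M2. tmap i2 i3 d3 m = \<zero>\<^bsub>?M3\<^esub>} = i2 ` {p \<in> FB \<times> FB. d3 p = 0}"
      by (auto simp: t2 t3 tmap_simp[OF i2] inj_eq[OF i3])
    also have "{p \<in> FB \<times> FB. d3 p = 0} = d4 ` FB"
    proof
      show "{p \<in> FB \<times> FB. d3 p = 0} \<subseteq> d4 ` FB"
        using exact_3 ex_level2 by (simp add: subset_iff image_iff) blast
      show "d4 ` FB \<subseteq> {p \<in> FB \<times> FB. d3 p = 0}"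
        using d_FB(4) d3_d4[folded zero_prod_def] by blast
    qed
    finally show ?thesis by (simp add: t1 tmap_simp[OF i1] image_image)
  qed
  have ker4: "tmap i1 i1 (\<lambda>p. p) ` carrier ?M0 = {m \<in> carrier ?M1. tmap i1 i2 d4 m = \<zero>\<^bsub>?M2\<^esub>}"
  proof -
    have "{m \<in> carrier ?M1. tmap i1 i2 d4 m = \<zero>\<^bsub>?M2\<^esub>} = i1 ` {p \<in> FB. d4 p = 0}"
      by (auto simp: t1 t2 tmap_simp[OF i1] inj_eq[OF i2])
    also have "{p \<in> FB. d4 p = 0} = {0}"
      using d4_inj FB_simps(1) additiveD(2)[OF d_additive(4)] by (auto simp: d4_def zero_prod_def)
    finally show ?thesis by (simp add: t1 tmap_simp[OF i1])
  qed
  have ker5: "tmap i1 i1 (\<lambda>p. p) ` carrier ?M0 = {m \<in> carrier ?M0. tmap i1 i1 (\<lambda>p. p) m = i1 0}"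
    by (auto simp: t1 tmap_simp[OF i1])
  \<comment> \<open>One, three, three, two and one copies of A \<otimes> M in degrees 0 to 4, and
    the zero module from degree 5 on.\<close>
  define P where "P n = (if n = 0 \<or> n = 4 then ?M1 else if n = 1 \<or> n = 2 then ?M3 else if n = 3 then ?M2 else ?M0)" for n :: nat
  define d where "d n = (if n = 0 then tmap i3 i1 d1 else if n = 1 then tmap i3 i3 d2 else
    if n = 2 then tmap i2 i3 d3 else if n = 3 then tmap i1 i2 d4 else tmap i1 i1 (\<lambda>p. p))" for n :: nat
  have "projective_resolution R M P d e"
    unfolding projective_resolution_def
  proof (intro conjI allI)
    show "projective R (P n)" for n by (simp add: P_def p0 p1 p2 p3)
    show "d n \<in> module_hom R (P (Suc n)) (P n)" for n
    proof -
      consider "n = 0" | "n = 1" | "n = 2" | "n = 3" | "n = 4" | "n > 4" by linarith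
      then show ?thesis by cases (simp_all add: P_def d_def h1 h2 h3 h4 h5 h6)
    qed
    show "d (Suc n) ` carrier (P (Suc (Suc n))) = {m \<in> carrier (P (Suc n)). d n m = \<zero>\<^bsub>P n\<^esub>}" for n
    proof -
      consider "n = 0" | "n = 1" | "n = 2" | "n = 3" | "n \<ge> 4" by linarith
      then show ?thesis
      proof cases
        case 5
        then show ?thesis by (simp add: P_def d_def ker5 t1(2))
      qed (simp_all add: P_def d_def ker1 ker2 ker3 ker4)
    qed
  qed (simp_all add: P_def d_def eh e_surj ker_e)
  moreover have "\<forall>n>4. carrier (P n) = {\<zero>\<^bsub>P n\<^esub>}" by (simp add: P_def t1)
  ultimately have "enat 4 \<in> {enat n | n. \<exists>P d e. projective_resolution R M P d e \<and> (\<forall>i>n. carrier (P i) = {\<zero>\<^bsub>P i\<^esub>})}"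
    by blast
  then have "proj_dim R M \<le> enat 4" unfolding proj_dim_def by (rule Inf_lower)
  then show ?thesis by (simp add: numeral_eq_enat)
qed

text \<open>In a free module right annihilators are computed coordinatewise, and a projective module
  is a direct summand of the free module on its own carrier. The cancellation form g a = g b is the
  one in which each step of the descent below produces its equation.\<close>

lemma projective_annihilator:
  fixes P :: "('a, 'm) module"
  assumes P: "projective R P" and inf: "infinite (UNIV :: 'm set)"
    and w: "\<exists>f :: 'w \<Rightarrow> 'm. inj f" and k: "\<exists>g :: 'k \<Rightarrow> 'm. inj g"
    and gh: "\<And>a. g * a = 0 \<Longrightarrow> \<exists>b. a = h * b"
    and ab: "a \<in> carrier P" "b \<in> carrier P" "sm P g a = sm P g b"
  shows "\<exists>q\<in>carrier P. a = b \<oplus>\<^bsub>P\<^esub> sm P h q"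
proof -
  have lm: "left_module R P" using P by (simp add: projective_def)
  interpret P: abelian_group P using lm by (simp add: left_module_def)
  obtain i1 :: "('m \<Rightarrow>\<^sub>0 ('w, 'k) malg) \<Rightarrow> 'm" where i1: "inj i1"
    using inj_poly_mapping_into[OF inf _ inj_malg_into[OF inf w k]] inj_on_id by blast
  note t1 = tmod_simps[OF i1]
  let ?Y = "{p :: 'm \<Rightarrow>\<^sub>0 ('w, 'k) malg. Poly_Mapping.keys p \<subseteq> carrier P}"
  let ?F = "tmod i1 lsc ?Y"
  have Y_add: "p + q \<in> ?Y" if "p \<in> ?Y" "q \<in> ?Y" for p q using keys_add[of p q] that by auto
  have Y_lsc: "lsc r p \<in> ?Y" if "p \<in> ?Y" for p r using keys_lsc[of r p] that by auto
  have F: "left_module R ?F"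
    by (rule left_module_tmod[OF i1]) (use Y_add Y_lsc in \<open>auto simp: action_on_def lsc_simps keys_uminus_eq\<close>)
  have id: "(\<lambda>m. m) \<in> carrier P \<rightarrow> carrier P" by simp
  define \<pi> where "\<pi> m = ext P (\<lambda>m. m) (inv_into UNIV i1 m)" for m
  have \<pi>: "\<pi> (i1 p) = ext P (\<lambda>m. m) p" for p by (simp add: \<pi>_def i1)
  have \<pi>_hom: "\<pi> \<in> module_hom R ?F P"
    by (rule module_homI) (auto simp: t1 \<pi> ext_add[OF lm id] ext_lsc[OF lm id] intro: ext_closed[OF lm id])
  have "\<pi> ` carrier ?F = carrier P"
  proof
    show "\<pi> ` carrier ?F \<subseteq> carrier P" using module_hom_simps(1)[OF \<pi>_hom] by blast
    show "carrier P \<subseteq> \<pi> ` carrier ?F"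
    proof
      fix m assume m: "m \<in> carrier P"
      then have "\<pi> (i1 (Poly_Mapping.single m 1)) = m" by (simp add: \<pi> ext_single[OF lm] sm_one[OF lm])
      moreover have "i1 (Poly_Mapping.single m 1) \<in> carrier ?F" using m by (simp add: t1)
      ultimately show "m \<in> \<pi> ` carrier ?F" by (metis image_eqI)
    qed
  qed
  moreover have "(\<lambda>m. m) \<in> module_hom R P P" by (rule module_homI) auto
  ultimately have "\<exists>s\<in>module_hom R P ?F. \<forall>m\<in>carrier P. \<pi> (s m) = m"
    using P F lm \<pi>_hom unfolding projective_def by blast
  then obtain s where s: "s \<in> module_hom R P ?F" "\<And>m. m \<in> carrier P \<Longrightarrow> \<pi> (s m) = m" by blast
  define c where "c = a \<ominus>\<^bsub>P\<^esub> b"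
  have c: "c \<in> carrier P" "a = b \<oplus>\<^bsub>P\<^esub> c" using ab
    using P.minus_closed[OF ab(1,2)] P.add.m_lcomm[OF ab(2,1) P.a_inv_closed[OF ab(2)]] P.r_neg[OF ab(2)]
    by (simp_all add: c_def P.minus_eq)
  have "sm P g b \<oplus>\<^bsub>P\<^esub> sm P g c = sm P g b"
    using ab c sm_add_right[OF lm ab(2) c(1), of g] by simp
  then have "sm P g c = \<zero>\<^bsub>P\<^esub>"
    using P.add.l_cancel_one[OF sm_closed[OF lm ab(2)] sm_closed[OF lm c(1)]] by simp
  then have "sm ?F g (s c) = \<zero>\<^bsub>?F\<^esub>"
    using module_hom_simps(3)[OF s(1) c(1), of g] module_hom_zero[OF lm F s(1)] by simp
  moreover obtain f where f: "s c = i1 f" "f \<in> ?Y" using module_hom_simps(1)[OF s(1) c(1)] by (auto simp: t1)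
  ultimately have "i1 (lsc g f) = i1 0" by (simp add: t1)
  then have "lsc g f = 0" using injD[OF i1] by blast
  then have "g * Poly_Mapping.lookup f m = 0" for m using lookup_lsc[of g f m] by simp
  then have "\<forall>m. \<exists>b. Poly_Mapping.lookup f m = h * b" using gh by blast
  then obtain r where r: "\<And>m. Poly_Mapping.lookup f m = h * r m" by metis
  define q where "q = (\<Sum>m\<in>Poly_Mapping.keys f. Poly_Mapping.single m (r m))"
  have q: "Poly_Mapping.lookup q m = (if m \<in> Poly_Mapping.keys f then r m else 0)" for m
    by (simp add: q_def lookup_sum lookup_single when_def)
  have "f = lsc h q"
    by (rule pm_eqI) (use r in \<open>auto simp: q in_keys_iff\<close>)
  moreover have "Poly_Mapping.keys q \<subseteq> Poly_Mapping.keys f" using q by (auto simp: in_keys_iff)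
  then have qY: "q \<in> ?Y" using f(2) by auto
  ultimately have "c = sm P h (\<pi> (i1 q))"
    using s(2)[OF c(1)] f(1) ext_lsc[OF lm id, of q h] by (simp add: \<pi>)
  moreover have "\<pi> (i1 q) \<in> carrier P" using qY by (auto simp: \<pi> intro: ext_closed[OF lm id])
  ultimately show ?thesis using c(2) by blast
qed

lemma proj_dim_ge:
  fixes M :: "('a, 'm) module"
  assumes M: "left_module R M" and inf: "infinite (UNIV :: 'm set)"
    and w: "\<exists>f :: 'w \<Rightarrow> 'm. inj f" and k: "\<exists>g :: 'k \<Rightarrow> 'm. inj g"
    and m: "m \<in> carrier M" "m \<noteq> \<zero>\<^bsub>M\<^esub>" "sm M y m = \<zero>\<^bsub>M\<^esub>"
  shows "4 \<le> proj_dim R M"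
proof -
  have "enat 4 \<le> enat n" if res: "projective_resolution R M P d e" and P0: "\<forall>i>n. carrier (P i) = {\<zero>\<^bsub>P i\<^esub>}"
    for n P d e
  proof (rule ccontr)
    assume "\<not> enat 4 \<le> enat n"
    then have P4: "carrier (P 4) = {\<zero>\<^bsub>P 4\<^esub>}" using P0 by simp
    have proj: "\<And>i. projective R (P i)" and dh: "\<And>i. d i \<in> module_hom R (P (Suc i)) (P i)"
      and eh: "e \<in> module_hom R (P 0) M" and sur: "e ` carrier (P 0) = carrier M"
      and ex0: "d 0 ` carrier (P (Suc 0)) = {x \<in> carrier (P 0). e x = \<zero>\<^bsub>M\<^esub>}"
      and ex: "\<And>i. d (Suc i) ` carrier (P (Suc (Suc i))) = {x \<in> carrier (P (Suc i)). d i x = \<zero>\<^bsub>P i\<^esub>}"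
      using res by (auto simp: projective_resolution_def)
    have lm: "\<And>i. left_module R (P i)" using proj by (simp add: projective_def)
    have grp: "\<And>i. abelian_group (P i)" using lm by (simp add: left_module_def)
    note cl = module_hom_simps(1)[OF dh] and smcl = sm_closed[OF lm]
    have dd: "d i (d (Suc i) p) = \<zero>\<^bsub>P i\<^esub>" if "p \<in> carrier (P (Suc (Suc i)))" for i p
      using ex[of i] that by blast
    have d_sm: "d i (sm (P (Suc i)) a p) = sm (P i) a (d i p)" if "p \<in> carrier (P (Suc i))" for i a p
      using module_hom_simps(3)[OF dh that] .
    have zero: "sm (P i) a (sm (P i) b p) = \<zero>\<^bsub>P i\<^esub>" if "a * b = 0" "p \<in> carrier (P i)" for i a b p
      using sm_mult[OF lm that(2), of a b] sm_zero_left[OF lm that(2)] that(1) by simp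
    note ann = projective_annihilator[OF proj inf w k]
    obtain p0 where p0: "p0 \<in> carrier (P 0)" "e p0 = m" using m(1) unfolding sur[symmetric] by blast
    have "sm (P 0) y p0 \<in> {x \<in> carrier (P 0). e x = \<zero>\<^bsub>M\<^esub>}"
      using p0 m(3) module_hom_simps(3)[OF eh p0(1), of y] smcl by simp
    then obtain p1 where p1: "p1 \<in> carrier (P (Suc 0))" "d 0 p1 = sm (P 0) y p0" unfolding ex0[symmetric] by auto
    have "sm (P (Suc 0)) z p1 \<in> {x \<in> carrier (P (Suc 0)). d 0 x = \<zero>\<^bsub>P 0\<^esub>}"
      using p1 smcl zero[OF rels(3) p0(1)] by (simp add: d_sm)
    then obtain p2 where p2: "p2 \<in> carrier (P (Suc (Suc 0)))" "d (Suc 0) p2 = sm (P (Suc 0)) z p1"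
      unfolding ex[symmetric] by auto
    have "sm (P (Suc (Suc 0))) x p2 \<in> {x \<in> carrier (P (Suc (Suc 0))). d (Suc 0) x = \<zero>\<^bsub>P (Suc 0)\<^esub>}"
      using p2 smcl zero[OF rels(2) p1(1)] by (simp add: d_sm)
    then obtain p3 where p3: "p3 \<in> carrier (P (Suc (Suc (Suc 0))))" "d (Suc (Suc 0)) p3 = sm (P (Suc (Suc 0))) x p2"
      unfolding ex[symmetric] by auto
    let ?P3 = "P (Suc (Suc (Suc 0)))" and ?P2 = "P (Suc (Suc 0))" and ?P1 = "P (Suc 0)"
    interpret G0: abelian_group "P 0" by (rule grp)
    interpret G1: abelian_group ?P1 by (rule grp)
    interpret G2: abelian_group ?P2 by (rule grp)
    interpret G3: abelian_group ?P3 by (rule grp)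
    \<comment> \<open>The only place where the shortness of the resolution enters: u p3 is a cycle,
      hence a boundary from P 4 = 0, so it vanishes and the descent can start.\<close>
    have "sm ?P3 u p3 \<in> {x \<in> carrier ?P3. d (Suc (Suc 0)) x = \<zero>\<^bsub>?P2\<^esub>}"
      using p3 smcl zero[OF rels(1) p2(1)] by (simp add: d_sm)
    then have "sm ?P3 u p3 \<in> d 3 ` carrier (P 4)" unfolding ex[symmetric] by (simp add: eval_nat_numeral)
    moreover have "d 3 \<zero>\<^bsub>P 4\<^esub> = \<zero>\<^bsub>?P3\<^esub>"
      using module_hom_zero[OF lm lm dh[of 3]] by (simp add: eval_nat_numeral)
    ultimately have "sm ?P3 u p3 = sm ?P3 u \<zero>\<^bsub>?P3\<^esub>" using P4 sm_zero_right[OF lm] by simp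
    then obtain q3 where q3: "q3 \<in> carrier ?P3" "p3 = sm ?P3 x q3"
      using ann[OF rann_u p3(1) G3.zero_closed] smcl by auto
    have "sm ?P2 x p2 = sm ?P2 x (d (Suc (Suc 0)) q3)" using p3(2) q3 by (simp add: d_sm)
    then obtain q2 where q2: "q2 \<in> carrier ?P2" "p2 = d (Suc (Suc 0)) q3 \<oplus>\<^bsub>?P2\<^esub> sm ?P2 z q2"
      using ann[OF rann_x p2(1) cl[OF q3(1)]] by auto
    have "d (Suc 0) p2 = sm ?P1 z (d (Suc 0) q2)"
      using q2 q3 cl smcl dd[of q3 "Suc 0"] by (simp add: module_hom_simps(2)[OF dh] d_sm)
    then have "sm ?P1 z p1 = sm ?P1 z (d (Suc 0) q2)" using p2(2) by simp
    then obtain q1 where q1: "q1 \<in> carrier ?P1" "p1 = d (Suc 0) q2 \<oplus>\<^bsub>?P1\<^esub> sm ?P1 y q1"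
      using ann[OF rann_z p1(1) cl[OF q2(1)]] by auto
    have "d 0 p1 = sm (P 0) y (d 0 q1)"
      using q1 q2 cl smcl dd[of q2 0] by (simp add: module_hom_simps(2)[OF dh] d_sm)
    then have y_eq: "sm (P 0) y p0 = sm (P 0) y (d 0 q1)" using p1(2) by simp
    \<comment> \<open>Left multiplication by y is injective, so the cancellation law applies with h
      = 0.\<close>
    have "\<exists>b. a = 0 * b" if "y * a = 0" for a using rann_y[OF that] by simp
    from ann[OF this p0(1) cl[OF q1(1)] y_eq]
    have "p0 = d 0 q1" using sm_zero_left[OF lm] cl[OF q1(1)] by auto
    then have "e p0 = \<zero>\<^bsub>M\<^esub>" using ex0 q1(1) by blast
    then show False using p0(2) m(2) by simp
  qed
  then have "enat 4 \<le> proj_dim R M" unfolding proj_dim_def by (intro Inf_greatest) auto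
  then show ?thesis by (simp add: numeral_eq_enat)
qed

theorem gldim_eq_4:
  assumes inf: "infinite (UNIV :: 'm set)" and w: "\<exists>f :: 'w \<Rightarrow> 'm. inj f" and k: "\<exists>g :: 'k \<Rightarrow> 'm. inj g"
  shows "gldim TYPE('m) R = 4"
proof (rule antisym)
  show "gldim TYPE('m) R \<le> 4"
    unfolding gldim_def using proj_dim_le[OF _ inf w k] by (intro SUP_least) auto
  obtain \<kappa> :: "'k \<Rightarrow> 'm" where \<kappa>: "inj \<kappa>" using k by blast
  note t = tmod_simps[OF \<kappa>]
  \<comment> \<open>The trivial module k, with A acting through the augmentation; y kills it because
    y has degree 1.\<close>
  let ?sc = "\<lambda>(a :: ('w, 'k) malg) c. coeff a zone * c"
  let ?M = "tmod \<kappa> ?sc UNIV"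
  have "coeff (1 :: ('w, 'k) malg) zone = 1" by (simp add: mon_zone_one[symmetric])
  then have M: "left_module R ?M"
    by (intro left_module_tmod[OF \<kappa>]) (simp add: action_on_def lookup_add coeff_mult_zone algebra_simps)
  have "coeff y zone = 0" using hom_pos_zone[OF xyz_hom(2)] by simp
  then have "4 \<le> proj_dim R ?M"
    using injD[OF \<kappa>, of 1 0] by (intro proj_dim_ge[OF M inf w k, of "\<kappa> 1"]) (auto simp: t)
  also have "\<dots> \<le> gldim TYPE('m) R"
    unfolding gldim_def using M by (intro SUP_upper) auto
  finally show "4 \<le> gldim TYPE('m) R" .
qed

end

section \<open>Normal words\<close>

text \<open>
  \<open>lm a w\<close> is the normal form of \<open>a w\<close>, for a letter \<open>a\<close> and a normal word \<open>w\<close>; the assumption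
  \<open>lm_act\<close> is confluence.
\<close>

locale rewriting =
  fixes lm :: "'g \<Rightarrow> 'g list \<Rightarrow> 'g list option"
begin

definition act :: "'g list \<Rightarrow> 'g list \<Rightarrow> 'g list option"
  where "act v w = foldr (\<lambda>a r. Option.bind r (lm a)) v (Some w)"

lemma act_simps [simp]: "act [] w = Some w" "act (a # v) w = Option.bind (act v w) (lm a)"
  by (simp_all add: act_def)

primrec normal :: "'g list \<Rightarrow> bool"
  where "normal [] = True" | "normal (a # w) = (normal w \<and> lm a w = Some (a # w))"

lemma act_normal: "normal (l @ m) \<Longrightarrow> act l m = Some (l @ m)"
  by (induction l) auto

end

locale confluent_rewriting = rewriting lm for lm :: "'g \<Rightarrow> 'g list \<Rightarrow> 'g list option" +
  assumes lm_length: "lm a w = Some v \<Longrightarrow> length v = Suc (length w)"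
    and lm_normal: "normal w \<Longrightarrow> lm a w = Some v \<Longrightarrow> normal v"
    and lm_act: "normal w \<Longrightarrow> normal t \<Longrightarrow> Option.bind (lm a w) (\<lambda>v. act v t) = Option.bind (act w t) (lm a)"
    and lm_letter: "lm a [] = Some [a]"
begin

lemma act_is_normal: "normal w \<Longrightarrow> act v w = Some u \<Longrightarrow> normal u"
proof (induction v arbitrary: u)
  case (Cons a v)
  then show ?case by (auto simp: Option.bind_eq_Some_conv intro: lm_normal)
qed simp

lemma act_length: "act v w = Some u \<Longrightarrow> length u = length v + length w"
proof (induction v arbitrary: u)
  case (Cons a v)
  then show ?case by (auto simp: Option.bind_eq_Some_conv dest!: lm_length)
qed simp

text \<open>Confluence is assumed for one letter on the left and propagates to words by induction;
  the result is associativity of the product of normal words.\<close>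

lemma act_assoc:
  assumes "normal v" "normal w"
  shows "Option.bind (act u v) (\<lambda>p. act p w) = Option.bind (act v w) (act u)"
proof (induction u)
  case Nil
  then show ?case by (cases "act v w") simp_all
next
  case (Cons a u)
  show ?case
  proof (cases "act u v")
    case None
    then show ?thesis using Cons by (cases "act v w") simp_all
  next
    case (Some p)
    then have "normal p" using act_is_normal assms(1) by blast
    then show ?thesis using lm_act[of p w a] assms(2) Some Cons by (cases "act v w") simp_all
  qed
qed

end

locale word_algebra = confluent_rewriting lm
  for lm :: "'g \<Rightarrow> 'g list \<Rightarrow> 'g list option" +
  fixes Rep :: "'w::zmonoid \<Rightarrow> 'g list" and Abs :: "'g list \<Rightarrow> 'w" and dummy :: "'k::field itself"
  assumes td: "type_definition Rep Abs {w. normal w}"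
    and zmult_words: "zmult a b = map_option Abs (act (Rep a) (Rep b))"
    and zdeg_word: "zdeg a = length (Rep a)"
begin

lemma Rep_normal [simp]: "normal (Rep w)" and Abs_Rep [simp]: "Abs (Rep w) = w"
  and Rep_Abs: "normal l \<Longrightarrow> Rep (Abs l) = l"
  using type_definition.Rep[OF td, of w] type_definition.Rep_inverse[OF td, of w]
    type_definition.Abs_inverse[OF td, of l] by auto

definition W :: "'g list \<Rightarrow> 'k \<Rightarrow> ('w, 'k) malg" where "W l c = mon (Abs l) c"
definition cl :: "('w, 'k) malg \<Rightarrow> 'g list \<Rightarrow> 'k" where "cl f l = coeff f (Abs l)"
definition lt :: "'g \<Rightarrow> ('w, 'k) malg" where "lt a = W [a] 1"

lemma cl_simps: "cl 0 l = 0" "cl (f + g) l = cl f l + cl g l" "cl (f - g) l = cl f l - cl g l"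
  "cl (- f) l = - cl f l"
  by (simp_all add: cl_def lookup_add lookup_minus)

lemma cl_W: "normal l \<Longrightarrow> normal m \<Longrightarrow> cl (W l c) m = (if l = m then c else 0)"
  using Rep_Abs by (auto simp: cl_def W_def lookup_single when_def) metis

lemma cl_eqI: "(\<And>l. normal l \<Longrightarrow> cl f l = cl g l) \<Longrightarrow> f = g"
  unfolding malg_eq_iff cl_def by (intro pm_eqI) (metis Abs_Rep Rep_normal)

lemma normal_letter: "normal [a]" by (simp add: lm_letter)

lemma W_induct [consumes 1, case_names zero add W]:
  assumes "\<And>l. normal l \<Longrightarrow> cl f l \<noteq> 0 \<Longrightarrow> Q l" "P 0" "\<And>p q. P p \<Longrightarrow> P q \<Longrightarrow> P (p + q)"
    and "\<And>l c. normal l \<Longrightarrow> Q l \<Longrightarrow> P (W l c)"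
  shows "P f"
proof (rule malg_induct)
  show "supp f \<subseteq> {w. Q (Rep w)}" using assms(1) by (auto simp: cl_def in_keys_iff)
  show "P (mon w c)" if "w \<in> {w. Q (Rep w)}" for w c
    using assms(4)[of "Rep w" c] that by (simp add: W_def)
qed (use assms in auto)

lemma W_induct_all [case_names zero add W]:
  assumes "P 0" "\<And>p q. P p \<Longrightarrow> P q \<Longrightarrow> P (p + q)" "\<And>l c. normal l \<Longrightarrow> P (W l c)"
  shows "P f"
  by (rule W_induct[where Q="\<lambda>_. True"]) (use assms in auto)

lemma hom_iff: "f \<in> hom n \<longleftrightarrow> (\<forall>l. normal l \<longrightarrow> cl f l \<noteq> 0 \<longrightarrow> length l = n)"
proof
  show "\<forall>l. normal l \<longrightarrow> cl f l \<noteq> 0 \<longrightarrow> length l = n" if "f \<in> hom n"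
    using that unfolding hom_def cl_def zdeg_word by (metis (mono_tags) Rep_Abs in_keys_iff mem_Collect_eq)
  show "f \<in> hom n" if *: "\<forall>l. normal l \<longrightarrow> cl f l \<noteq> 0 \<longrightarrow> length l = n"
    unfolding hom_def zdeg_word
  proof safe
    fix w assume "w \<in> supp f"
    then show "length (Rep w) = n" using *[rule_format, of "Rep w"] by (simp add: cl_def in_keys_iff)
  qed
qed

lemma W_hom: "normal l \<Longrightarrow> W l c \<in> hom (length l)"
  by (simp add: W_def zdeg_word Rep_Abs hom_mon)

lemma lt_hom: "lt a \<in> hom 1"
  using W_hom[OF normal_letter, of a 1] by (simp add: lt_def)

lemma W_times: "normal l \<Longrightarrow> normal m \<Longrightarrow> W l c * W m d = (case act l m of None \<Rightarrow> 0 | Some v \<Rightarrow> W v (c * d))"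
  by (simp add: W_def mon_times zmult_words Rep_Abs zmon_def split: option.splits)

lemma lt_times_W: "normal l \<Longrightarrow> lt a * W l c = (case lm a l of None \<Rightarrow> 0 | Some v \<Rightarrow> W v c)"
  unfolding lt_def by (subst W_times) (auto simp: lm_letter split: option.splits)

lemma W_Cons: "normal (a # l) \<Longrightarrow> W (a # l) c = lt a * W l c"
  by (simp add: lt_times_W)

lemma W_snoc: "normal (l @ [a]) \<Longrightarrow> normal l \<Longrightarrow> W (l @ [a]) c = W l c * lt a"
  unfolding lt_def by (subst W_times) (auto simp: act_normal lm_letter)

lemma starts_multiple:
  assumes "\<And>l. normal l \<Longrightarrow> cl f l \<noteq> 0 \<Longrightarrow> \<exists>w. l = a # w"
  shows "\<exists>b. f = lt a * b"
proof (rule W_induct[where f=f and Q="\<lambda>l. \<exists>w. l = a # w" and P="\<lambda>f. \<exists>b. f = lt a * b"])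
  show "\<exists>b. 0 = lt a * b" by (intro exI[of _ 0]) simp
  show "\<exists>b. p + q = lt a * b" if "\<exists>b. p = lt a * b" "\<exists>b. q = lt a * b" for p q
    using that by (metis distrib_left)
  show "\<exists>b. W l c = lt a * b" if "normal l" "\<exists>w. l = a # w" for l c
    using that W_Cons by auto
qed (use assms in auto)

lemma hom_Suc_decompose:
  assumes "f \<in> hom (Suc n)"
  shows "\<And>l. normal l \<Longrightarrow> cl f l \<noteq> 0 \<Longrightarrow> l \<noteq> []"
  using assms by (auto simp: hom_iff)

lemma lt_neq: "a \<noteq> b \<Longrightarrow> lt a \<noteq> lt b"
  using cl_W[OF normal_letter normal_letter, of a 1 b] cl_W[OF normal_letter normal_letter, of b 1 b]
  by (auto simp: lt_def)

lemma card_degree_1: "card {w :: 'w. zdeg w = 1} = card (UNIV :: 'g set)"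
proof -
  have "{w :: 'w. zdeg w = 1} = (\<lambda>a. Abs [a]) ` UNIV"
  proof safe
    fix w :: 'w assume "zdeg w = 1"
    then obtain a where "Rep w = [a]" by (auto simp: zdeg_word length_Suc_conv)
    then have "w = Abs [a]" by (metis Abs_Rep)
    then show "w \<in> (\<lambda>a. Abs [a]) ` UNIV" by blast
  qed (simp add: zdeg_word Rep_Abs normal_letter lm_letter)
  moreover have "inj (\<lambda>a. Abs [a])"
    by (rule injI) (metis Rep_Abs normal_letter list.inject)
  ultimately show ?thesis by (simp add: card_image)
qed

end

lemma UNIV_generator: "(UNIV :: generator set) = {gx, gy, gz}"
  using generator.exhaust by auto

instance generator :: finite
  by standard (simp add: UNIV_generator)

lemma card_generator: "card (UNIV :: generator set) = 3"
  by (simp add: UNIV_generator)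

subsection \<open>The algebra of the theorem\<close>

text \<open>
  After replacing \<open>y\<close> by \<open>- y\<close> the relations become \<open>y x = x x\<close>, \<open>x z = 0\<close>, \<open>z y = 0\<close>; the reduced
  Groebner basis contains in addition \<open>z x x = 0\<close>.
\<close>

fun lmA :: "generator \<Rightarrow> generator list \<Rightarrow> generator list option"
  where
    "lmA gx (gz # w) = None"
  | "lmA gx w = Some (gx # w)"
  | "lmA gy (gx # w) = Some (gx # gx # w)"
  | "lmA gy w = Some (gy # w)"
  | "lmA gz (gy # w) = None"
  | "lmA gz (gx # gx # w) = None"
  | "lmA gz w = Some (gz # w)"

lemma lmA_gx: "lmA gx w = (if w \<noteq> [] \<and> hd w = gz then None else Some (gx # w))"
  by (cases "(gx, w)" rule: lmA.cases) auto

lemma lmA_gy: "lmA gy w = (if w \<noteq> [] \<and> hd w = gx then Some (gx # w) else Some (gy # w))"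
  by (cases "(gy, w)" rule: lmA.cases) auto

lemma lmA_gz: "lmA gz w = (if w \<noteq> [] \<and> (hd w = gy \<or> hd w = gx \<and> tl w \<noteq> [] \<and> hd (tl w) = gx) then None else Some (gz # w))"
  by (cases "(gz, w)" rule: lmA.cases) auto

lemmas lmA_simps = lmA_gx lmA_gy lmA_gz

text \<open>If no rule applies to a w, then \<open>lm_act\<close> is the recursion for
  \<open>act\<close>. What remains are the left-hand sides of the four rules, where it suffices to
  look at the leading letters of the reduced words.\<close>

interpretation A: confluent_rewriting lmA
proof
  fix a :: generator and w v t :: "generator list"
  show "length v = Suc (length w)" if "lmA a w = Some v"
    using that by (cases a) (auto simp: lmA_simps split: if_splits)
  show "rewriting.normal lmA v" if "rewriting.normal lmA w" "lmA a w = Some v"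
    using that by (cases a; cases w) (auto simp: lmA_simps rewriting.normal.simps split: if_splits)
  show "lmA a [] = Some [a]" by (cases a) auto
  show "Option.bind (lmA a w) (\<lambda>v. rewriting.act lmA v t) = Option.bind (rewriting.act lmA w t) (lmA a)"
  proof (cases "lmA a w = Some (a # w)")
    case True
    then show ?thesis by (simp add: rewriting.act_simps)
  next
    case False
    then consider w' where "a = gx" "w = gz # w'" | w' where "a = gy" "w = gx # w'"
      | w' where "a = gz" "w = gy # w'" | w' where "a = gz" "w = gx # gx # w'"
      by (cases "(a, w)" rule: lmA.cases) auto
    then show ?thesis
    proof cases
      case (1 w')
      then show ?thesis
        by (cases "rewriting.act lmA w' t") (auto simp: rewriting.act_simps lmA_simps)
    next
      case (2 w')
      then show ?thesis
        by (cases "rewriting.act lmA w' t") (auto simp: rewriting.act_simps lmA_simps)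
    next
      case (3 w')
      then show ?thesis
        by (cases "rewriting.act lmA w' t") (auto simp: rewriting.act_simps lmA_simps)
    next
      case (4 w')
      then show ?thesis
        by (cases "rewriting.act lmA w' t") (auto simp: rewriting.act_simps lmA_simps)
    qed
  qed
qed

typedef wordA = "{w. A.normal w}"
  by (rule exI[of _ "[]"]) simp


lemma finite_words_length_1: "finite {w :: generator list. length w = Suc 0}"
  using finite_lists_length_eq[of "UNIV :: generator set" 1] by simp

instantiation wordA :: zmonoid
begin

definition "zmult a b = map_option Abs_wordA (A.act (Rep_wordA a) (Rep_wordA b))"
definition "zone = Abs_wordA []"
definition "zdeg a = length (Rep_wordA a)"

lemma Rep_zone: "Rep_wordA zone = []"
  by (simp add: zone_wordA_def Abs_wordA_inverse)

lemma Rep_zmult: "map_option Rep_wordA (zmult a b) = A.act (Rep_wordA a) (Rep_wordA b)"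
  using A.act_is_normal[of "Rep_wordA b" "Rep_wordA a"] Rep_wordA[of b]
  by (cases "A.act (Rep_wordA a) (Rep_wordA b)") (auto simp: zmult_wordA_def Abs_wordA_inverse)

lemma zmult_None_iff: "zmult a b = None \<longleftrightarrow> A.act (Rep_wordA a) (Rep_wordA b) = None"
  by (simp add: zmult_wordA_def)

lemma zmult_SomeD: "zmult a b = Some c \<Longrightarrow> A.act (Rep_wordA a) (Rep_wordA b) = Some (Rep_wordA c)"
  using Rep_zmult[of a b] by simp

instance
proof
  fix a b c :: wordA
  have nb: "A.normal (Rep_wordA b)" "A.normal (Rep_wordA c)" using Rep_wordA by auto
  have "map_option Rep_wordA (Option.bind (zmult a b) (\<lambda>u. zmult u c)) =
      Option.bind (A.act (Rep_wordA a) (Rep_wordA b)) (\<lambda>p. A.act p (Rep_wordA c))"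
    by (cases "zmult a b") (simp_all add: Rep_zmult zmult_SomeD zmult_None_iff[THEN iffD1])
  also have "\<dots> = Option.bind (A.act (Rep_wordA b) (Rep_wordA c)) (A.act (Rep_wordA a))"
    by (rule A.act_assoc[OF nb])
  also have "\<dots> = map_option Rep_wordA (Option.bind (zmult b c) (zmult a))"
    by (cases "zmult b c") (simp_all add: Rep_zmult zmult_SomeD zmult_None_iff[THEN iffD1])
  finally show "Option.bind (zmult a b) (\<lambda>u. zmult u c) = Option.bind (zmult b c) (zmult a)"
    using option.inj_map[of Rep_wordA] Rep_wordA_inject by (auto simp: inj_def)
  show "zmult zone a = Some a" by (simp add: zmult_wordA_def Rep_zone Rep_wordA_inverse)
  show "zmult a zone = Some a"
    using A.act_normal[of "Rep_wordA a" "[]"] Rep_wordA[of a] by (simp add: zmult_wordA_def Rep_zone Rep_wordA_inverse)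
  show "zdeg c = zdeg a + zdeg b" if "zmult a b = Some c"
    using A.act_length[OF zmult_SomeD[OF that]] by (simp add: zdeg_wordA_def)
  show "zdeg a = 0 \<longleftrightarrow> a = zone"
    by (simp add: zdeg_wordA_def Rep_wordA_inject[symmetric] Rep_zone)
  have "Rep_wordA ` {a. zdeg a = Suc 0} \<subseteq> {w. length w = Suc 0}" by (auto simp: zdeg_wordA_def)
  then show "finite {a :: wordA. zdeg a = Suc 0}"
    using finite_words_length_1 by (meson Rep_wordA_inject finite_imageD finite_subset inj_onI)
qed

end

interpretation wA: word_algebra lmA Rep_wordA Abs_wordA "TYPE('k::field)"
  using Rep_wordA
  by unfold_locales
    (simp_all add: Rep_wordA_inverse Abs_wordA_inverse zmult_wordA_def zone_wordA_def zdeg_wordA_def)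

subsection \<open>The dual algebra\<close>

text \<open>
  The quadratic dual has generators \<open>u, x, z\<close> (written \<open>gx, gy, gz\<close>) and relations
  \<open>u u = u z = x u = x x = z z = 0\<close>, \<open>z u = z x\<close>, up to the sign of \<open>u\<close>.
\<close>

fun lmB :: "generator \<Rightarrow> generator list \<Rightarrow> generator list option"
  where
    "lmB gx (gx # w) = None"
  | "lmB gx (gz # w) = None"
  | "lmB gx w = Some (gx # w)"
  | "lmB gy (gx # w) = None"
  | "lmB gy (gy # w) = None"
  | "lmB gy w = Some (gy # w)"
  | "lmB gz [] = Some [gz]"
  | "lmB gz [gx] = Some [gz, gy]"
  | "lmB gz [gy] = Some [gz, gy]"
  | "lmB gz w = None"

lemma lmB_gx: "lmB gx w = (if w \<noteq> [] \<and> (hd w = gx \<or> hd w = gz) then None else Some (gx # w))"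
  by (cases "(gx, w)" rule: lmB.cases) auto

lemma lmB_gy: "lmB gy w = (if w \<noteq> [] \<and> (hd w = gx \<or> hd w = gy) then None else Some (gy # w))"
  by (cases "(gy, w)" rule: lmB.cases) auto

lemma lmB_gz: "lmB gz w = (if w = [] then Some [gz] else if w = [gx] \<or> w = [gy] then Some [gz, gy] else None)"
  by (cases "(gz, w)" rule: lmB.cases) auto

lemmas lmB_simps = lmB_gx lmB_gy lmB_gz

lemma bind_lmB_not_Nil: "Option.bind r (lmB a) = Some q \<Longrightarrow> q \<noteq> []"
  by (cases r; cases a) (auto simp: lmB_simps split: if_splits)

interpretation B: confluent_rewriting lmB
proof
  fix a :: generator and w v t :: "generator list"
  show "length v = Suc (length w)" if "lmB a w = Some v"
    using that by (cases a) (auto simp: lmB_simps split: if_splits)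
  show "rewriting.normal lmB v" if "rewriting.normal lmB w" "lmB a w = Some v"
    using that by (cases a) (auto simp: lmB_simps rewriting.normal.simps split: if_splits)
  show "lmB a [] = Some [a]" by (cases a) auto
  show "Option.bind (lmB a w) (\<lambda>v. rewriting.act lmB v t) = Option.bind (rewriting.act lmB w t) (lmB a)"
    if "rewriting.normal lmB w"
  proof (cases "lmB a w = Some (a # w)")
    case True
    then show ?thesis by (simp add: rewriting.act_simps)
  next
    case False
    then consider b w' where "a = gx" "w = b # w'" "b = gx \<or> b = gz"
      | b w' where "a = gy" "w = b # w'" "b = gx \<or> b = gy"
      | "a = gz" "w = [gx]" | w' where "a = gz" "w = gz # w'"
      | b c w' where "a = gz" "w = b # c # w'" "b \<noteq> gz"
      using False
    proof -
      assume "lmB a w \<noteq> Some (a # w)"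
      then have w: "w = hd w # tl w" by (cases a; cases w) (auto simp: lmB_simps)
      show thesis
      proof (cases a)
        case gx
        then have "hd w = gx \<or> hd w = gz" using \<open>lmB a w \<noteq> Some (a # w)\<close> by (auto simp: lmB_simps split: if_splits)
        then show ?thesis using that(1) gx w by blast
      next
        case gy
        then have "hd w = gx \<or> hd w = gy" using \<open>lmB a w \<noteq> Some (a # w)\<close> by (auto simp: lmB_simps split: if_splits)
        then show ?thesis using that(2) gy w by blast
      next
        case gz
        show ?thesis
        proof (cases "tl w")
          case Nil
          then have "hd w \<noteq> gy" using gz \<open>lmB a w \<noteq> Some (a # w)\<close> w by (cases w) auto
          then show ?thesis using that(3,4) gz w Nil by (cases "hd w") auto
        next
          case (Cons c w')
          then show ?thesis using that(4,5) gz w by (cases "hd w = gz") auto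
        qed
      qed
    qed
    then show ?thesis
    proof cases
      case (1 b w')
      then show ?thesis
        by (cases "rewriting.act lmB w' t") (auto simp: rewriting.act_simps lmB_simps)
    next
      case (2 b w')
      then show ?thesis
        by (cases "rewriting.act lmB w' t") (auto simp: rewriting.act_simps lmB_simps)
    next
      case 3
      then show ?thesis
        by (cases t) (auto simp: rewriting.act_simps lmB_simps)
    next
      case (4 w')
      then show ?thesis
        by (cases "rewriting.act lmB w' t") (auto simp: rewriting.act_simps lmB_simps)
    next
      \<comment> \<open>Here z kills every word of length at least 2, so both sides vanish as soon
        as q is seen to be that long: c produces a nonempty word and b lengthens it.\<close>
      case (5 b c w')
      have "lmB gz q = None" if bb: "Option.bind (Option.bind r (lmB c)) (lmB b) = Some q" for r q
      proof -
        obtain q' where q': "Option.bind r (lmB c) = Some q'" "lmB b q' = Some q"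
          using bb by (cases "Option.bind r (lmB c)") auto
        have "q' \<noteq> []" by (rule bind_lmB_not_Nil[OF q'(1)])
        then have "length q \<ge> 2" using q'(2) 5(3)
          by (cases b; cases q') (auto simp: lmB_simps split: if_splits)
        then show ?thesis by (auto simp: lmB_gz)
      qed
      then have "Option.bind (rewriting.act lmB w t) (lmB a) = None"
        by (cases "rewriting.act lmB w t") (auto simp: 5 rewriting.act_simps)
      moreover have "lmB a w = None" by (simp add: 5 lmB_gz)
      ultimately show ?thesis by simp
    qed
  qed
qed

typedef wordB = "{w. B.normal w}"
  by (rule exI[of _ "[]"]) simp

instantiation wordB :: zmonoid
begin

definition "zmult a b = map_option Abs_wordB (B.act (Rep_wordB a) (Rep_wordB b))"
definition "zone = Abs_wordB []"
definition "zdeg a = length (Rep_wordB a)"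

lemma Rep_zoneB: "Rep_wordB zone = []"
  by (simp add: zone_wordB_def Abs_wordB_inverse)

lemma Rep_zmultB: "map_option Rep_wordB (zmult a b) = B.act (Rep_wordB a) (Rep_wordB b)"
  using B.act_is_normal[of "Rep_wordB b" "Rep_wordB a"] Rep_wordB[of b]
  by (cases "B.act (Rep_wordB a) (Rep_wordB b)") (auto simp: zmult_wordB_def Abs_wordB_inverse)

lemma zmultB_None_iff: "zmult a b = None \<longleftrightarrow> B.act (Rep_wordB a) (Rep_wordB b) = None"
  by (simp add: zmult_wordB_def)

lemma zmultB_SomeD: "zmult a b = Some c \<Longrightarrow> B.act (Rep_wordB a) (Rep_wordB b) = Some (Rep_wordB c)"
  using Rep_zmultB[of a b] by simp

instance
proof
  fix a b c :: wordB
  have nb: "B.normal (Rep_wordB b)" "B.normal (Rep_wordB c)" using Rep_wordB by auto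
  have "map_option Rep_wordB (Option.bind (zmult a b) (\<lambda>u. zmult u c)) =
      Option.bind (B.act (Rep_wordB a) (Rep_wordB b)) (\<lambda>p. B.act p (Rep_wordB c))"
    by (cases "zmult a b") (simp_all add: Rep_zmultB zmultB_SomeD zmultB_None_iff[THEN iffD1])
  also have "\<dots> = Option.bind (B.act (Rep_wordB b) (Rep_wordB c)) (B.act (Rep_wordB a))"
    by (rule B.act_assoc[OF nb])
  also have "\<dots> = map_option Rep_wordB (Option.bind (zmult b c) (zmult a))"
    by (cases "zmult b c") (simp_all add: Rep_zmultB zmultB_SomeD zmultB_None_iff[THEN iffD1])
  finally show "Option.bind (zmult a b) (\<lambda>u. zmult u c) = Option.bind (zmult b c) (zmult a)"
    using option.inj_map[of Rep_wordB] Rep_wordB_inject by (auto simp: inj_def)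
  show "zmult zone a = Some a" by (simp add: zmult_wordB_def Rep_zoneB Rep_wordB_inverse)
  show "zmult a zone = Some a"
    using B.act_normal[of "Rep_wordB a" "[]"] Rep_wordB[of a] by (simp add: zmult_wordB_def Rep_zoneB Rep_wordB_inverse)
  show "zdeg c = zdeg a + zdeg b" if "zmult a b = Some c"
    using B.act_length[OF zmultB_SomeD[OF that]] by (simp add: zdeg_wordB_def)
  show "zdeg a = 0 \<longleftrightarrow> a = zone"
    by (simp add: zdeg_wordB_def Rep_wordB_inject[symmetric] Rep_zoneB)
  have "Rep_wordB ` {a. zdeg a = Suc 0} \<subseteq> {w. length w = Suc 0}" by (auto simp: zdeg_wordB_def)
  then show "finite {a :: wordB. zdeg a = Suc 0}"
    using finite_words_length_1 by (meson Rep_wordB_inject finite_imageD finite_subset inj_onI)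
qed

end

interpretation wB: word_algebra lmB Rep_wordB Abs_wordB "TYPE('k::field)"
  using Rep_wordB
  by unfold_locales
    (simp_all add: Rep_wordB_inverse Abs_wordB_inverse zmult_wordB_def zone_wordB_def zdeg_wordB_def)

section \<open>Annihilators\<close>

context word_algebra
begin

text \<open>Left multiplication by a letter sends normal words to normal words or to 0, so the
  coefficient of v in the product comes from the single word that is sent to v.\<close>

lemma cl_lt_times:
  assumes "normal v" "normal w" "\<And>l. normal l \<Longrightarrow> lm a l = Some v \<longleftrightarrow> l = w"
  shows "cl (lt a * f) v = cl f w"
proof (induction f rule: W_induct_all)
  case (W l c)
  then show ?case
    using assms(3)[of l] lm_normal[of l a] assms(1,2)
    by (cases "lm a l") (auto simp: lt_times_W cl_W cl_simps)
qed (simp_all add: cl_simps distrib_left)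

lemma cl_lt_times_0:
  assumes "normal v" "\<And>l. normal l \<Longrightarrow> lm a l \<noteq> Some v"
  shows "cl (lt a * f) v = 0"
proof (induction f rule: W_induct_all)
  case (W l c)
  then show ?case
    using assms(2)[of l] lm_normal[of l a] assms(1)
    by (cases "lm a l") (auto simp: lt_times_W cl_W cl_simps)
qed (simp_all add: cl_simps distrib_left)

text \<open>\<open>lm\<close> describes left multiplication only; for the right side it must be
  known that appending a gives a normal word or 0. \<open>Q\<close> restricts to words with this
  property, which for x can fail after a final y, since l y x = l x x.\<close>

lemma cl_times_lt:
  assumes "\<And>l. normal l \<Longrightarrow> cl f l \<noteq> 0 \<Longrightarrow> Q l"
    and "\<And>l c. normal l \<Longrightarrow> Q l \<Longrightarrow> normal (l @ [a]) \<or> W l c * lt a = 0"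
    and "normal m" "normal (m @ [a])"
  shows "cl (f * lt a) (m @ [a]) = cl f m"
proof (rule W_induct[where f=f and Q=Q and P="\<lambda>f. cl (f * lt a) (m @ [a]) = cl f m"])
  fix l c assume l: "normal l" "Q l"
  show "cl (W l c * lt a) (m @ [a]) = cl (W l c) m"
  proof (cases "normal (l @ [a])")
    case True
    then show ?thesis using l assms(3,4) by (simp add: W_snoc[symmetric] cl_W)
  next
    case False
    then have "W l c * lt a = 0" "l \<noteq> m" using assms(2)[OF l, of c] assms(4) by auto
    then show ?thesis using l assms(3) by (simp add: cl_simps cl_W)
  qed
qed (use assms(1) in \<open>auto simp: cl_simps distrib_right\<close>)

definition ends :: "'g \<Rightarrow> ('w, 'k) malg \<Rightarrow> bool"
  where "ends a f \<longleftrightarrow> (\<forall>l. normal l \<longrightarrow> cl f l \<noteq> 0 \<longrightarrow> l \<noteq> [] \<and> last l = a)"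

lemma ends_0: "ends a 0"
  by (simp add: ends_def cl_simps)

lemma ends_W: "normal (l @ [a]) \<Longrightarrow> ends a (W (l @ [a]) c)"
  by (auto simp: ends_def cl_W split: if_splits)

lemma ends_add:
  assumes "ends a f" "ends a g"
  shows "ends a (f + g)"
  unfolding ends_def
proof (intro allI impI)
  fix l assume "normal l" "cl (f + g) l \<noteq> 0"
  then have "cl f l \<noteq> 0 \<or> cl g l \<noteq> 0" by (auto simp: cl_simps)
  then show "l \<noteq> [] \<and> last l = a" using assms \<open>normal l\<close> by (auto simp: ends_def)
qed

lemma ends_direct:
  assumes "ends a f" "ends b g" "ends c h" "a \<noteq> b" "a \<noteq> c" "b \<noteq> c" "f + g + h = 0"
  shows "f = 0" "g = 0" "h = 0"
proof -
  have "cl f l = 0 \<and> cl g l = 0 \<and> cl h l = 0" if l: "normal l" for l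
  proof -
    have "cl f l + cl g l + cl h l = 0"
      using arg_cong[OF assms(7), of "\<lambda>f. cl f l"] by (simp add: cl_simps)
    moreover have "cl f l \<noteq> 0 \<Longrightarrow> last l = a" "cl g l \<noteq> 0 \<Longrightarrow> last l = b" "cl h l \<noteq> 0 \<Longrightarrow> last l = c"
      using assms(1-3) l by (auto simp: ends_def)
    ultimately show ?thesis using assms(4-6) by (metis add.right_neutral add.left_neutral)
  qed
  then show "f = 0" "g = 0" "h = 0" by (auto intro!: cl_eqI simp: cl_simps)
qed

end

section \<open>Right annihilators of u, x, z and y\<close>

abbreviation XA :: "(wordA, 'k::field) malg" where "XA \<equiv> wA.lt gx"
abbreviation YA :: "(wordA, 'k::field) malg" where "YA \<equiv> wA.lt gy"
abbreviation ZA :: "(wordA, 'k::field) malg" where "ZA \<equiv> wA.lt gz"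

lemma relA: "XA * XA = YA * XA" "XA * ZA = 0" "ZA * YA = 0"
  using wA.lt_times_W[OF A.normal.simps(1)[THEN iffD2, OF TrueI]]
  by (simp_all add: wA.lt_def wA.W_times A.lm_letter)

lemma clA_X: "A.normal (gx # w) \<Longrightarrow> wA.cl (XA * f) (gx # w) = wA.cl f w"
  by (rule wA.cl_lt_times) (auto simp: lmA_gx split: if_splits)

lemma clA_X_gz: "A.normal (gz # w) \<Longrightarrow> wA.cl (XA * f) (gz # w) = 0"
  and clA_X_gy: "A.normal (gy # w) \<Longrightarrow> wA.cl (XA * f) (gy # w) = 0"
  by (rule wA.cl_lt_times_0; force simp: lmA_gx split: if_splits)+

lemma clA_Y: "A.normal (gy # w) \<Longrightarrow> wA.cl (YA * f) (gy # w) = wA.cl f w"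
  by (rule wA.cl_lt_times) (auto simp: lmA_gy split: if_splits)

lemma clA_Y_gxgx: "A.normal (gx # gx # w) \<Longrightarrow> wA.cl (YA * f) (gx # gx # w) = wA.cl f (gx # w)"
  by (rule wA.cl_lt_times) (auto simp: lmA_gy lmA_gx split: if_splits)

lemma clA_Y_gz: "A.normal (gz # w) \<Longrightarrow> wA.cl (YA * f) (gz # w) = 0"
  by (rule wA.cl_lt_times_0; force simp: lmA_gy split: if_splits)

lemma clA_Z: "A.normal (gz # w) \<Longrightarrow> wA.cl (ZA * f) (gz # w) = wA.cl f w"
  by (rule wA.cl_lt_times) (auto simp: lmA_gz split: if_splits)

lemma clA_Z_0: "A.normal v \<Longrightarrow> v = [] \<or> hd v \<noteq> gz \<Longrightarrow> wA.cl (ZA * f) v = 0"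
  by (rule wA.cl_lt_times_0) (auto simp: lmA_gz split: if_splits)

lemma generator_list_cases:
  obtains "l = []" | w where "l = gx # w" | w where "l = gy # w" | w where "l = gz # w"
  by (cases l; cases "hd l") auto

text \<open>If l does not start with \<open>gx\<close>, then \<open>gy # l\<close> is normal and
  arises in the product only from YA f, so its coefficient forces \<open>cl f l\<close> to
  vanish.\<close>

lemma rannA_u: "(XA - YA) * f = 0 \<Longrightarrow> \<exists>b. f = XA * b"
proof (rule wA.starts_multiple)
  fix l assume f: "(XA - YA) * f = 0" and l: "A.normal l" "wA.cl f l \<noteq> 0"
  show "\<exists>w. l = gx # w"
  proof (rule ccontr)
    assume "\<nexists>w. l = gx # w"
    then have n: "A.normal (gy # l)" using l(1) by (cases l rule: generator_list_cases) (auto simp: lmA_gy)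
    have "wA.cl (XA * f - YA * f) (gy # l) = - wA.cl f l"
      by (simp add: wA.cl_simps clA_X_gy[OF n] clA_Y[OF n])
    then show False using f l(2) by (simp add: left_diff_distrib wA.cl_simps)
  qed
qed

lemma rannA_x: "XA * f = 0 \<Longrightarrow> \<exists>b. f = ZA * b"
proof (rule wA.starts_multiple)
  fix l assume f: "XA * f = 0" and l: "A.normal l" "wA.cl f l \<noteq> 0"
  show "\<exists>w. l = gz # w"
  proof (rule ccontr)
    assume "\<nexists>w. l = gz # w"
    then have n: "A.normal (gx # l)" using l(1) by (cases l rule: generator_list_cases) (auto simp: lmA_gx)
    show False using clA_X[OF n, of f] f l(2) by (simp add: wA.cl_simps)
  qed
qed

text \<open>Prefixing \<open>gz\<close> keeps a word normal unless it starts with \<open>gy\<close>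
  or with \<open>gx, gx\<close>; a word of the second kind is also a multiple of YA, because y x w =
  x x w in these generators.\<close>

lemma rannA_z:
  fixes f :: "(wordA, 'k::field) malg"
  assumes "ZA * f = 0"
  shows "\<exists>b. f = YA * b"
proof (rule wA.W_induct[where f=f and P="\<lambda>f. \<exists>b. f = YA * b" and
      Q="\<lambda>l. (\<exists>w. l = gy # w) \<or> (\<exists>w. l = gx # gx # w)"])
  fix l assume l: "A.normal l" "wA.cl f l \<noteq> 0"
  show "(\<exists>w. l = gy # w) \<or> (\<exists>w. l = gx # gx # w)"
  proof (rule ccontr)
    assume "\<not> ?thesis"
    then have n: "A.normal (gz # l)"
      using l(1) by (cases l rule: generator_list_cases; cases "tl l" rule: generator_list_cases) (auto simp: lmA_gz)
    show False using clA_Z[OF n, of f] assms l(2) by (simp add: wA.cl_simps)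
  qed
next
  fix l and c :: 'k assume l: "A.normal l" "(\<exists>w. l = gy # w) \<or> (\<exists>w. l = gx # gx # w)"
  then consider w where "l = gy # w" | w where "l = gx # gx # w" by blast
  then show "\<exists>b. wA.W l c = YA * b"
  proof cases
    case (1 w)
    then show ?thesis using l(1) wA.W_Cons[of gy w c] by auto
  next
    case (2 w)
    have "YA * wA.W (gx # w) c = wA.W l c"
      using l(1) 2 by (subst wA.lt_times_W) (auto simp: lmA_gy)
    then show ?thesis by metis
  qed
next
  show "\<exists>b. 0 = YA * b" by (intro exI[of _ 0]) simp
  show "\<exists>b. p + q = YA * b" if "\<exists>b. p = YA * b" "\<exists>b. q = YA * b" for p q
    using that by (metis distrib_left)
qed

text \<open>Left multiplication by YA is injective on normal words: \<open>gx # w\<close> goes to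
  \<open>gx # gx # w\<close>, and every other word gets \<open>gy\<close> in front.\<close>

lemma rannA_y:
  assumes "YA * f = 0"
  shows "f = 0"
proof (rule wA.cl_eqI)
  fix l assume l: "A.normal l"
  show "wA.cl f l = wA.cl 0 l"
  proof (cases "\<exists>w. l = gx # w")
    case True
    then obtain w where w: "l = gx # w" by blast
    then have "A.normal (gx # gx # w)" using l by (auto simp: lmA_gx)
    from clA_Y_gxgx[OF this, of f] show ?thesis by (simp add: w assms wA.cl_simps)
  next
    case False
    then have "A.normal (gy # l)" using l by (cases l rule: generator_list_cases) (auto simp: lmA_gy)
    from clA_Y[OF this, of f] show ?thesis by (simp add: assms wA.cl_simps)
  qed
qed

subsection \<open>Left annihilators\<close>

lemma A_prefix: "A.normal (l @ m) \<Longrightarrow> A.normal l"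
proof (induction l)
  case (Cons a l)
  then show ?case by (cases a; cases l; cases "tl l") (auto simp: lmA_simps split: if_splits)
qed simp

lemma A_snoc_gz: "A.normal l \<Longrightarrow> l = [] \<or> last l \<noteq> gx \<Longrightarrow> A.normal (l @ [gz])"
proof (induction l)
  case (Cons a l)
  then show ?case by (cases a; cases l; cases "tl l") (auto simp: lmA_simps split: if_splits)
qed (simp add: lmA_simps)

lemma A_snoc_gy: "A.normal l \<Longrightarrow> l = [] \<or> last l \<noteq> gz \<Longrightarrow> A.normal (l @ [gy])"
proof (induction l)
  case (Cons a l)
  then show ?case by (cases a; cases l; cases "tl l") (auto simp: lmA_simps split: if_splits)
qed (simp add: lmA_simps)

text \<open>For a normal word, this is the condition under which \<open>gx\<close> can be appended
  without a reduction: y x is rewritten and z x x is zero.\<close>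

definition xend :: "generator list \<Rightarrow> bool"
  where "xend l \<longleftrightarrow> (l = [] \<or> last l \<noteq> gy) \<and> \<not> (\<exists>m. l = m @ [gz, gx])"

lemma A_snoc_gx: "A.normal l \<Longrightarrow> xend l \<Longrightarrow> A.normal (l @ [gx])"
proof (induction l)
  case (Cons a l)
  have xl: "xend l" using Cons.prems(2) by (auto simp: xend_def split: if_splits)
  have "l = [gx] \<Longrightarrow> a \<noteq> gz" using Cons.prems(2) by (auto simp: xend_def)
  moreover have "l = [] \<Longrightarrow> a \<noteq> gy" using Cons.prems(2) by (auto simp: xend_def)
  ultimately show ?case using Cons.IH Cons.prems(1) xl
    by (cases a; cases l; cases "tl l") (auto simp: lmA_simps split: if_splits)
qed (simp add: lmA_simps)

lemma WA_snoc: "A.normal (l @ [a]) \<Longrightarrow> wA.W (l @ [a]) c = wA.W l c * wA.lt a"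
  by (rule wA.W_snoc) (auto dest: A_prefix)

lemma A_snocE:
  assumes "A.normal l" "l \<noteq> []" "last l = a"
  obtains m where "l = m @ [a]" "A.normal m"
  using assms A_prefix[of "butlast l" "[a]"] by (metis append_butlast_last_id)

lemma WA_Z: "A.normal l \<Longrightarrow> A.normal (l @ [gz]) \<or> wA.W l c * ZA = 0"
proof (cases "l = [] \<or> last l \<noteq> gx")
  case False
  assume "A.normal l"
  then obtain m where "l = m @ [gx]" using False A_snocE by metis
  then show ?thesis using \<open>A.normal l\<close> by (simp add: WA_snoc mult.assoc relA)
qed (simp add: A_snoc_gz)

lemma WA_Y: "A.normal l \<Longrightarrow> A.normal (l @ [gy]) \<or> wA.W l c * YA = 0"
proof (cases "l = [] \<or> last l \<noteq> gz")
  case False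
  assume "A.normal l"
  then obtain m where "l = m @ [gz]" using False A_snocE by metis
  then show ?thesis using \<open>A.normal l\<close> by (simp add: WA_snoc mult.assoc relA)
qed (simp add: A_snoc_gy)

lemma endsA_Z: "wA.ends gz (f * ZA)"
proof (induction f rule: wA.W_induct_all)
  case (W l c)
  then show ?case using WA_Z[OF W, of c] wA.ends_0 wA.ends_W[of l gz c] by (auto simp: WA_snoc)
qed (simp_all add: wA.ends_0 wA.ends_add distrib_right)

lemma endsA_Y: "wA.ends gy (f * YA)"
proof (induction f rule: wA.W_induct_all)
  case (W l c)
  then show ?case using WA_Y[OF W, of c] wA.ends_0 wA.ends_W[of l gy c] by (auto simp: WA_snoc)
qed (simp_all add: wA.ends_0 wA.ends_add distrib_right)

lemma ZXX: "ZA * (XA * XA) = 0"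
  by (simp add: relA(1)) (simp add: mult.assoc[symmetric] relA(3))

lemma WA_X: "A.normal l \<Longrightarrow> l = [] \<or> last l \<noteq> gy \<Longrightarrow> A.normal (l @ [gx]) \<or> wA.W l c * XA = 0"
proof (cases "xend l")
  case False
  assume l: "A.normal l" "l = [] \<or> last l \<noteq> gy"
  then obtain m where m: "l = m @ [gz, gx]" using False by (auto simp: xend_def)
  then have "wA.W l c = wA.W (m @ [gz]) c * XA" "wA.W (m @ [gz]) c = wA.W m c * ZA"
    using l(1) WA_snoc[of "m @ [gz]" gx c] WA_snoc[of m gz c] A_prefix[of "m @ [gz]" "[gx]"] by auto
  then show ?thesis by (simp add: mult.assoc ZXX)
qed (simp add: A_snoc_gx)

lemma endsA_X_aux: "wA.ends gx f \<Longrightarrow> wA.ends gx (f * XA)"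
proof (rule wA.W_induct[where f=f and Q="\<lambda>l. l \<noteq> [] \<and> last l = gx" and P="\<lambda>f. wA.ends gx (f * XA)"])
  fix l c assume "A.normal l" "l \<noteq> [] \<and> last l = gx"
  then show "wA.ends gx (wA.W l c * XA)"
    using WA_X[of l c] wA.ends_0 wA.ends_W[of l gx c] by (auto simp: WA_snoc)
qed (auto simp: wA.ends_0 wA.ends_add distrib_right wA.ends_def[of gx f])

text \<open>After a final y the product with x is reduced by (l y) x = (l x) x, and l may end in y
  again; hence the induction from the end of the word, with \<open>endsA_X_aux\<close> for the
  second factor x.\<close>

lemma endsA_X: "wA.ends gx (f * XA)"
proof (induction f rule: wA.W_induct_all)
  case (W l c)
  then show ?case
  proof (induction l rule: rev_induct)
    case Nil
    have "A.normal ([] @ [gx])" by (simp add: lmA_simps)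
    from wA.ends_W[OF this] WA_snoc[OF this] show ?case by metis
  next
    case (snoc a l)
    then have l: "A.normal l" by (auto dest: A_prefix)
    show ?case
    proof (cases "a = gy")
      case True
      have "wA.W (l @ [a]) c * XA = wA.W l c * XA * XA"
        using snoc.prems by (simp add: WA_snoc True mult.assoc relA)
      then show ?thesis using endsA_X_aux[OF snoc.IH[OF l]] by simp
    next
      case False
      then show ?thesis
        using WA_X[OF snoc.prems, of c] wA.ends_0 wA.ends_W[of "l @ [a]" gx c] WA_snoc[of "l @ [a]" gx c] by auto
    qed
  qed
qed (simp_all add: wA.ends_0 wA.ends_add distrib_right)

lemma endsA_multiple: "wA.ends a f \<Longrightarrow> \<exists>b. f = b * wA.lt a"
proof (rule wA.W_induct[where f=f and Q="\<lambda>l. l \<noteq> [] \<and> last l = a" and P="\<lambda>f. \<exists>b. f = b * wA.lt a"])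
  show "\<exists>b. 0 = b * wA.lt a" by (intro exI[of _ 0]) simp
  show "\<exists>b. p + q = b * wA.lt a" if "\<exists>b. p = b * wA.lt a" "\<exists>b. q = b * wA.lt a" for p q
    using that by (metis distrib_right)
  show "\<exists>b. wA.W l c = b * wA.lt a" if "A.normal l" "l \<noteq> [] \<and> last l = a" for l c
    using that by (metis A_snocE WA_snoc)
qed (auto simp: wA.ends_def)

lemma lannA_z: "f * ZA = 0 \<Longrightarrow> \<exists>b. f = b * XA"
proof (rule endsA_multiple, unfold wA.ends_def, intro allI impI)
  fix l assume f: "f * ZA = 0" and l: "A.normal l" "wA.cl f l \<noteq> 0"
  show "l \<noteq> [] \<and> last l = gx"
  proof (rule ccontr)
    assume "\<not> ?thesis"
    then have "A.normal (l @ [gz])" using A_snoc_gz[OF l(1)] by blast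
    from wA.cl_times_lt[where f=f and Q="\<lambda>_. True", OF _ WA_Z l(1) this] f l(2)
    show False by (simp add: wA.cl_simps)
  qed
qed

lemma lannA_y_ends: "f * YA = 0 \<Longrightarrow> wA.ends gz f"
proof (unfold wA.ends_def, intro allI impI)
  fix l assume f: "f * YA = 0" and l: "A.normal l" "wA.cl f l \<noteq> 0"
  show "l \<noteq> [] \<and> last l = gz"
  proof (rule ccontr)
    assume "\<not> ?thesis"
    then have "A.normal (l @ [gy])" using A_snoc_gy[OF l(1)] by blast
    from wA.cl_times_lt[where f=f and Q="\<lambda>_. True", OF _ WA_Y l(1) this] f l(2)
    show False by (simp add: wA.cl_simps)
  qed
qed

text \<open>On the span of the words in \<open>xend\<close>, right multiplication by x merely
  appends a letter and so is injective.\<close>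

lemma X_regular:
  assumes "f * XA = 0" "\<And>l. A.normal l \<Longrightarrow> wA.cl f l \<noteq> 0 \<Longrightarrow> xend l"
  shows "f = 0"
proof (rule wA.cl_eqI)
  fix l assume l: "A.normal l"
  show "wA.cl f l = wA.cl 0 l"
  proof (cases "wA.cl f l = 0")
    case False
    have "wA.cl (f * XA) (l @ [gx]) = wA.cl f l"
      by (rule wA.cl_times_lt[where Q=xend]) (use assms(2) l False A_snoc_gx in auto)
    then show ?thesis using assms(1) by (simp add: wA.cl_simps)
  qed (simp add: wA.cl_simps)
qed

text \<open>The words of f XA end in x and those of f YA in y, so both products vanish. From f YA =
  0 all words of f end in z; to such words x can be appended, and \<open>X_regular\<close>
  applies.\<close>

lemma lannA_u:
  assumes "f * (XA - YA) = 0"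
  shows "f = 0"
proof -
  have "f * XA + (- f) * YA + 0 = 0" using assms by (simp add: right_diff_distrib)
  from wA.ends_direct[OF endsA_X endsA_Y wA.ends_0[of gz] _ _ _ this]
  have fX: "f * XA = 0" and fY: "f * YA = 0" by auto
  show ?thesis
  proof (rule X_regular[OF fX])
    fix l assume "A.normal l" "wA.cl f l \<noteq> 0"
    then show "xend l" using lannA_y_ends[OF fY] by (auto simp: wA.ends_def xend_def)
  qed
qed

text \<open>Modulo the left ideal of u = XA - YA every element has a representative g with words in
  \<open>xend\<close>: a final y is exchanged for x, and m z x = m z u because z y = 0. Since u x =
  0, g is still killed by x, so g = 0 by \<open>X_regular\<close>.\<close>

lemma lannA_x:
  fixes f :: "(wordA, 'k::field) malg"
  assumes "f * XA = 0"
  shows "\<exists>b. f = b * (XA - YA)"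
proof -
  let ?Q = "\<lambda>f :: (wordA, 'k) malg. \<exists>g b. f = g + b * (XA - YA) \<and> (\<forall>l. A.normal l \<longrightarrow> wA.cl g l \<noteq> 0 \<longrightarrow> xend l)"
  have Q0: "?Q 0" by (rule exI[of _ 0], rule exI[of _ 0]) (simp add: wA.cl_simps)
  have Qadd: "?Q (p + q)" if p: "?Q p" and q: "?Q q" for p q
  proof -
    obtain g b where g: "p = g + b * (XA - YA)" "\<forall>l. A.normal l \<longrightarrow> wA.cl g l \<noteq> 0 \<longrightarrow> xend l" using p by blast
    obtain h c where h: "q = h + c * (XA - YA)" "\<forall>l. A.normal l \<longrightarrow> wA.cl h l \<noteq> 0 \<longrightarrow> xend l" using q by blast
    have "p + q = (g + h) + (b + c) * (XA - YA)" by (simp add: g h algebra_simps)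
    moreover have "\<forall>l. A.normal l \<longrightarrow> wA.cl (g + h) l \<noteq> 0 \<longrightarrow> xend l"
      using g(2) h(2) by (auto simp: wA.cl_simps)
    ultimately show ?thesis by blast
  qed
  have QW: "?Q (wA.W l c)" if "A.normal l" "xend l" for l c
    by (rule exI[of _ "wA.W l c"], rule exI[of _ 0]) (use that in \<open>auto simp: wA.cl_W split: if_splits\<close>)
  have Qx: "?Q p" if "wA.ends gx p" for p
  proof (rule wA.W_induct[where f=p and P="?Q" and Q="\<lambda>l. l \<noteq> [] \<and> last l = gx"])
    fix l and c :: 'k assume l: "A.normal l" "l \<noteq> [] \<and> last l = gx"
    show "?Q (wA.W l c)"
    proof (cases "xend l")
      case False
      then obtain m where m: "l = (m @ [gz]) @ [gx]" using l(2) by (auto simp: xend_def)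
      have n: "A.normal (m @ [gz])" using l(1) m A_prefix by blast
      have "wA.W (m @ [gz]) c * YA = 0" using n by (simp add: WA_snoc mult.assoc relA)
      then have "wA.W l c = 0 + wA.W (m @ [gz]) c * (XA - YA)"
        using l(1) WA_snoc[of "m @ [gz]" gx c] by (simp add: m right_diff_distrib)
      then show ?thesis by (intro exI[of _ 0] exI[of _ "wA.W (m @ [gz]) c"]) (simp add: wA.cl_simps)
    qed (use QW l in blast)
  qed (use Q0 Qadd that in \<open>auto simp: wA.ends_def\<close>)
  have "?Q f"
  proof (induction f rule: wA.W_induct_all)
    case (W l c)
    show ?case
    proof (cases "l \<noteq> [] \<and> last l = gy")
      case True
      then obtain m where m: "l = m @ [gy]" using A_snocE W by metis
      have "wA.W l c = wA.W m c * XA + (- wA.W m c) * (XA - YA)"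
        using W by (simp add: m WA_snoc algebra_simps)
      moreover have "?Q ((- wA.W m c) * (XA - YA))"
        by (rule exI[of _ 0], rule exI[of _ "- wA.W m c"]) (simp add: wA.cl_simps)
      ultimately show ?thesis using Qadd[OF Qx[OF endsA_X]] by metis
    next
      case False
      show ?thesis
      proof (cases "xend l")
        case False
        then have "l \<noteq> [] \<and> last l = gx" using \<open>\<not> (l \<noteq> [] \<and> last l = gy)\<close> by (auto simp: xend_def)
        then have "wA.ends gx (wA.W l c)"
          using W wA.ends_W[of "butlast l" gx c] by (metis append_butlast_last_id)
        then show ?thesis by (rule Qx)
      qed (use QW W in blast)
    qed
  qed (use Q0 Qadd in blast)+
  then obtain g b where g: "f = g + b * (XA - YA)" "\<And>l. A.normal l \<Longrightarrow> wA.cl g l \<noteq> 0 \<Longrightarrow> xend l" by blast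
  have "g * XA = f * XA - b * ((XA - YA) * XA)" by (simp add: g(1) algebra_simps)
  also have "\<dots> = 0" by (simp add: assms left_diff_distrib relA)
  finally have "g = 0" using X_regular g(2) by blast
  then show ?thesis using g(1) by auto
qed

lemma A_left_gen:
  fixes f :: "(wordA, 'k::field) malg"
  assumes "f \<in> hom (Suc n)"
  shows "\<exists>b c d. f = b * XA + c * YA + d * ZA"
proof (rule wA.W_induct[where f=f and Q="\<lambda>l. l \<noteq> []" and P="\<lambda>f. \<exists>b c d. f = b * XA + c * YA + d * ZA"])
  show "\<exists>b c d. (0::(wordA, 'k) malg) = b * XA + c * YA + d * ZA" by (intro exI[of _ 0]) simp
  show "\<exists>b c d. p + q = b * XA + c * YA + d * ZA"
    if p: "\<exists>b c d. p = b * XA + c * YA + d * ZA" and q: "\<exists>b c d. q = b * XA + c * YA + d * ZA" for p q :: "(wordA, 'k) malg"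
  proof -
    from p q obtain b c d b' c' d' where "p = b * XA + c * YA + d * ZA" "q = b' * XA + c' * YA + d' * ZA" by blast
    then have "p + q = (b + b') * XA + (c + c') * YA + (d + d') * ZA" by (simp add: algebra_simps)
    then show ?thesis by blast
  qed
  fix l and c :: 'k assume l: "A.normal l" "l \<noteq> []"
  then obtain m where "l = m @ [last l]" by (metis append_butlast_last_id)
  then have "wA.W l c = wA.W m c * wA.lt (last l)" using l WA_snoc by metis
  then consider "wA.W l c = wA.W m c * XA + 0 * YA + 0 * ZA" | "wA.W l c = 0 * XA + wA.W m c * YA + 0 * ZA"
    | "wA.W l c = 0 * XA + 0 * YA + wA.W m c * ZA"
    by (cases "last l") auto
  then show "\<exists>b c' d. wA.W l c = b * XA + c' * YA + d * ZA" by cases blast+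
qed (use wA.hom_Suc_decompose[OF assms] in auto)

text \<open>The minus sign undoes the change of generators, so u = x + y is XA - YA here.\<close>

lemma xyz_algebra_A: "xyz_algebra (XA :: (wordA, 'k::field) malg) (- YA) ZA"
proof
  show "(XA :: (wordA, 'k) malg) \<in> hom 1" "(- YA :: (wordA, 'k) malg) \<in> hom 1" "(ZA :: (wordA, 'k) malg) \<in> hom 1"
    using wA.lt_hom hom_minus by blast+
  show "(XA + - YA) * XA = (0 :: (wordA, 'k) malg)" "XA * ZA = (0 :: (wordA, 'k) malg)" "ZA * - YA = (0 :: (wordA, 'k) malg)"
    by (simp_all add: relA left_diff_distrib)
  fix a b c :: "(wordA, 'k) malg" and n
  show "a * (XA + - YA) = 0 \<Longrightarrow> a = 0" using lannA_u[of a] by simp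
  show "a * XA = 0 \<Longrightarrow> \<exists>b. a = b * (XA + - YA)" using lannA_x[of a] by simp
  show "a * ZA = 0 \<Longrightarrow> \<exists>b. a = b * XA" by (rule lannA_z)
  show "a * - YA = 0 \<Longrightarrow> \<exists>b. a = b * ZA" using endsA_multiple[OF lannA_y_ends, of a] by simp
  show "a * XA + b * - YA + c * ZA = 0 \<Longrightarrow> a * XA = 0 \<and> b * - YA = 0 \<and> c * ZA = 0"
    using wA.ends_direct[OF endsA_X[of a] endsA_Y[of "- b"] endsA_Z[of c]] by simp
  show "a \<in> hom (Suc n) \<Longrightarrow> \<exists>b c d. a = b * XA + c * - YA + d * ZA"
    using A_left_gen[of a n] by (metis minus_mult_minus)
  show "(XA + - YA) * a = 0 \<Longrightarrow> \<exists>b. a = XA * b" using rannA_u[of a] by simp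
  show "XA * a = 0 \<Longrightarrow> \<exists>b. a = ZA * b" by (rule rannA_x)
  show "ZA * a = 0 \<Longrightarrow> \<exists>b. a = - YA * b" using rannA_z[of a] by (metis minus_mult_minus)
  show "- YA * a = 0 \<Longrightarrow> a = 0" using rannA_y[of a] by simp
qed

subsection \<open>Koszul filtrations\<close>

lemma direct_empty: "direct {}" and direct_singleton: "direct {c}"
  by (simp_all add: direct_def)

text \<open>\<open>T0\<close> contains u in place of y because the right ideals of XA and YA are not
  independent: they share XA XA = YA XA. The element y enters \<open>S\<close> only as the
  annihilator of z, and the chain stops there.\<close>

lemma koszul_filtration_A:
  "\<exists>S T0 T. koszul_filtration (S :: (wordA, 'k::field) malg set) T0 T"
proof -
  let ?u = "XA - YA :: (wordA, 'k) malg"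
  let ?X = "XA :: (wordA, 'k) malg" and ?Y = "YA :: (wordA, 'k) malg" and ?Z = "ZA :: (wordA, 'k) malg"
  define T where "T b = (if b = ?u then {?X} else if b = ?X then {?Z} else if b = ?Z then {?Y} else {})"
    for b
  have "wA.cl ?u [gy] = -1" "wA.cl ?X [gy] = 0" "wA.cl ?Z [gy] = 0" "wA.cl ?u [gx] = 1" "wA.cl ?Y [gx] = 0"
    by (simp_all add: wA.cl_simps wA.lt_def wA.cl_W lmA_simps)
  then have ne: "?u \<noteq> ?X" "?u \<noteq> ?Z" "?u \<noteq> ?Y" by force+
  have ne2: "?X \<noteq> ?Y" "?X \<noteq> ?Z" "?Y \<noteq> ?Z" by (simp_all add: wA.lt_neq)
  have "koszul_filtration {?u, ?X, ?Y, ?Z} {?u, ?X, ?Z} T"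
  proof
    show "{?u, ?X, ?Y, ?Z} \<subseteq> hom 1" using wA.lt_hom hom_diff by blast
    show "direct {?u, ?X, ?Z}"
      unfolding direct_def
    proof (intro allI impI)
      fix g assume "(\<Sum>c\<in>{?u, ?X, ?Z}. c * g c) = 0"
      then have sum: "?X * g ?u - ?Y * g ?u + ?X * g ?X + ?Z * g ?Z = 0"
        using ne ne2 by (simp add: left_diff_distrib add.assoc)
      have cl0: "wA.cl (?X * g ?u) l - wA.cl (?Y * g ?u) l + wA.cl (?X * g ?X) l + wA.cl (?Z * g ?Z) l = 0" for l
        using arg_cong[OF sum, of "\<lambda>f. wA.cl f l"] by (simp add: wA.cl_simps)
      have z: "?Z * g ?Z = 0"
      proof (rule wA.cl_eqI)
        fix l assume l: "A.normal l"
        show "wA.cl (?Z * g ?Z) l = wA.cl 0 l"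
        proof (cases "l = [] \<or> hd l \<noteq> gz")
          case False
          then obtain w where w: "l = gz # w" by (cases l) auto
          show ?thesis using cl0[of l] l clA_X_gz[of w "g ?u"] clA_X_gz[of w "g ?X"] clA_Y_gz[of w "g ?u"]
            by (simp add: w wA.cl_simps)
        qed (use clA_Z_0 l in \<open>simp add: wA.cl_simps\<close>)
      qed
      \<comment> \<open>Words starting with y come only from the YA part of u, which forces the
        cofactor of u into x A, the right annihilator of u.\<close>
      have "\<exists>b. g ?u = ?X * b"
      proof (rule wA.starts_multiple)
        fix l assume l: "A.normal l" "wA.cl (g ?u) l \<noteq> 0"
        show "\<exists>w. l = gx # w"
        proof (rule ccontr)
          assume "\<nexists>w. l = gx # w"
          then have n: "A.normal (gy # l)" using l(1) by (cases l rule: generator_list_cases) (auto simp: lmA_gy)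
          show False using cl0[of "gy # l"] l(2) z by (simp add: clA_X_gy[OF n] clA_Y[OF n] wA.cl_simps)
        qed
      qed
      then obtain b where "g ?u = ?X * b" by blast
      then have u: "?u * g ?u = 0" by (simp add: left_diff_distrib mult.assoc[symmetric] relA)
      then have "?X * g ?X = 0" using sum z by (simp add: left_diff_distrib)
      then show "\<forall>c\<in>{?u, ?X, ?Z}. c * g c = 0" using u z by simp
    qed
    fix b assume "b \<in> {?u, ?X, ?Y, ?Z}"
    then consider "b = ?u" | "b = ?X" | "b = ?Y" | "b = ?Z" by blast
    note b = this
    show "finite (T b)" "T b \<subseteq> {?u, ?X, ?Y, ?Z}" "direct (T b)"
      by (simp_all add: T_def direct_empty direct_singleton)
    show "b * c = 0" if "c \<in> T b" for c
      using b that ne ne2 by cases (auto simp: T_def relA left_diff_distrib)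
    show "\<exists>g. a = (\<Sum>c\<in>T b. c * g c)" if ba: "b * a = 0" for a
    proof -
      have sing: "\<exists>g. a = (\<Sum>c\<in>{d}. c * g c)" if "\<exists>e. a = d * e" for d
        using that by auto
      show ?thesis using b
      proof cases
        case 1
        then show ?thesis using sing[OF rannA_u] ba by (simp add: T_def)
      next
        case 2
        then show ?thesis using sing[OF rannA_x] ba ne by (simp add: T_def)
      next
        case 3
        then show ?thesis using rannA_y[of a] ba ne ne2 by (simp add: T_def)
      next
        case 4
        then show ?thesis using sing[OF rannA_z] ba ne ne2 by (simp add: T_def)
      qed
    qed
  next
    fix a :: "(wordA, 'k) malg" and n assume a: "a \<in> hom (Suc n)"
    let ?P = "\<lambda>a. \<exists>r s t. a = ?u * r + ?X * s + ?Z * t"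
    have "?P a"
    proof (rule wA.W_induct[where f=a and Q="\<lambda>l. l \<noteq> []" and P="?P"])
      show "?P 0" by (intro exI[of _ 0]) simp
      show "?P (p + q)" if p: "?P p" and q: "?P q" for p q
      proof -
        from p q obtain r s t r' s' t' where pq: "p = ?u * r + ?X * s + ?Z * t" "q = ?u * r' + ?X * s' + ?Z * t'" by blast
        have "p + q = ?u * (r + r') + ?X * (s + s') + ?Z * (t + t')"
          unfolding pq by (simp only: distrib_left ac_simps)
        then show ?thesis by blast
      qed
      fix l and c :: 'k assume l: "A.normal l" "l \<noteq> []"
      then obtain e w where w: "l = e # w" by (cases l) auto
      have W: "wA.W l c = wA.lt e * wA.W w c" using wA.W_Cons[of e w c] l w by simp
      consider "wA.W l c = ?u * 0 + ?X * wA.W w c + ?Z * 0"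
        | "wA.W l c = ?u * (- wA.W w c) + ?X * wA.W w c + ?Z * 0"
        | "wA.W l c = ?u * 0 + ?X * 0 + ?Z * wA.W w c"
        using W by (cases e) (auto simp: algebra_simps)
      then show "?P (wA.W l c)" by cases blast+
    qed (use wA.hom_Suc_decompose[OF a] in auto)
    then obtain r s t where "a = ?u * r + ?X * s + ?Z * t" by blast
    then have "a = (\<Sum>c\<in>{?u, ?X, ?Z}. c * (if c = ?u then r else if c = ?X then s else t))"
      using ne ne2 by (simp add: add.assoc)
    then show "\<exists>g. a = (\<Sum>c\<in>{?u, ?X, ?Z}. c * g c)"
      by (rule exI[of _ "\<lambda>c. if c = ?u then r else if c = ?X then s else t"])
  qed auto
  then show ?thesis by blast
qed

section \<open>Annihilators and Koszul filtration of the dual algebra\<close>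

abbreviation UB :: "(wordB, 'k::field) malg" where "UB \<equiv> wB.lt gx"
abbreviation XB :: "(wordB, 'k::field) malg" where "XB \<equiv> wB.lt gy"
abbreviation ZB :: "(wordB, 'k::field) malg" where "ZB \<equiv> wB.lt gz"

lemma clB_U: "B.normal (gx # w) \<Longrightarrow> wB.cl (UB * f) (gx # w) = wB.cl f w"
  by (rule wB.cl_lt_times) (auto simp: lmB_gx split: if_splits)

lemma clB_U_0: "B.normal v \<Longrightarrow> v = [] \<or> hd v \<noteq> gx \<Longrightarrow> wB.cl (UB * f) v = 0"
  by (rule wB.cl_lt_times_0) (auto simp: lmB_gx split: if_splits)

lemma clB_X: "B.normal (gy # w) \<Longrightarrow> wB.cl (XB * f) (gy # w) = wB.cl f w"
  by (rule wB.cl_lt_times) (auto simp: lmB_gy split: if_splits)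

lemma clB_X_0: "B.normal v \<Longrightarrow> v = [] \<or> hd v \<noteq> gy \<Longrightarrow> wB.cl (XB * f) v = 0"
  by (rule wB.cl_lt_times_0) (auto simp: lmB_gy split: if_splits)

lemma clB_Z_0: "B.normal v \<Longrightarrow> v = [] \<or> hd v \<noteq> gz \<Longrightarrow> wB.cl (ZB * f) v = 0"
  by (rule wB.cl_lt_times_0) (auto simp: lmB_gz split: if_splits)

lemma clB_Z: "wB.cl (ZB * f) [gz] = wB.cl f []"
  by (rule wB.cl_lt_times) (auto simp: lmB_gz split: if_splits)

text \<open>Since z u = z x, the words \<open>[gx]\<close> and \<open>[gy]\<close> are both sent to
  \<open>[gz, gy]\<close>; left multiplication is not injective on words here and two coefficients
  add up.\<close>

lemma clB_Z_gy: "wB.cl (ZB * f) [gz, gy] = wB.cl f [gx] + wB.cl f [gy]"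
proof (induction f rule: wB.W_induct_all)
  case (W l c)
  then show ?case
    by (auto simp: wB.lt_times_W lmB_simps wB.cl_W wB.cl_simps)
qed (simp_all add: wB.cl_simps distrib_left)

lemma relB: "UB * UB = 0" "UB * ZB = 0" "XB * UB = 0" "XB * XB = 0" "ZB * ZB = 0" "ZB * UB = ZB * XB"
  by (simp_all add: wB.lt_def wB.W_times lmB_simps)

lemma B_normal_gz: "B.normal (gz # w) \<Longrightarrow> w = [] \<or> w = [gy]"
  by (auto simp: lmB_simps split: if_splits)

text \<open>In this algebra a nonzero product of a letter with a word still starts with that letter,
  so different summands have disjoint supports.\<close>

lemma direct_of_starts:
  assumes "finite (V :: generator set)"
  shows "direct ((wB.lt :: _ \<Rightarrow> (wordB, 'k::field) malg) ` V)"
  unfolding direct_def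
proof (intro allI impI ballI)
  fix g and c :: "(wordB, 'k) malg"
  assume sum: "(\<Sum>c\<in>wB.lt ` V. c * g c) = (0 :: (wordB, 'k) malg)" and "c \<in> wB.lt ` V"
  then obtain a where a: "a \<in> V" "c = wB.lt a" by blast
  have inj: "inj_on (wB.lt :: _ \<Rightarrow> (wordB, 'k) malg) V" using wB.lt_neq by (auto intro: inj_onI)
  have 0: "wB.cl (wB.lt b * f) l = 0" if "B.normal l" "l = [] \<or> hd l \<noteq> b" for b l and f :: "(wordB, 'k) malg"
    using that clB_U_0[of l f] clB_X_0[of l f] clB_Z_0[of l f] by (cases b) auto
  have "wB.cl (wB.lt a * g (wB.lt a)) l = 0" if l: "B.normal l" for l
  proof (cases "l = [] \<or> hd l \<noteq> a")
    case False
    have cl_sum: "wB.cl (sum F S) l = (\<Sum>s\<in>S. wB.cl (F s) l)" for F :: "generator \<Rightarrow> (wordB, 'k) malg" and S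
      by (induction S rule: infinite_finite_induct) (simp_all add: wB.cl_simps)
    have "0 = wB.cl (\<Sum>b\<in>V. wB.lt b * g (wB.lt b)) l"
      using sum by (simp add: sum.reindex[OF inj] wB.cl_simps)
    also have "\<dots> = (\<Sum>b\<in>V. if b = a then wB.cl (wB.lt a * g (wB.lt a)) l else 0)"
      unfolding cl_sum using False 0[OF l] by (intro sum.cong) auto
    also have "\<dots> = wB.cl (wB.lt a * g (wB.lt a)) l" using assms a(1) by simp
    finally show ?thesis by simp
  qed (use 0 l in auto)
  then show "c * g c = 0" unfolding a(2) by (intro wB.cl_eqI) (simp add: wB.cl_simps)
qed

lemma starts_sum:
  fixes f :: "(wordB, 'k::field) malg"
  assumes "finite V" "\<And>l. B.normal l \<Longrightarrow> wB.cl f l \<noteq> 0 \<Longrightarrow> l \<noteq> [] \<and> hd l \<in> V"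
  shows "\<exists>g. f = (\<Sum>c\<in>wB.lt ` V. c * g c)"
proof (rule wB.W_induct[where f=f and Q="\<lambda>l. l \<noteq> [] \<and> hd l \<in> V" and P="\<lambda>f. \<exists>g. f = (\<Sum>c\<in>wB.lt ` V. c * g c)"])
  show "\<exists>g. (0 :: (wordB, 'k) malg) = (\<Sum>c\<in>wB.lt ` V. c * g c)" by (intro exI[of _ "\<lambda>_. 0"]) simp
  show "\<exists>g. p + q = (\<Sum>c\<in>wB.lt ` V. c * g c)"
    if p: "\<exists>g. p = (\<Sum>c\<in>wB.lt ` V. c * g c)" and q: "\<exists>g. q = (\<Sum>c\<in>wB.lt ` V. c * g c)" for p q :: "(wordB, 'k) malg"
  proof -
    obtain g where g: "p = (\<Sum>c\<in>wB.lt ` V. c * g c)" using p by blast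
    obtain h where h: "q = (\<Sum>c\<in>wB.lt ` V. c * h c)" using q by blast
    have "p + q = (\<Sum>c\<in>wB.lt ` V. c * (g c + h c))" by (simp add: g h distrib_left sum.distrib)
    then show ?thesis by (rule exI[of _ "\<lambda>c. g c + h c"])
  qed
  fix l and c :: 'k assume l: "B.normal l" "l \<noteq> [] \<and> hd l \<in> V"
  then obtain a w where w: "l = a # w" "a \<in> V" by (cases l) auto
  have "(\<Sum>b\<in>wB.lt ` V. b * (if b = wB.lt a then wB.W w c else 0)) = wB.lt a * wB.W w c"
    using assms(1) w(2) by (subst sum.remove[of _ "wB.lt a"]) (auto intro!: sum.neutral)
  moreover have "wB.W l c = wB.lt a * wB.W w c" using wB.W_Cons[of a w c] l(1) w(1) by simp
  ultimately have "wB.W l c = (\<Sum>b\<in>wB.lt ` V. b * (if b = wB.lt a then wB.W w c else 0))" by simp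
  then show "\<exists>g. wB.W l c = (\<Sum>c\<in>wB.lt ` V. c * g c)"
    by (rule exI[of _ "\<lambda>b. if b = wB.lt a then wB.W w c else 0"])
qed (use assms(2) in auto)

lemma annB_W:
  fixes f :: "(wordB, 'k::field) malg"
  assumes "(UB - XB) * f = 0"
  shows "\<exists>b. f = UB * b"
proof (rule wB.starts_multiple)
  fix l assume l: "B.normal l" "wB.cl f l \<noteq> 0"
  have cl: "wB.cl (UB * f) v = wB.cl (XB * f) v" for v
    using arg_cong[OF assms, of "\<lambda>f. wB.cl f v"] by (simp add: left_diff_distrib wB.cl_simps)
  show "\<exists>w. l = gx # w"
  proof (rule ccontr)
    assume n: "\<nexists>w. l = gx # w"
    show False
    proof (cases "\<exists>w. l = gz # w")
      case True
      then have n: "B.normal (gy # l)" using l(1) by (auto simp: lmB_gy)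
      show False using cl[of "gy # l"] clB_X[OF n, of f] clB_U_0[OF n, of f] l(2) by simp
    next
      case False
      then have n: "B.normal (gx # l)" using l(1) n by (cases l rule: generator_list_cases) (auto simp: lmB_gx)
      show False using cl[of "gx # l"] clB_U[OF n, of f] clB_X_0[OF n, of f] l(2) by simp
    qed
  qed
qed

text \<open>The equation z u = z x leaves c (U - X) as the only possible part of f on the words
  \<open>[gx]\<close> and \<open>[gy]\<close>; it is subtracted first. Each remaining word starts
  with z, or is U w with X w = 0, or X w with U w = 0, and in the last two cases it is (U - X) w or
  -(U - X) w.\<close>

lemma annB_Z:
  fixes f :: "(wordB, 'k::field) malg"
  assumes "ZB * f = 0"
  shows "\<exists>r s. f = ZB * r + (UB - XB) * s"
proof -
  let ?P = "\<lambda>f :: (wordB, 'k) malg. \<exists>r s. f = ZB * r + (UB - XB) * s"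
  have P0: "?P 0" by (intro exI[of _ 0]) simp
  have Padd: "?P (p + q)" if p: "?P p" and q: "?P q" for p q
  proof -
    from p q obtain r s r' s' where pq: "p = ZB * r + (UB - XB) * s" "q = ZB * r' + (UB - XB) * s'" by blast
    have "p + q = ZB * (r + r') + (UB - XB) * (s + s')" unfolding pq by (simp only: distrib_left ac_simps)
    then show ?thesis by blast
  qed
  define c where "c = wB.cl f [gx]"
  have "wB.cl f [] = 0" using clB_Z[of f] assms by (simp add: wB.cl_simps)
  moreover have "wB.cl f [gy] = - c" using clB_Z_gy[of f] assms by (simp add: wB.cl_simps c_def add_eq_0_iff)
  moreover have n: "B.normal [gx]" "B.normal [gy]" "B.normal []" by (simp_all add: lmB_simps)
  moreover have W: "(UB - XB) * wB.W [] c = wB.W [gx] c - wB.W [gy] c"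
    using wB.W_Cons[of gx "[]" c] wB.W_Cons[of gy "[]" c] n by (simp add: left_diff_distrib)
  ultimately have "wB.cl (f - (UB - XB) * wB.W [] c) l = 0" if "l = [] \<or> l = [gx] \<or> l = [gy]" for l
    using that by (auto simp: W wB.cl_simps wB.cl_W c_def)
  then have *: "?P (f - (UB - XB) * wB.W [] c)"
  proof (intro wB.W_induct[where f="f - (UB - XB) * wB.W [] c" and P="?P" and Q="\<lambda>l. l \<noteq> [] \<and> l \<noteq> [gx] \<and> l \<noteq> [gy]"])
    fix l and d :: 'k assume l: "B.normal l" "l \<noteq> [] \<and> l \<noteq> [gx] \<and> l \<noteq> [gy]"
    then obtain a w where w: "l = a # w" by (cases l) auto
    have Wl: "wB.W l d = wB.lt a * wB.W w d" using wB.W_Cons[of a w d] l w by simp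
    have wn: "B.normal w" using l w by simp
    show "?P (wB.W l d)"
    proof (cases a)
      case gx
      then obtain v where "w = gy # v" using l w by (cases w rule: generator_list_cases) (auto simp: lmB_gx)
      then have "XB * wB.W w d = 0" using wn by (simp add: wB.lt_times_W lmB_gy)
      then have "wB.W l d = ZB * 0 + (UB - XB) * wB.W w d" using Wl gx by (simp add: left_diff_distrib)
      then show ?thesis by blast
    next
      case gy
      then obtain v where "w = gz # v" using l w by (cases w rule: generator_list_cases) (auto simp: lmB_gy)
      then have "UB * wB.W w d = 0" using wn by (simp add: wB.lt_times_W lmB_gx)
      then have "wB.W l d = ZB * 0 + (UB - XB) * (- wB.W w d)" using Wl gy by (simp add: left_diff_distrib)
      then show ?thesis by blast
    next
      case gz
      then have "wB.W l d = ZB * wB.W w d + (UB - XB) * 0" using Wl by simp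
      then show ?thesis by blast
    qed
  qed (use P0 Padd in blast)+
  have "?P ((UB - XB) * wB.W [] c)" by (rule exI[of _ 0], rule exI[of _ "wB.W [] c"]) simp
  from Padd[OF * this] show ?thesis by simp
qed

text \<open>The element W = U - X joins the generators because Z kills it and it is not a multiple
  of Z. Koszulness is checked directly on this algebra, without an appeal to duality.\<close>

lemma koszul_filtration_B:
  "\<exists>S T0 T. koszul_filtration (S :: (wordB, 'k::field) malg set) T0 T"
proof -
  let ?U = "UB :: (wordB, 'k) malg" and ?X = "XB :: (wordB, 'k) malg" and ?Z = "ZB :: (wordB, 'k) malg"
  let ?W = "?U - ?X"
  define T where "T b = (if b = ?U then {?U, ?Z} else if b = ?X then {?U, ?X} else if b = ?Z then {?Z, ?W} else {?U})"
    for b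
  have ne: "?U \<noteq> ?X" "?U \<noteq> ?Z" "?X \<noteq> ?Z" by (simp_all add: wB.lt_neq)
  have "wB.cl ?W [gy] = -1" "wB.cl ?U [gy] = 0" "wB.cl ?Z [gy] = 0" "wB.cl ?W [gx] = 1" "wB.cl ?X [gx] = 0"
    by (simp_all add: wB.cl_simps wB.lt_def wB.cl_W lmB_simps)
  then have neW: "?W \<noteq> ?U" "?W \<noteq> ?Z" "?W \<noteq> ?X" by force+
  have TW: "T ?U = {?U, ?Z}" "T ?X = {?U, ?X}" "T ?Z = {?Z, ?W}" "T ?W = {?U}"
    using ne neW by (simp_all add: T_def)
  have dir: "direct {?U, ?Z}" "direct {?U, ?X}" "direct {?U, ?X, ?Z}"
    using direct_of_starts[of "{gx, gz}"] direct_of_starts[of "{gx, gy}"] direct_of_starts[of "{gx, gy, gz}"]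
    by simp_all
  have dirW: "direct {?Z, ?W}"
    unfolding direct_def
  proof (intro allI impI)
    fix g assume "(\<Sum>c\<in>{?Z, ?W}. c * g c) = 0"
    then have sum: "?Z * g ?Z + ?W * g ?W = 0" using neW by simp
    have "?Z * g ?Z = 0"
    proof (rule wB.cl_eqI)
      fix l assume l: "B.normal l"
      show "wB.cl (?Z * g ?Z) l = wB.cl 0 l"
      proof (cases "l = [] \<or> hd l \<noteq> gz")
        case False
        have "wB.cl (?Z * g ?Z) l + wB.cl (?U * g ?W) l - wB.cl (?X * g ?W) l = 0"
          using arg_cong[OF sum, of "\<lambda>f. wB.cl f l"] by (simp add: wB.cl_simps left_diff_distrib algebra_simps)
        then show ?thesis
          using False clB_U_0[OF l, of "g ?W"] clB_X_0[OF l, of "g ?W"] by (simp add: wB.cl_simps)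
      qed (use clB_Z_0 l in \<open>simp add: wB.cl_simps\<close>)
    qed
    then show "\<forall>c\<in>{?Z, ?W}. c * g c = 0" using sum by simp
  qed
  have "koszul_filtration {?U, ?X, ?Z, ?W} {?U, ?X, ?Z} T"
  proof
    show "{?U, ?X, ?Z, ?W} \<subseteq> hom 1" using wB.lt_hom hom_diff by blast
    show "direct {?U, ?X, ?Z}" by (rule dir)
    fix b assume "b \<in> {?U, ?X, ?Z, ?W}"
    then consider "b = ?U" | "b = ?X" | "b = ?Z" | "b = ?W" by blast
    note b = this
    show "finite (T b)" by (simp add: T_def)
    show "T b \<subseteq> {?U, ?X, ?Z, ?W}" by (simp add: T_def)
    show "direct (T b)" using b by cases (simp_all add: TW dir dirW direct_singleton)
    show "b * c = 0" if "c \<in> T b" for c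
      using b that by cases (auto simp: TW relB left_diff_distrib right_diff_distrib)
    show "\<exists>g. a = (\<Sum>c\<in>T b. c * g c)" if ba: "b * a = 0" for a
      using b
    proof cases
      case 1
      have "\<exists>g. a = (\<Sum>c\<in>wB.lt ` {gx, gz}. c * g c)"
      proof (rule starts_sum)
        fix l assume l: "B.normal l" "wB.cl a l \<noteq> 0"
        show "l \<noteq> [] \<and> hd l \<in> {gx, gz}"
        proof (rule ccontr)
          assume "\<not> ?thesis"
          then have n: "B.normal (gx # l)" using l(1) by (cases l rule: generator_list_cases) (auto simp: lmB_gx)
          show False using clB_U[OF n, of a] ba 1 l(2) by (simp add: wB.cl_simps)
        qed
      qed simp
      then show ?thesis by (simp add: 1 TW)
    next
      case 2
      have "\<exists>g. a = (\<Sum>c\<in>wB.lt ` {gx, gy}. c * g c)"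
      proof (rule starts_sum)
        fix l assume l: "B.normal l" "wB.cl a l \<noteq> 0"
        show "l \<noteq> [] \<and> hd l \<in> {gx, gy}"
        proof (rule ccontr)
          assume "\<not> ?thesis"
          then have n: "B.normal (gy # l)" using l(1) by (cases l rule: generator_list_cases) (auto simp: lmB_gy)
          show False using clB_X[OF n, of a] ba 2 l(2) by (simp add: wB.cl_simps)
        qed
      qed simp
      then show ?thesis by (simp add: 2 TW)
    next
      case 3
      then obtain r s where "a = ?Z * r + ?W * s" using annB_Z[of a] ba by auto
      then have "a = (\<Sum>c\<in>{?Z, ?W}. c * (if c = ?Z then r else s))" using neW by simp
      then show ?thesis unfolding 3 TW by (rule exI[of _ "\<lambda>c. if c = ?Z then r else s"])
    next
      case 4
      then obtain r where "a = ?U * r" using annB_W[of a] ba by auto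
      then have "a = (\<Sum>c\<in>{?U}. c * r)" by simp
      then show ?thesis unfolding 4 TW by (rule exI[of _ "\<lambda>_. r"])
    qed
  next
    fix a :: "(wordB, 'k) malg" and n assume a: "a \<in> hom (Suc n)"
    have "\<exists>g. a = (\<Sum>c\<in>wB.lt ` {gx, gy, gz}. c * g c)"
    proof (rule starts_sum)
      fix l assume "B.normal l" "wB.cl a l \<noteq> 0"
      then have "l \<noteq> []" using wB.hom_Suc_decompose[OF a] by blast
      then show "l \<noteq> [] \<and> hd l \<in> {gx, gy, gz}" by (cases "hd l") auto
    qed simp
    then show "\<exists>g. a = (\<Sum>c\<in>{?U, ?X, ?Z}. c * g c)" by simp
  qed auto
  then show ?thesis by blast
qed

section \<open>The presented algebra\<close>

lemma free_simps:
  "carrier free_algebra = UNIV" "p \<otimes>\<^bsub>free_algebra\<^esub> q = p * q" "\<one>\<^bsub>free_algebra\<^esub> = 1"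
  "\<zero>\<^bsub>free_algebra\<^esub> = 0" "p \<oplus>\<^bsub>free_algebra\<^esub> q = p + q" "c \<odot>\<^bsub>free_algebra\<^esub> p = pm_scale c p"
  "hcomp free_algebra n = {p. \<forall>w\<in>Poly_Mapping.keys p. length w = n}"
  by (simp_all add: free_algebra_def)

lemma ring_free: "ring free_algebra"
proof (rule ringI)
  show "abelian_group free_algebra"
    by (rule abelian_groupI) (auto simp: free_simps algebra_simps intro: exI[of _ "- _"] left_minus)
  show "monoid free_algebra"
    by (rule monoidI) (auto simp: free_simps algebra_simps)
qed (simp_all add: free_simps algebra_simps)

lemma minus_free: "\<ominus>\<^bsub>free_algebra\<^esub> p = - p"
  by (rule abelian_group.minus_equality[OF ring.is_abelian_group[OF ring_free]]) (simp_all add: free_simps)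

lemma diff_free: "p \<ominus>\<^bsub>free_algebra\<^esub> q = p - q"
  by (simp add: a_minus_def minus_free free_simps)

lemma single_append: "Poly_Mapping.single v c * Poly_Mapping.single w d =
    (Poly_Mapping.single (v @ w) (c * d) :: 'v list \<Rightarrow>\<^sub>0 'k::field)"
  by (simp add: mult_single plus_list_def)

lemma one_single: "(1 :: 'v list \<Rightarrow>\<^sub>0 'k::field) = Poly_Mapping.single [] 1"
  by (simp add: zero_list_def[symmetric])

lemma pm_scale_times: "pm_scale c p = Poly_Mapping.single [] c * (p :: 'v list \<Rightarrow>\<^sub>0 'k::field)"
proof -
  have "Poly_Mapping.keys p \<subseteq> UNIV" by simp
  then show ?thesis
    by (induction rule: pm_induct_keys) (simp_all add: pm_scale_lsc lsc_simps single_append distrib_left)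
qed

lemma gen_times_single: "gen a * Poly_Mapping.single w c = Poly_Mapping.single (a # w) c"
  by (simp add: gen_def single_append)

context
  fixes I :: "('v list \<Rightarrow>\<^sub>0 'k::field) set"
  assumes I: "ideal I free_algebra"
begin

interpretation I: ideal I free_algebra by (rule I)

lemma ideal_simps:
  "0 \<in> I" "p \<in> I \<Longrightarrow> q \<in> I \<Longrightarrow> p + q \<in> I" "p \<in> I \<Longrightarrow> - p \<in> I" "p \<in> I \<Longrightarrow> q \<in> I \<Longrightarrow> p - q \<in> I"
  "p \<in> I \<Longrightarrow> r * p \<in> I" "p \<in> I \<Longrightarrow> p * r \<in> I"
proof -
  show add: "p \<in> I \<Longrightarrow> q \<in> I \<Longrightarrow> p + q \<in> I" for p q
    using additive_subgroup.a_closed[OF ideal.axioms(1)[OF I], of p q] by (simp add: free_simps)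
  show "p \<in> I \<Longrightarrow> r * p \<in> I" "p \<in> I \<Longrightarrow> p * r \<in> I"
    using I.I_l_closed[of p r] I.I_r_closed[of p r] by (simp_all add: free_simps)
  show neg: "p \<in> I \<Longrightarrow> - p \<in> I" for p
    using additive_subgroup.a_inv_closed[OF ideal.axioms(1)[OF I], of p] by (simp add: minus_free)
  show "0 \<in> I" using additive_subgroup.zero_closed[OF ideal.axioms(1)[OF I]] by (simp add: free_simps)
  show "p \<in> I \<Longrightarrow> q \<in> I \<Longrightarrow> p - q \<in> I" using add[of p "- q"] neg[of q] by simp
qed

lemma coset_eq_iff: "I +>\<^bsub>free_algebra\<^esub> p = I +>\<^bsub>free_algebra\<^esub> q \<longleftrightarrow> p - q \<in> I"
  using ring.quotient_eq_iff_same_a_r_cos[OF ring_free I, of p q] by (auto simp: free_simps diff_free)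

lemma quotient_simps:
  "carrier (quotient_algebra free_algebra I) = range (\<lambda>p. I +>\<^bsub>free_algebra\<^esub> p)"
  "(I +>\<^bsub>free_algebra\<^esub> p) \<otimes>\<^bsub>quotient_algebra free_algebra I\<^esub> (I +>\<^bsub>free_algebra\<^esub> q) = I +>\<^bsub>free_algebra\<^esub> (p * q)"
  "(I +>\<^bsub>free_algebra\<^esub> p) \<oplus>\<^bsub>quotient_algebra free_algebra I\<^esub> (I +>\<^bsub>free_algebra\<^esub> q) = I +>\<^bsub>free_algebra\<^esub> (p + q)"
  "\<one>\<^bsub>quotient_algebra free_algebra I\<^esub> = I +>\<^bsub>free_algebra\<^esub> 1"
  "\<zero>\<^bsub>quotient_algebra free_algebra I\<^esub> = I +>\<^bsub>free_algebra\<^esub> 0"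
  "c \<odot>\<^bsub>quotient_algebra free_algebra I\<^esub> (I +>\<^bsub>free_algebra\<^esub> p) = I +>\<^bsub>free_algebra\<^esub> pm_scale c p"
  "hcomp (quotient_algebra free_algebra I) n =
    (\<lambda>p. I +>\<^bsub>free_algebra\<^esub> p) ` {p. \<forall>w\<in>Poly_Mapping.keys p. length w = n}"
proof -
  show "carrier (quotient_algebra free_algebra I) = range (\<lambda>p. I +>\<^bsub>free_algebra\<^esub> p)"
    by (auto simp: quotient_algebra_def FactRing_def A_RCOSETS_def' free_simps)
  show "(I +>\<^bsub>free_algebra\<^esub> p) \<otimes>\<^bsub>quotient_algebra free_algebra I\<^esub> (I +>\<^bsub>free_algebra\<^esub> q) = I +>\<^bsub>free_algebra\<^esub> (p * q)"
    using I.rcoset_mult_add[of p q] by (simp add: quotient_algebra_def FactRing_def free_simps)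
  show "(I +>\<^bsub>free_algebra\<^esub> p) \<oplus>\<^bsub>quotient_algebra free_algebra I\<^esub> (I +>\<^bsub>free_algebra\<^esub> q) = I +>\<^bsub>free_algebra\<^esub> (p + q)"
    using I.a_rcos_sum[of p q] by (simp add: quotient_algebra_def FactRing_def free_simps)
  show "\<one>\<^bsub>quotient_algebra free_algebra I\<^esub> = I +>\<^bsub>free_algebra\<^esub> 1"
    by (simp add: quotient_algebra_def FactRing_def free_simps)
  show "\<zero>\<^bsub>quotient_algebra free_algebra I\<^esub> = I +>\<^bsub>free_algebra\<^esub> 0"
    using ring.a_rcos_zero[OF ring_free I ideal_simps(1)] by (simp add: quotient_algebra_def FactRing_def free_simps)
  show "hcomp (quotient_algebra free_algebra I) n =
    (\<lambda>p. I +>\<^bsub>free_algebra\<^esub> p) ` {p. \<forall>w\<in>Poly_Mapping.keys p. length w = n}"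
    by (simp add: quotient_algebra_def free_simps)
  have p: "p \<in> I +>\<^bsub>free_algebra\<^esub> p" using ideal_simps(1) by (auto simp: a_r_coset_def' free_simps)
  have "I +>\<^bsub>free_algebra\<^esub> pm_scale c x = I +>\<^bsub>free_algebra\<^esub> pm_scale c p" if x: "x \<in> I +>\<^bsub>free_algebra\<^esub> p" for x
  proof -
    obtain i where "i \<in> I" "x = i + p" using x by (auto simp: a_r_coset_def' free_simps)
    then have "pm_scale c x - pm_scale c p = Poly_Mapping.single [] c * i"
      by (simp add: pm_scale_times distrib_left)
    then show ?thesis using ideal_simps(5)[OF \<open>i \<in> I\<close>] by (simp add: coset_eq_iff)
  qed
  then have "(\<Union>x\<in>I +>\<^bsub>free_algebra\<^esub> p. I +>\<^bsub>free_algebra\<^esub> pm_scale c x) = I +>\<^bsub>free_algebra\<^esub> pm_scale c p"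
    using p by blast
  then show "c \<odot>\<^bsub>quotient_algebra free_algebra I\<^esub> (I +>\<^bsub>free_algebra\<^esub> p) = I +>\<^bsub>free_algebra\<^esub> pm_scale c p"
    by (simp only: quotient_algebra_def module.simps free_simps)
qed

end

section \<open>The presented algebra is the algebra of normal words\<close>

definition rels :: "(generator list \<Rightarrow>\<^sub>0 'k::field) set"
  where "rels = {gen gx * gen gx + gen gy * gen gx, gen gx * gen gz, gen gz * gen gy}"

definition idA :: "(generator list \<Rightarrow>\<^sub>0 'k::field) set"
  where "idA = Idl\<^bsub>free_algebra\<^esub> rels"

lemma ideal_idA: "ideal idA free_algebra"
  unfolding idA_def by (rule ring.genideal_ideal[OF ring_free]) (simp add: free_simps)

lemma rels_idA: "rels \<subseteq> idA"
  unfolding idA_def by (rule ring.genideal_self[OF ring_free]) (simp add: free_simps)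

primrec letter :: "generator \<Rightarrow> (wordA, 'k::field) malg"
  where "letter gx = XA" | "letter gy = - YA" | "letter gz = ZA"

primrec word :: "generator list \<Rightarrow> (wordA, 'k::field) malg"
  where "word [] = 1" | "word (a # w) = letter a * word w"

text \<open>Accounts for the change of y to -y: a normal word in the original generators equals this
  sign times the same word in XA, YA, ZA.\<close>

definition sg :: "generator list \<Rightarrow> 'k::field" where "sg w = (-1) ^ count_list w gy"

lemma sg_simps: "sg [] = 1" "sg (a # w) = (if a = gy then - sg w else sg w)" "sg w * sg w = 1"
  by (simp_all add: sg_def power_mult_distrib[symmetric])

definition ev :: "(generator list \<Rightarrow>\<^sub>0 'k::field) \<Rightarrow> (wordA, 'k) malg"
  where "ev = lin (\<lambda>w c. scal c * word w)"

text \<open>A linear section of \<open>ev\<close>: the normal form, written in the original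
  generators.\<close>

definition lift :: "(wordA, 'k::field) malg \<Rightarrow> (generator list \<Rightarrow>\<^sub>0 'k)"
  where "lift f = lin (\<lambda>w c. Poly_Mapping.single (Rep_wordA w) (sg (Rep_wordA w) * c)) (cf f)"

lemma additive_scal_times: "additive (\<lambda>c. scal c * f)"
  by (simp add: additive_def scal_add distrib_right)

lemma additive_ev: "additive ev"
  unfolding ev_def by (intro additive_lin additive_scal_times)

lemma ev_single: "ev (Poly_Mapping.single w c) = scal c * word w"
  unfolding ev_def by (rule lin_single[OF additive_scal_times])

lemma additive_single_times: "additive (\<lambda>c. Poly_Mapping.single w (d * c :: 'k::field))"
  by (simp add: additive_def distrib_left single_add)

lemma additive_lift: "additive lift"
  unfolding lift_def by (intro additive_compose[OF additive_lin additive_cf] additive_single_times)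

lemma lift_W: "A.normal l \<Longrightarrow> lift (wA.W l c) = Poly_Mapping.single l (sg l * c)"
  unfolding lift_def wA.W_def cf_mon
  by (subst lin_single[OF additive_single_times]) (simp add: wA.Rep_Abs)

lemmas ev_simps = additiveD[OF additive_ev] and lift_simps = additiveD[OF additive_lift]

lemma word_append: "word (v @ w) = word v * word w"
  by (induction v) (simp_all add: mult.assoc)

lemma ev_times: "ev (p * q) = ev p * ev q"
proof -
  have "Poly_Mapping.keys p \<subseteq> UNIV" by simp
  then show ?thesis
  proof (induction rule: pm_induct_keys)
    case (single v c)
    have "Poly_Mapping.keys q \<subseteq> UNIV" by simp
    then show ?case
    proof (induction rule: pm_induct_keys)
      case (single w d)
      have "scal (c * d) * (word v * word w) = scal c * (scal d * word v) * word w"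
        by (simp only: scal_mult mult.assoc)
      also have "\<dots> = scal c * word v * (scal d * word w)"
        by (simp only: scal_central[of d "word v"] mult.assoc)
      finally show ?case by (simp add: single_append ev_single word_append)
    qed (simp_all add: ev_simps distrib_left)
  qed (simp_all add: ev_simps distrib_right)
qed

lemma word_normal: "A.normal l \<Longrightarrow> (word l :: (wordA, 'k::field) malg) = scal (sg l) * wA.W l 1"
proof (induction l)
  case Nil
  then show ?case by (simp add: sg_simps wA.W_def mon_zone_one zone_wordA_def[symmetric])
next
  case (Cons a l)
  have W: "(wA.W (a # l) 1 :: (wordA, 'k) malg) = wA.lt a * wA.W l 1" by (rule wA.W_Cons[OF Cons.prems])
  have "(word (a # l) :: (wordA, 'k) malg) = letter a * (scal (sg l) * wA.W l 1)" using Cons by simp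
  also have "\<dots> = scal (sg l) * (letter a * wA.W l 1)"
    by (metis mult.assoc scal_central)
  also have "\<dots> = scal (sg (a # l)) * wA.W (a # l) 1"
    using W by (cases a) (simp_all add: sg_simps mon_minus)
  finally show ?case .
qed

lemma scal_W: "scal c * wA.W l d = wA.W l (c * d)"
  by (simp add: wA.W_def scal_times_mon)

lemma ev_lift: "ev (lift f) = f"
proof (induction f rule: wA.W_induct_all)
  case (W l c)
  have "scal (sg l * c) * (scal (sg l) * wA.W l 1) = wA.W l (sg l * sg l * c)"
    by (simp add: scal_W algebra_simps)
  then show ?case using W by (simp add: lift_W ev_single word_normal sg_simps)
qed (simp_all add: ev_simps lift_simps)

lemma ev_rels: "p \<in> rels \<Longrightarrow> ev p = 0"
  by (auto simp: rels_def gen_def single_append ev_simps ev_single mon_zone_one relA)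

lemma idA_ker:
  fixes p :: "generator list \<Rightarrow>\<^sub>0 'k::field"
  assumes "p \<in> idA"
  shows "ev p = 0"
proof -
  have "ideal {p :: generator list \<Rightarrow>\<^sub>0 'k::field. ev p = 0} free_algebra"
  proof (rule idealI[OF ring_free])
    show "subgroup {p :: generator list \<Rightarrow>\<^sub>0 'k. ev p = 0} (add_monoid free_algebra)"
    proof (rule subgroup.intro)
      fix p :: "generator list \<Rightarrow>\<^sub>0 'k" assume "p \<in> {p. ev p = 0}"
      moreover have "inv\<^bsub>add_monoid free_algebra\<^esub> p = - p" using minus_free[of p] by (simp add: a_inv_def)
      ultimately show "inv\<^bsub>add_monoid free_algebra\<^esub> p \<in> {p. ev p = 0}" by (simp only: mem_Collect_eq ev_simps minus_zero)
    qed (auto simp: free_simps ev_simps)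
  qed (auto simp: free_simps ev_times)
  then have "idA \<subseteq> {p :: generator list \<Rightarrow>\<^sub>0 'k. ev p = 0}"
    unfolding idA_def using ev_rels by (intro ring.genideal_minimal[OF ring_free]) auto
  then show ?thesis using assms by blast
qed

lemmas idA_simps = ideal_simps[OF ideal_idA]

text \<open>The rewriting rules as members of the ideal, with an arbitrary tail. The last one comes
  from the overlap z y x: it is z times the first relation minus a multiple of z y.\<close>

lemma idA_words:
  "Poly_Mapping.single (gx # gz # w) c \<in> idA" "Poly_Mapping.single (gz # gy # w) c \<in> idA"
  "Poly_Mapping.single (gx # gx # w) c + Poly_Mapping.single (gy # gx # w) c \<in> idA"
  "Poly_Mapping.single (gz # gx # gx # w) c \<in> idA"
proof -
  have r: "gen gx * gen gx + gen gy * gen gx \<in> idA" "gen gx * gen gz \<in> idA" "gen gz * gen gy \<in> idA"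
    using rels_idA by (auto simp: rels_def)
  show "Poly_Mapping.single (gx # gz # w) c \<in> idA"
    using idA_simps(6)[OF r(2), of "Poly_Mapping.single w c"] by (simp add: mult.assoc gen_times_single)
  show zy: "Poly_Mapping.single (gz # gy # w) c \<in> idA" for w
    using idA_simps(6)[OF r(3), of "Poly_Mapping.single w c"] by (simp add: mult.assoc gen_times_single)
  show xx: "Poly_Mapping.single (gx # gx # w) c + Poly_Mapping.single (gy # gx # w) c \<in> idA"
    using idA_simps(6)[OF r(1), of "Poly_Mapping.single w c"]
    by (simp add: mult.assoc gen_times_single distrib_right)
  have "gen gz * (Poly_Mapping.single (gx # gx # w) c + Poly_Mapping.single (gy # gx # w) c) -
      Poly_Mapping.single (gz # gy # gx # w) c \<in> idA"
    by (rule idA_simps(4)[OF idA_simps(5)[OF xx] zy])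
  then show "Poly_Mapping.single (gz # gx # gx # w) c \<in> idA"
    by (simp add: distrib_left gen_times_single)
qed

text \<open>If no rule applies, prefixing the letter gives a normal word and the difference is 0;
  otherwise one of the four rules applies and \<open>idA_words\<close> puts the difference into the
  ideal.\<close>

lemma gen_lift: "gen a * lift f - lift (letter a * f) \<in> idA"
proof (induction f rule: wA.W_induct_all)
  case zero
  then show ?case by (simp add: lift_simps idA_simps)
next
  case (add p q)
  from idA_simps(2)[OF add] show ?case by (simp add: lift_simps distrib_left algebra_simps)
next
  case (W l c)
  show ?case
  proof (cases "lmA a l = Some (a # l)")
    case True
    then have n: "A.normal (a # l)" using W by simp
    have "letter a * wA.W l c = wA.W (a # l) (if a = gy then - c else c)"
      using wA.W_Cons[OF n, of c] wA.W_Cons[OF n, of "- c"]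
      by (cases a) (simp_all add: wA.W_def mon_minus)
    then have "lift (letter a * wA.W l c) = gen a * lift (wA.W l c)"
      using W by (simp add: lift_W[OF n] lift_W gen_times_single sg_simps)
    then show ?thesis by (simp add: idA_simps)
  next
    case False
    then consider w where "a = gx" "l = gz # w" | w where "a = gy" "l = gx # w"
      | w where "a = gz" "l = gy # w" | w where "a = gz" "l = gx # gx # w"
      by (cases "(a, l)" rule: lmA.cases) auto
    then show ?thesis
    proof cases
      case (1 w)
      have "letter a * wA.W l c = 0" using W by (simp add: 1 wA.lt_times_W)
      then show ?thesis using W idA_words(1) by (simp add: 1 lift_W lift_simps gen_times_single)
    next
      case (2 w)
      have n: "A.normal (gx # gx # w)" using W 2 by (auto simp: lmA_gx)
      have "letter a * wA.W l c = - wA.W (gx # gx # w) c" using W by (simp add: 2 wA.lt_times_W)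
      then show ?thesis using W n idA_words(3)[of w "sg w * c"]
        by (simp add: 2 lift_W lift_simps gen_times_single sg_simps add.commute del: A.normal.simps)
    next
      case (3 w)
      have "letter a * wA.W l c = 0" using W by (simp add: 3 wA.lt_times_W)
      then show ?thesis using W idA_words(2) by (simp add: 3 lift_W lift_simps gen_times_single)
    next
      case (4 w)
      have "letter a * wA.W l c = 0" using W by (simp add: 4 wA.lt_times_W)
      then show ?thesis using W idA_words(4) by (simp add: 4 lift_W lift_simps gen_times_single)
    qed
  qed
qed

text \<open>Reduction to normal form, one letter at a time, does not leave the coset. With
  \<open>ev_lift\<close> and \<open>idA_ker\<close> this makes the ideal the kernel of
  \<open>ev\<close>, so the normal words are a basis of the presented algebra.\<close>

lemma lift_ev: "p - lift (ev p) \<in> idA"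
proof -
  have "Poly_Mapping.keys p \<subseteq> UNIV" by simp
  then show ?thesis
  proof (induction rule: pm_induct_keys)
    case zero
    then show ?case by (simp add: ev_simps lift_simps idA_simps)
  next
    case (add p q)
    from idA_simps(2)[OF add.IH] show ?case by (simp add: ev_simps lift_simps algebra_simps)
  next
    case (single w c)
    show ?case
    proof (induction w)
      case Nil
      have "scal c = wA.W [] c" by (simp add: wA.W_def zone_wordA_def)
      then show ?case by (simp add: ev_single lift_W sg_simps idA_simps)
    next
      case (Cons a w)
      have ev: "ev (Poly_Mapping.single (a # w) c) = letter a * ev (Poly_Mapping.single w c)"
        by (simp only: ev_single word.simps mult.assoc[symmetric] scal_central[of c "letter a"])
      from idA_simps(2)[OF idA_simps(5)[OF Cons, of "gen a"] gen_lift[of a "ev (Poly_Mapping.single w c)"]]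
      show ?case by (simp add: ev right_diff_distrib gen_times_single)
    qed
  qed
qed

definition rhoA :: "(wordA, 'k::field) malg \<Rightarrow> (generator list \<Rightarrow>\<^sub>0 'k) set"
  where "rhoA f = idA +>\<^bsub>free_algebra\<^esub> lift f"

lemma coset_rhoA: "idA +>\<^bsub>free_algebra\<^esub> p = rhoA (ev p)"
  unfolding rhoA_def coset_eq_iff[OF ideal_idA] by (rule lift_ev)

lemma word_hom: "word w \<in> hom (length w)"
proof (induction w)
  case Nil
  then show ?case using hom_scal[of 1] by (simp add: mon_zone_one)
next
  case (Cons a w)
  have "letter a \<in> hom 1" using wA.lt_hom hom_minus by (cases a) auto
  from hom_mult[OF this Cons] show ?case by simp
qed

lemma graded_model_A:
  "graded_model (presented_algebra rels) (rhoA :: (wordA, 'k::field) malg \<Rightarrow> _)"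
proof -
  have A: "presented_algebra (rels :: (generator list \<Rightarrow>\<^sub>0 'k) set) = quotient_algebra free_algebra idA"
    by (simp add: presented_algebra_def idA_def)
  note qs = quotient_simps[OF ideal_idA]
  show ?thesis
    unfolding A
  proof
    show "inj (rhoA :: (wordA, 'k) malg \<Rightarrow> _)"
    proof (rule injI)
      fix f g :: "(wordA, 'k) malg" assume "rhoA f = rhoA g"
      then have "lift f - lift g \<in> idA" by (simp add: rhoA_def coset_eq_iff[OF ideal_idA])
      then have "ev (lift f - lift g) = 0" by (rule idA_ker)
      then show "f = g" by (simp add: ev_simps ev_lift)
    qed
    show "carrier (quotient_algebra free_algebra idA) = range rhoA"
    proof
      show "carrier (quotient_algebra free_algebra idA) \<subseteq> range rhoA" unfolding qs(1) coset_rhoA by blast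
      show "range rhoA \<subseteq> carrier (quotient_algebra free_algebra idA)" unfolding qs(1) rhoA_def by blast
    qed
    fix f g :: "(wordA, 'k) malg" and c :: 'k and n :: nat
    show "rhoA f \<oplus>\<^bsub>quotient_algebra free_algebra idA\<^esub> rhoA g = rhoA (f + g)"
    proof -
      have "rhoA f \<oplus>\<^bsub>quotient_algebra free_algebra idA\<^esub> rhoA g = idA +>\<^bsub>free_algebra\<^esub> (lift f + lift g)"
        unfolding rhoA_def by (rule qs(3))
      then show ?thesis by (simp only: coset_rhoA ev_simps ev_lift)
    qed
    show "rhoA f \<otimes>\<^bsub>quotient_algebra free_algebra idA\<^esub> rhoA g = rhoA (f * g)"
    proof -
      have "rhoA f \<otimes>\<^bsub>quotient_algebra free_algebra idA\<^esub> rhoA g = idA +>\<^bsub>free_algebra\<^esub> (lift f * lift g)"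
        unfolding rhoA_def by (rule qs(2))
      then show ?thesis by (simp only: coset_rhoA ev_times ev_lift)
    qed
    show "\<zero>\<^bsub>quotient_algebra free_algebra idA\<^esub> = rhoA 0"
      by (simp only: qs coset_rhoA ev_simps)
    show "\<one>\<^bsub>quotient_algebra free_algebra idA\<^esub> = rhoA 1"
      by (simp only: qs coset_rhoA one_single ev_single word.simps mon_zone_one mult_1_left)
    show "c \<odot>\<^bsub>quotient_algebra free_algebra idA\<^esub> rhoA f = rhoA (scal c * f)"
    proof -
      have "c \<odot>\<^bsub>quotient_algebra free_algebra idA\<^esub> rhoA f = idA +>\<^bsub>free_algebra\<^esub> pm_scale c (lift f)"
        unfolding rhoA_def by (rule qs(6))
      then show ?thesis
        by (simp only: coset_rhoA pm_scale_times ev_times ev_single word.simps mult_1_right ev_lift)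
    qed
    show "hcomp (quotient_algebra free_algebra idA) n = rhoA ` (hom n :: (wordA, 'k) malg set)"
    proof
      show "hcomp (quotient_algebra free_algebra idA) n \<subseteq> rhoA ` (hom n :: (wordA, 'k) malg set)" (is "?H \<subseteq> _")
      proof
        fix cs assume "cs \<in> ?H"
        then obtain p :: "generator list \<Rightarrow>\<^sub>0 'k"
          where p: "\<forall>w\<in>Poly_Mapping.keys p. length w = n" and cs: "cs = rhoA (ev p)"
          unfolding qs coset_rhoA by blast
        have "ev p \<in> hom n" unfolding ev_def lin_def
          using p by (intro hom_sum hom_scal_times) (metis word_hom)
        then show "cs \<in> rhoA ` hom n" unfolding cs by blast
      qed
      show "rhoA ` (hom n :: (wordA, 'k) malg set) \<subseteq> hcomp (quotient_algebra free_algebra (idA :: (generator list \<Rightarrow>\<^sub>0 'k) set)) n"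
      proof safe
        fix f :: "(wordA, 'k) malg" assume f: "f \<in> (hom n :: (wordA, 'k) malg set)"
        have "length w = n" if "w \<in> Poly_Mapping.keys (lift f)" for w
          using that f keys_lin[of "\<lambda>w c. Poly_Mapping.single (Rep_wordA w) (sg (Rep_wordA w) * c)" "cf f"]
          by (fastforce simp: lift_def hom_def zdeg_wordA_def split: if_splits)
        then show "rhoA f \<in> hcomp (quotient_algebra free_algebra (idA :: (generator list \<Rightarrow>\<^sub>0 'k) set)) n" unfolding qs rhoA_def by blast
      qed
    qed
  qed
qed

section \<open>A copy of the dual algebra\<close>

text \<open>
  The dual conjecture is stated over the carrier type of \<open>A\<close>; the dual algebra is moved there by
  encoding each element as a singleton set.
\<close>

definition copy_algebra :: "(('w::zmonoid, 'k::field) malg \<Rightarrow> 'a) \<Rightarrow> ('k, 'a) graded_algebra"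
  where "copy_algebra \<rho> = \<lparr>carrier = range \<rho>,
    monoid.mult = (\<lambda>s t. \<rho> (inv_into UNIV \<rho> s * inv_into UNIV \<rho> t)), one = \<rho> 1, zero = \<rho> 0,
    add = (\<lambda>s t. \<rho> (inv_into UNIV \<rho> s + inv_into UNIV \<rho> t)),
    module.smult = (\<lambda>c s. \<rho> (scal c * inv_into UNIV \<rho> s)), hcomp = (\<lambda>n. \<rho> ` hom n)\<rparr>"

lemma graded_model_copy: "inj \<rho> \<Longrightarrow> graded_model (copy_algebra \<rho>) \<rho>"
  by unfold_locales (simp_all add: copy_algebra_def)

definition rhoB :: "(wordB, 'k::field) malg \<Rightarrow> (generator list \<Rightarrow>\<^sub>0 'k) set"
  where "rhoB f = {lin (\<lambda>w. Poly_Mapping.single (Rep_wordB w)) (cf f)}"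

lemma inj_rhoB: "inj (rhoB :: (wordB, 'k::field) malg \<Rightarrow> _)"
proof (rule injI)
  fix f g :: "(wordB, 'k) malg" assume eq: "rhoB f = rhoB g"
  have add: "additive (lin (\<lambda>w. Poly_Mapping.single (Rep_wordB w)) :: (wordB \<Rightarrow>\<^sub>0 'k) \<Rightarrow> _)"
    by (intro additive_lin additive_single)
  have "lin (\<lambda>w. Poly_Mapping.single (Rep_wordB w)) (cf f - cf g) = 0"
    using eq by (simp add: rhoB_def additiveD(4)[OF add])
  then have "cf f - cf g = 0"
    by (rule lin_inj_single_zero) (auto intro: inj_onI simp: Rep_wordB_inject)
  then show "f = g" by (simp add: malg_eq_iff)
qed

text \<open>In a normal word \<open>gx\<close> can be followed only by \<open>gy\<close> and
  \<open>gy\<close> only by \<open>gz\<close>, while after \<open>gz\<close> there is room for at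
  most one \<open>gy\<close>.\<close>

lemma B_normal_length: "B.normal l \<Longrightarrow> length l \<le> 4"
proof -
  have y: "length l \<le> 2" if "B.normal (gy # l)" for l
    using that B_normal_gz[of "tl l"] by (cases l rule: generator_list_cases) (auto simp: lmB_gy)
  have x: "length l \<le> 3" if "B.normal (gx # l)" for l
    using that y[of "tl l"] by (cases l rule: generator_list_cases) (auto simp: lmB_gx)
  assume "B.normal l"
  then show ?thesis
    using x[of "tl l"] y[of "tl l"] B_normal_gz[of "tl l"] by (cases l rule: generator_list_cases) auto
qed

section \<open>The counterexample\<close>

theorem mainTheorem1:
  fixes A :: "('k::field, (generator list \<Rightarrow>\<^sub>0 'k) set) graded_algebra"
  assumes A_def: "A = presented_algebra
      {gen gx * gen gx + gen gy * gen gx, gen gx * gen gz, gen gz * gen gy}"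
    and universe: "infinite (UNIV :: 'm set)" "\<exists>\<iota> :: 'k \<Rightarrow> 'm. inj \<iota>"
  shows "koszul A \<and>
    gldim TYPE('m) A = 4 \<and>
    \<not> positselski_conjecture TYPE('k) TYPE((generator list \<Rightarrow>\<^sub>0 'k) set) TYPE('m) \<and>
    \<not> positselski_conjecture_dual TYPE('k) TYPE((generator list \<Rightarrow>\<^sub>0 'k) set)"
proof -
  have A: "A = presented_algebra rels" by (simp add: A_def rels_def)
  interpret A: graded_xyz A "rhoA :: (wordA, 'k) malg \<Rightarrow> _" XA "- YA" ZA
    unfolding A by (intro graded_xyz.intro graded_model_A xyz_algebra_A)
  let ?B = "copy_algebra (rhoB :: (wordB, 'k) malg \<Rightarrow> _)"
  interpret B: graded_model ?B "rhoB :: (wordB, 'k) malg \<Rightarrow> _"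
    by (rule graded_model_copy[OF inj_rhoB])
  have koszul_A: "koszul A" using koszul_filtration_A A.koszul_model by blast
  have koszul_B: "koszul ?B" using koszul_filtration_B B.koszul_model by blast
  obtain i :: "nat \<Rightarrow> 'm" where i: "inj i" using inj_nat_infinite[OF universe(1)] by blast
  have "inj (\<lambda>a. case a of gx \<Rightarrow> 0 :: nat | gy \<Rightarrow> 1 | gz \<Rightarrow> 2)"
    by (rule injI) (simp split: generator.splits)
  then have "\<exists>f :: generator \<Rightarrow> 'm. inj f" using inj_compose[OF i] by blast
  then obtain j :: "generator list \<Rightarrow> 'm" where j: "inj j" using inj_list_into[OF universe(1)] by blast
  have "inj Rep_wordA" by (rule injI) (simp add: Rep_wordA_inject)
  then have "\<exists>f :: wordA \<Rightarrow> 'm. inj f" using inj_compose[OF j] by blast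
  then have gldim: "gldim TYPE('m) A = 4" by (rule A.gldim_eq_4[OF universe(1) _ universe(2)])
  have "kdim A (hcomp A 1) = 3"
    using A.kdim_hcomp[of 1] wA.card_degree_1 card_generator by simp
  then have neg: "\<not> positselski_conjecture TYPE('k) TYPE((generator list \<Rightarrow>\<^sub>0 'k) set) TYPE('m)"
    unfolding positselski_conjecture_def using koszul_A gldim
    by (intro notI) (drule spec[of _ A], drule spec[of _ 4], simp add: numeral_eq_enat)
  have "kdim ?B (hcomp ?B 1) = 3"
    using B.kdim_hcomp[of 1] wB.card_degree_1 card_generator by simp
  moreover have "hcomp ?B 5 = {\<zero>\<^bsub>?B\<^esub>}"
  proof -
    have "hom 5 \<subseteq> {0 :: (wordB, 'k) malg}"
    proof
      fix f :: "(wordB, 'k) malg" assume f: "f \<in> hom 5"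
      have "wB.cl f l = wB.cl 0 l" if l: "B.normal l" for l
        using f l B_normal_length[OF l] by (auto simp: wB.hom_iff wB.cl_simps)
      then show "f \<in> {0}" using wB.cl_eqI[of f 0] by simp
    qed
    then have "hom 5 = {0 :: (wordB, 'k) malg}" by auto
    then show ?thesis by (simp add: B.hcomp_model B.zero_model)
  qed
  moreover have "hcomp ?B 4 \<noteq> {\<zero>\<^bsub>?B\<^esub>}"
  proof
    \<comment> \<open>The only normal word of length 4, the counterpart of the last syzygy
      \<open>uxzy\<close>.\<close>
    let ?l = "[gx, gy, gz, gy]"
    assume "hcomp ?B 4 = {\<zero>\<^bsub>?B\<^esub>}"
    then have sub: "hom 4 = {0 :: (wordB, 'k) malg}"
      using inj_image_eq_iff[OF inj_rhoB, of "hom 4 :: (wordB, 'k) malg set" "{0}"] by (simp add: B.hcomp_model B.zero_model)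
    have n: "B.normal ?l" by (simp add: lmB_simps)
    have "wB.W ?l 1 \<in> (hom 4 :: (wordB, 'k) malg set)" using wB.W_hom[OF n, of 1] by (simp add: eval_nat_numeral)
    then have "wB.W ?l 1 = (0 :: (wordB, 'k) malg)" using sub by blast
    then show False using wB.cl_W[OF n n, of "1 :: 'k"] by (simp add: wB.cl_simps)
  qed
  ultimately have "\<not> positselski_conjecture_dual TYPE('k) TYPE((generator list \<Rightarrow>\<^sub>0 'k) set)"
    unfolding positselski_conjecture_dual_def using koszul_B
    by (intro notI) (drule spec[of _ ?B], drule spec[of _ 4], simp)
  then show ?thesis using koszul_A gldim neg by blast
qed

end
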